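(* Let $R>0$ and $k\in\mathbb N$, $k\ge2$, and write $B_R^+=\{(x,y)\in\mathbb R^2: x^2+y^2<R^2,\ y>0\}$. For $\varepsilon\ge 0$ and $y>0$ let $$u_{\varepsilon,k}(x,y)=\left(\frac12+\frac{\arctan(x/y)}\pi\right)\mathrm{Re}\big((x+iy)^k\big)-\frac{\log(x^2+y^2+\varepsilon^2)}{2\pi}\,\mathrm{Im}\big((x+iy)^k\big),$$ and $u_k=u_{0,k}$. There exists $\varepsilon_0>0$ depending on $R$ and $k$ such that the following hold. (1) There is a constant $C$ depending on $k$ and $R$, but not on $\varepsilon$, such that $\|u_{\varepsilon,k}\|_{\mathcal B_k(B_R^+)}\le C|\log\varepsilon|$ for all $\varepsilon\in(0,\varepsilon_0)$. (2) There exist constants $c,C>0$ such that for all $p\in[1,\infty]$ and all sufficiently small $\varepsilon\in(0,\varepsilon_0)$, $$c\,R^{k-2}\varepsilon^2\le\|u_{\varepsilon,k}-u_k\|_{L^p(B_R^+)}\le C\,R^{k-2}\varepsilon^2.$$ (3) There exists a constant $C>0$ such that for all $p\in[1,\infty]$ and all $\varepsilon\in(0,\varepsilon_0)$, $$\|\nabla(u_{\varepsilon,k}-u_k)\|_{L^p(B_R^+)}\le C\,\varepsilon^{2/p}.$$ (4) For all $p\in[1,\infty]$ there exists a constant $C>0$ depending on $k,p,R$ such that for all $\varepsilon\in(0,\varepsilon_0)$, $$\|D^2(u_{\varepsilon,k}-u_k)\|_{L^p(B_R^+)}\le C\,\varepsilon^{2/p}\quad\text{if }k>2\text{ or }p>1,$$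 and $\|D^2(u_{\varepsilon,k}-u_k)\|_{L^p(B_R^+)}\le C\,\varepsilon^2|\log\varepsilon|$ if $k=2$ and $p=1$.
   Context: For $\alpha>0$ let $\sigma_\alpha(z)=\max\{z,0\}^\alpha$ for $z\in\mathbb R$. For a Borel probability measure $\pi$ on $\mathbb R\times\mathbb R^d\times\mathbb R$ set $f_{\pi,\alpha}(x)=\mathbb E_{(a,w,b)\sim\pi}[a\,\sigma_\alpha(w^Tx+b)]$, $x\in\mathbb R^d$. For $D\subseteq\mathbb R^d$ and a continuous function $f:D\to\mathbb R$, $$\|f\|_{\mathcal B_\alpha(D)}=\inf\{\mathbb E_{(a,w,b)\sim\pi}[|a|(|w|+|b|)^\alpha] : f(x)=f_{\pi,\alpha}(x)\text{ for all }x\in D\}.$$ For $p=\infty$, $2/p$ is read as $0$. $D^2$ denotes the Hessian.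
   Formalization: In (4) the case k=2, p=∞ is excluded, since there the mixed derivative of u_{ε,2}−u_2 equals −log(1+ε²/r²)/π plus bounded terms, so the L^∞ norm of D² is infinite for every ε>0; constants in (2) and (3) may depend on R and k. *)

theory Defs
  imports "HOL-Probability.Probability"
begin

section \<open>Barron norms with activation $\max\{z,0\}^\alpha$\<close>

text \<open>Only used for \<open>\<alpha> > 0\<close>, where \<open>0 powr \<alpha> = 0\<close> is the correct value.\<close>

definition relu_pow :: "real \<Rightarrow> real \<Rightarrow> real" where
  "relu_pow \<alpha> z = max z 0 powr \<alpha>"

definition neuron :: "real \<Rightarrow> real ^ 'n \<Rightarrow> real \<times> (real ^ 'n) \<times> real \<Rightarrow> real" where
  "neuron \<alpha> x = (\<lambda>(a, w, b). a * relu_pow \<alpha> (w \<bullet> x + b))"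

definition barron_cost :: "real \<Rightarrow> real \<times> (real ^ 'n) \<times> real \<Rightarrow> real" where
  "barron_cost \<alpha> = (\<lambda>(a, w, b). \<bar>a\<bar> * (norm w + \<bar>b\<bar>) powr \<alpha>)"

definition barron_represents ::
  "(real \<times> (real ^ 'n) \<times> real) measure \<Rightarrow> real \<Rightarrow> (real ^ 'n) set \<Rightarrow> (real ^ 'n \<Rightarrow> real) \<Rightarrow> bool" where
  "barron_represents \<pi> \<alpha> D f \<longleftrightarrow>
     prob_space \<pi> \<and> sets \<pi> = sets borel \<and>
     (\<forall>x\<in>D. integrable \<pi> (neuron \<alpha> x) \<and> f x = integral\<^sup>L \<pi> (neuron \<alpha> x))"

text \<open>
  The infimum is taken in \<open>[0, \<infinity>]\<close>, so that it is \<open>\<infinity>\<close> if no measure of finite cost represents \<open>f\<close>.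
\<close>

definition barron_norm :: "real \<Rightarrow> (real ^ 'n) set \<Rightarrow> (real ^ 'n \<Rightarrow> real) \<Rightarrow> ennreal" where
  "barron_norm \<alpha> D f =
     (INF \<pi>\<in>{\<pi>. barron_represents \<pi> \<alpha> D f}. \<integral>\<^sup>+ \<theta>. ennreal (barron_cost \<alpha> \<theta>) \<partial>\<pi>)"


section \<open>$L^p$ norms, gradient and Hessian\<close>

text \<open>
  The value is \<open>\<infinity>\<close> for functions that are not measurable or not in \<open>L\<^sup>p\<close>.
\<close>

definition Lp_norm ::
  "ennreal \<Rightarrow> 'a::euclidean_space set \<Rightarrow> ('a \<Rightarrow> 'b::euclidean_space) \<Rightarrow> ennreal" where
  "Lp_norm p D f =
     (if f \<notin> borel_measurable (lebesgue_on D) then \<infinity>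
      else if p = \<infinity> then esssup (lebesgue_on D) (\<lambda>x. ennreal (norm (f x)))
      else (let I = \<integral>\<^sup>+ x. ennreal (norm (f x) powr enn2real p) \<partial>lebesgue_on D
            in if I = \<infinity> then \<infinity> else ennreal (enn2real I powr (1 / enn2real p))))"

definition grad :: "(real ^ 'n \<Rightarrow> real) \<Rightarrow> real ^ 'n \<Rightarrow> real ^ 'n" where
  "grad f x = (\<chi> i. frechet_derivative f (at x) (axis i 1))"

text \<open>The norm on \<open>real ^ 'n ^ 'n\<close> is the Frobenius norm.\<close>

definition hessian :: "(real ^ 'n \<Rightarrow> real) \<Rightarrow> real ^ 'n \<Rightarrow> real ^ 'n ^ 'n" where
  "hessian f x = jacobian (grad f) (at x)"


section \<open>The half disc and the functions $u_{\varepsilon,k}$\<close>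

definition half_disc :: "real \<Rightarrow> (real ^ 2) set" where
  "half_disc R = {v. (v $ 1)\<^sup>2 + (v $ 2)\<^sup>2 < R\<^sup>2 \<and> v $ 2 > 0}"

text \<open>Meaningful only for \<open>v $ 2 > 0\<close>; \<open>u\<^sub>k\<close> is \<open>u_fun 0 k\<close>.\<close>

definition u_fun :: "real \<Rightarrow> nat \<Rightarrow> real ^ 2 \<Rightarrow> real" where
  "u_fun \<epsilon> k v =
     (let x = v $ 1; y = v $ 2 in
      (1 / 2 + arctan (x / y) / pi) * Re (Complex x y ^ k)
      - ln (x\<^sup>2 + y\<^sup>2 + \<epsilon>\<^sup>2) / (2 * pi) * Im (Complex x y ^ k))"

text \<open>
  Pitfall: for \<open>k = 2\<close> and \<open>\<epsilon> > 0\<close> the mixed second derivative of \<open>u_diff \<epsilon> 2\<close> is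
  \<open>- ln (1 + \<epsilon>\<^sup>2 / r\<^sup>2) / pi\<close> plus a bounded function, where \<open>r\<^sup>2 = x\<^sup>2 + y\<^sup>2\<close>. Hence the Hessian
  lies in \<open>L\<^sup>p\<close> of the half disc for every \<open>p < \<infinity>\<close>, but not in \<open>L\<^sup>\<infinity>\<close>.
\<close>

abbreviation u_diff :: "real \<Rightarrow> nat \<Rightarrow> real ^ 2 \<Rightarrow> real" where
  "u_diff \<epsilon> k \<equiv> (\<lambda>v. u_fun \<epsilon> k v - u_fun 0 k v)"

end

theory Submission
  imports Defs
begin

text \<open>
  Write \<open>v = r (cos \<theta>, sin \<theta>)\<close> and \<open>E = \<epsilon>\<^sup>2\<close>. The difference \<open>u\<^sub>\<epsilon> - u\<^sub>0\<close> equals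
  \<open>- ln (1 + E / r\<^sup>2) r\<^sup>k sin (k \<theta>) / (2 \<pi>)\<close>. Each derivative costs one factor \<open>r\<close>, so the \<open>j\<close>-th
  derivatives (\<open>j \<le> 2\<close>) are at most a constant times \<open>r ^ (k - j) ln (1 + E / r\<^sup>2)\<close>, and all
  \<open>L\<^sup>p\<close> estimates reduce to one-dimensional radial integrals.

  For the Barron norm, every neuron is of the form \<open>max (x cos \<phi> + y sin \<phi> - b) 0 ^ k\<close>.
  Homogeneous terms \<open>r\<^sup>k sin (m \<theta>)\<close>, \<open>r\<^sup>k cos (m \<theta>)\<close> and the resonant term \<open>r\<^sup>k \<theta> cos (k \<theta>)\<close> use
  \<open>b = 0\<close> and a bounded density in \<open>\<phi>\<close>. For \<open>r\<^sup>k sin (k \<theta>) ln (r\<^sup>2 + E)\<close> the density is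
  \<open>sin (k \<phi>) g b\<close>. By Rodrigues' formula, integrating it against the neurons gives
  \<open>r\<^sup>k sin (k \<theta>)\<close> times \<open>Q r\<close>, the integral over \<open>\<phi>\<close> of
  \<open>sin \<phi> ^ (2 k) \<psi> (r cos \<phi>)\<close> up to a constant, where \<open>\<psi>' = g\<close>. If \<open>N' = t g\<close> and \<open>N\<close> solves
  \<open>(t\<^sup>2 + E) N' + (2 k + 1) t N = t\<^sup>2\<close>, then an integration by parts shows that \<open>Q' r\<close> is
  proportional to \<open>r / (r\<^sup>2 + E)\<close>. As \<open>\<bar>g t\<bar> \<le> (2 k + 2) \<bar>t\<bar> / (t\<^sup>2 + E)\<close>, the cost is at most a
  constant times \<open>\<bar>ln \<epsilon>\<bar>\<close>.
\<close>

text \<open>Let L = ln (1 + E / r^2). Two bounds compete: L \<le> E / r^2 is good for large r but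
  not integrable at 0 in the plane, whereas L \<le> \<epsilon> / r is integrable at 0. They meet at
  r = \<epsilon>, where the integrals are split. When the Hessian keeps no factor r (k = 2), the
  weighted tail of L^p is r^(1 - 2 p): integrable at infinity for p > 1, but 1 / r for p = 1, which
  costs the logarithm.

  The ODE for N is forced. With T = r cos \<phi> one has r^2 + E = r^2 sin^2 \<phi> + (T^2 + E). In
  r (r^2 + E) Q' r the sin^2 part is integrated by parts, which replaces g by N; the ODE says that
  the terms in g and N then add up to sin \<phi> ^ (2 k) T^2, whose integral is a multiple of r^2.

  The obstacle among the homogeneous terms is \<theta> cos (k \<theta>): trigonometric densities
  only reproduce trigonometric functions, which are periodic. Since only 0 < \<theta> < pi is seen,
  a density cut off to a half circle can produce it.\<close>

section \<open>Derivatives of the difference\<close>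

text \<open>\<open>L_fun\<close> is radial with gradient \<open>M_fun v\<close> times \<open>v\<close>, and \<open>M_fun\<close> has gradient \<open>M2_fun v\<close> times \<open>v\<close>.\<close>

definition L_fun :: "real \<Rightarrow> real^2 \<Rightarrow> real" where
  "L_fun \<epsilon> v = ln ((v$1)\<^sup>2 + (v$2)\<^sup>2 + \<epsilon>\<^sup>2) - ln ((v$1)\<^sup>2 + (v$2)\<^sup>2)"

definition toC :: "real^2 \<Rightarrow> complex" where "toC v = Complex (v$1) (v$2)"

lemma norm_toC: "norm (toC v) = norm v"
  by (simp add: toC_def complex_norm norm_vec_def L2_set_def sum_2)

lemma norm_sq_2: "(norm v)\<^sup>2 = (v$1)\<^sup>2 + (v$2)\<^sup>2" for v :: "real^2"
  by (simp add: norm_vec_def L2_set_def sum_2)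

lemma bounded_linear_toC: "bounded_linear toC"
  by (simp add: linear_conv_bounded_linear[symmetric] linear_iff toC_def complex_eq_iff)

lemma u_diff_eq: "u_fun \<epsilon> k v - u_fun 0 k v = - 1 / (2 * pi) * (L_fun \<epsilon> v * Im (toC v ^ k))"
  by (simp add: u_fun_def L_fun_def toC_def Let_def field_simps)

definition M_fun :: "real \<Rightarrow> real^2 \<Rightarrow> real" where
  "M_fun \<epsilon> v = 2 / ((v$1)\<^sup>2 + (v$2)\<^sup>2 + \<epsilon>\<^sup>2) - 2 / ((v$1)\<^sup>2 + (v$2)\<^sup>2)"
definition M2_fun :: "real \<Rightarrow> real^2 \<Rightarrow> real" where
  "M2_fun \<epsilon> v = 4 / ((v$1)\<^sup>2 + (v$2)\<^sup>2)\<^sup>2 - 4 / ((v$1)\<^sup>2 + (v$2)\<^sup>2 + \<epsilon>\<^sup>2)\<^sup>2"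

lemma sum_squares_pos: "v$2 > 0 \<Longrightarrow> (v$1)\<^sup>2 + (v$2)\<^sup>2 > (0::real)" "v$2 > 0 \<Longrightarrow> (v$1)\<^sup>2 + (v$2)\<^sup>2 + \<epsilon>\<^sup>2 > (0::real)" for v :: "real^2"
  by (simp_all add: add_nonneg_pos add_pos_nonneg)

lemma has_derivative_nth: "((\<lambda>v::real^2. v$i) has_derivative (\<lambda>h. h$i)) F"
  by (intro bounded_linear_imp_has_derivative bounded_linear_vec_nth)

lemma has_derivative_L: assumes "v$2 > 0"
  shows "(L_fun \<epsilon> has_derivative (\<lambda>h. M_fun \<epsilon> v * (v$1 * h$1 + v$2 * h$2))) (at v)"
proof -
  have 2: "((\<lambda>v. ln ((v$1)\<^sup>2 + (v$2)\<^sup>2 + e) :: real) has_derivative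
     (\<lambda>h. 2 / ((v$1)\<^sup>2 + (v$2)\<^sup>2 + e) * (v$1 * h$1 + v$2 * h$2))) (at v)"
    if "(v$1)\<^sup>2 + (v$2)\<^sup>2 + e > 0" for e
    apply (rule has_derivative_eq_rhs)
     apply (rule has_derivative_nth derivative_eq_intros refl that)+
    by (auto simp: fun_eq_iff divide_simps)
  show ?thesis unfolding L_fun_def[abs_def]
    apply (rule has_derivative_eq_rhs)
     apply (rule has_derivative_diff[OF 2[of "\<epsilon>\<^sup>2"] 2[of 0, simplified]])
    using sum_squares_pos[OF assms] by (auto simp: fun_eq_iff M_fun_def algebra_simps)
qed

lemma has_derivative_M: assumes "v$2 > 0"
  shows "(M_fun \<epsilon> has_derivative (\<lambda>h. M2_fun \<epsilon> v * (v$1 * h$1 + v$2 * h$2))) (at v)"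
proof -
  define s where "s = (v$1)\<^sup>2 + (v$2)\<^sup>2"
  have 1: "s > 0" "s + \<epsilon>\<^sup>2 > 0" using sum_squares_pos[OF assms] by (auto simp: s_def)
  have 2: "((\<lambda>v. 2 / ((v$1)\<^sup>2 + (v$2)\<^sup>2 + e) :: real) has_derivative (\<lambda>h. -4 / (s+e)\<^sup>2 * (v$1 * h$1 + v$2 * h$2))) (at v)"
    if "s + e > 0" for e
    apply (rule has_derivative_eq_rhs)
     apply (rule derivative_eq_intros refl has_derivative_nth)+
    using that apply (force simp: s_def)
     apply (rule refl)
    using that unfolding s_def[symmetric]
    by (auto simp: fun_eq_iff divide_simps power2_eq_square)
  show ?thesis unfolding M_fun_def[abs_def]
    apply (rule has_derivative_eq_rhs)
     apply (rule has_derivative_diff[OF 2[of "\<epsilon>\<^sup>2"] 2[of 0, simplified]])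
    using 1 by (auto simp: fun_eq_iff M2_fun_def s_def[symmetric] algebra_simps add_divide_distrib)
qed

lemma has_derivative_toC_power:
  "((\<lambda>v. toC v ^ n) has_derivative (\<lambda>h. of_nat n * toC v ^ (n-1) * toC h)) (at v)"
  apply (rule has_derivative_eq_rhs)
   apply (rule has_derivative_power bounded_linear_imp_has_derivative bounded_linear_toC)+
  by (simp add: fun_eq_iff)

lemma has_derivative_Im_power:
  "((\<lambda>v. Im (toC v ^ n)) has_derivative (\<lambda>h. n * Im (toC v ^ (n-1)) * h$1 + n * Re (toC v ^ (n-1)) * h$2)) (at v)"
  apply (rule has_derivative_eq_rhs)
   apply (rule has_derivative_Im[OF has_derivative_toC_power])
  by (simp add: fun_eq_iff toC_def algebra_simps)

lemma has_derivative_Re_power: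
  "((\<lambda>v. Re (toC v ^ n)) has_derivative (\<lambda>h. n * Re (toC v ^ (n-1)) * h$1 - n * Im (toC v ^ (n-1)) * h$2)) (at v)"
  apply (rule has_derivative_eq_rhs)
   apply (rule has_derivative_Re[OF has_derivative_toC_power])
  by (simp add: fun_eq_iff toC_def algebra_simps)

text \<open>The product rule, where the Cauchy-Riemann equations give the partial derivatives k Im
  z^(k-1) and k Re z^(k-1) of Im z^k.\<close>

definition grad_explicit :: "real \<Rightarrow> nat \<Rightarrow> real^2 \<Rightarrow> real^2" where
  "grad_explicit \<epsilon> k v = (-1 / (2*pi)) *\<^sub>R vector
     [v$1 * M_fun \<epsilon> v * Im (toC v ^ k) + L_fun \<epsilon> v * (k * Im (toC v ^ (k-1))),
      v$2 * M_fun \<epsilon> v * Im (toC v ^ k) + L_fun \<epsilon> v * (k * Re (toC v ^ (k-1)))]"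

lemma grad_eqI:
  fixes f :: "real^2 \<Rightarrow> real"
  assumes "(f has_derivative (\<lambda>h. a * h$1 + b * h$2)) (at v)"
  shows "grad f v = vector [a, b]"
proof -
  have "frechet_derivative f (at v) = (\<lambda>h. a * h$1 + b * h$2)"
    using frechet_derivative_at[OF assms] by simp
  then show ?thesis by (simp add: grad_def vec_eq_iff forall_2 axis_def)
qed

lemma grad_u_diff: assumes "v$2 > 0"
  shows "grad (u_diff \<epsilon> k) v = grad_explicit \<epsilon> k v"
proof -
  have "((\<lambda>v. - 1 / (2 * pi) * (L_fun \<epsilon> v * Im (toC v ^ k))) has_derivative 
    (\<lambda>h. (grad_explicit \<epsilon> k v $ 1) * h$1 + (grad_explicit \<epsilon> k v $ 2) * h$2)) (at v)"
    apply (rule has_derivative_eq_rhs)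
     apply (rule has_derivative_nth has_derivative_L has_derivative_Im_power assms has_derivative_mult_right derivative_eq_intros refl)+
    by (simp add: fun_eq_iff grad_explicit_def add_divide_distrib diff_divide_distrib algebra_simps)
  from grad_eqI[OF this] have "grad (u_diff \<epsilon> k) v = vector [grad_explicit \<epsilon> k v $ 1, grad_explicit \<epsilon> k v $ 2]"
    unfolding u_diff_eq[abs_def] .
  also have "\<dots> = grad_explicit \<epsilon> k v" by (simp add: vec_eq_iff forall_2)
  finally show ?thesis .
qed

text \<open>The lower right entry uses that Im z^k is harmonic, so that its second y-derivative is
  \<open>- Pxx\<close>. The truncated differences \<open>k-1\<close> and \<open>k-2\<close> are
  harmless, because their terms carry the factors \<open>k\<close> and
  \<open>real (k-1)\<close>.\<close>

definition hess_explicit :: "real \<Rightarrow> nat \<Rightarrow> real^2 \<Rightarrow> real^2^2" where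
  "hess_explicit \<epsilon> k v = (let x = v$1; y = v$2; L = L_fun \<epsilon> v; M = M_fun \<epsilon> v; M2 = M2_fun \<epsilon> v;
      P = Im (toC v ^ k); Px = k * Im (toC v ^ (k-1)); Py = k * Re (toC v ^ (k-1));
      Pxx = k * (real (k-1) * Im (toC v ^ (k-2))); Pxy = k * (real (k-1) * Re (toC v ^ (k-2))) in
      (-1 / (2*pi)) *\<^sub>R vector 
     [vector [M * P + x * (x * M2) * P + 2 * (x * M * Px) + L * Pxx,
              x * (y * M2) * P + x * M * Py + y * M * Px + L * Pxy],
      vector [x * (y * M2) * P + x * M * Py + y * M * Px + L * Pxy,
              M * P + y * (y * M2) * P + 2 * (y * M * Py) - L * Pxx]])"

text \<open>\<open>hessian\<close> differentiates \<open>grad f\<close>, so a formula for the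
  gradient at \<open>v\<close> alone would not suffice. It is required on an open set, and locality
  of the derivative does the rest.\<close>

lemma hessian_eqI:
  fixes f :: "real^2 \<Rightarrow> real"
  assumes "((\<lambda>v. G v $ 1) has_derivative (\<lambda>h. a * h$1 + b * h$2)) (at v)"
      and "((\<lambda>v. G v $ 2) has_derivative (\<lambda>h. c * h$1 + d * h$2)) (at v)"
      and "open S" "v \<in> S" and "\<And>w. w \<in> S \<Longrightarrow> grad f w = G w"
    shows "hessian f v = vector [vector [a, b], vector [c, d]]"
proof -
  have "(G has_derivative (\<lambda>h. vector [a * h$1 + b * h$2, c * h$1 + d * h$2])) (at v)"
    apply (subst has_derivative_componentwise_within)
    using assms(1,2) 
    by (auto simp: Basis_vec_def inner_axis UNIV_2)
  then have "(grad f has_derivative (\<lambda>h. vector [a * h$1 + b * h$2, c * h$1 + d * h$2])) (at v)"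
    by (rule has_derivative_transform_within_open) (use assms in auto)
  then have "frechet_derivative (grad f) (at v) = (\<lambda>h. vector [a * h$1 + b * h$2, c * h$1 + d * h$2])"
    by (rule frechet_derivative_at[symmetric])
  then show ?thesis
    by (simp add: hessian_def jacobian_def matrix_def vec_eq_iff forall_2 axis_def)
qed

lemma hessian_u_diff: assumes "v$2 > 0"
  shows "hessian (u_diff \<epsilon> k) v = hess_explicit \<epsilon> k v"
proof -
  let ?H = "hess_explicit \<epsilon> k v"
  have 0: "k - Suc (Suc 0) = k - 2" by simp
  have 1: "((\<lambda>v. grad_explicit \<epsilon> k v $ 1) has_derivative (\<lambda>h. ?H$1$1 * h$1 + ?H$1$2 * h$2)) (at v)"
    apply (simp add: grad_explicit_def del: times_divide_eq_left times_divide_eq_right minus_divide_left divide_minus_left)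
    apply (rule has_derivative_eq_rhs)
     apply (rule has_derivative_nth has_derivative_L has_derivative_M has_derivative_Im_power has_derivative_Re_power assms has_derivative_mult_right derivative_eq_intros refl)+
    by (simp add: fun_eq_iff hess_explicit_def Let_def 0 algebra_simps del: times_divide_eq_left times_divide_eq_right minus_divide_left divide_minus_left)
  have 2: "((\<lambda>v. grad_explicit \<epsilon> k v $ 2) has_derivative (\<lambda>h. ?H$2$1 * h$1 + ?H$2$2 * h$2)) (at v)"
    apply (simp add: grad_explicit_def del: times_divide_eq_left times_divide_eq_right minus_divide_left divide_minus_left)
    apply (rule has_derivative_eq_rhs)
     apply (rule has_derivative_nth has_derivative_L has_derivative_M has_derivative_Im_power has_derivative_Re_power assms has_derivative_mult_right derivative_eq_intros refl)+
    by (simp add: fun_eq_iff hess_explicit_def Let_def 0 algebra_simps del: times_divide_eq_left times_divide_eq_right minus_divide_left divide_minus_left)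
  have "open {v::real^2. v$2 > 0}"
    by (intro open_Collect_less continuous_intros)
  from hessian_eqI[OF 1 2 this] assms grad_u_diff
  have "hessian (u_diff \<epsilon> k) v = vector [vector [?H$1$1, ?H$1$2], vector [?H$2$1, ?H$2$2]]" by blast
  also have "\<dots> = ?H" by (simp add: vec_eq_iff forall_2)
  finally show ?thesis .
qed

section \<open>Pointwise bounds of the derivatives by the logarithm\<close>

lemma norm_pos_upper: "v$2 > 0 \<Longrightarrow> norm v > 0" for v :: "real^2"
  by auto

lemma L_fun_eq:
  assumes "v$2 > 0"
  shows "L_fun \<epsilon> v = ln (1 + \<epsilon>\<^sup>2 / (norm v)\<^sup>2)"
proof -
  have "(norm v)\<^sup>2 > 0" using norm_pos_upper[OF assms] by simp
  moreover have "(norm v)\<^sup>2 + \<epsilon>\<^sup>2 > 0" using calculation by (simp add: add_pos_nonneg)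
  ultimately have "ln ((norm v)\<^sup>2 + \<epsilon>\<^sup>2) - ln ((norm v)\<^sup>2) = ln (((norm v)\<^sup>2 + \<epsilon>\<^sup>2) / (norm v)\<^sup>2)"
    by (simp add: ln_div)
  also have "((norm v)\<^sup>2 + \<epsilon>\<^sup>2) / (norm v)\<^sup>2 = 1 + \<epsilon>\<^sup>2 / (norm v)\<^sup>2"
    using \<open>(norm v)\<^sup>2 > 0\<close> by (simp add: field_simps)
  finally show ?thesis by (simp add: L_fun_def norm_sq_2)
qed

text \<open>This is ln x \<le> x - 1 at x = 1 / (1 + t). It allows the rational functions that arise
  from differentiating the logarithm to be absorbed into the logarithm itself.\<close>

lemma ln_one_plus_ge: "t \<ge> 0 \<Longrightarrow> t / (1 + t) \<le> ln (1 + t)" for t :: real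
  using ln_le_minus_one[of "1 / (1+t)"] by (simp add: ln_div field_simps)

text \<open>With t = \<epsilon> / r this becomes the bound whose singularity at the origin is
  integrable in the plane. The difference exp t - 1 - t^2 vanishes at 0 and has the nonnegative
  derivative exp t - 2 t.\<close>

lemma ln_one_plus_square_le: "t \<ge> 0 \<Longrightarrow> ln (1 + t\<^sup>2) \<le> t" for t :: real
proof -
  assume t: "t \<ge> 0"
  have "1 + t\<^sup>2 \<le> exp t"
  proof -
    have m: "((\<lambda>t::real. exp t - 1 - t\<^sup>2) has_real_derivative (exp t - 2 * t)) (at t)" for t
      by (auto intro!: derivative_eq_intros)
    \<comment> \<open>For x \<ge> 0, exp x is e times exp (x - 1), hence at least 2 x; for negative
      x both terms are nonnegative.\<close>
    have "exp x - 2 * x \<ge> 0" for x :: real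
    proof -
      have "x - 1 + 1 \<le> exp (x - 1)" using exp_ge_add_one_self[of "x-1"] by simp
      moreover have "exp x = exp (x-1) * exp 1" by (simp flip: exp_add)
      moreover have "exp 1 \<ge> (2::real)" using exp_ge_add_one_self[of 1] by simp
      moreover have "x * 2 \<le> exp (x-1) * exp 1" if "x \<ge> 0"
        using calculation that by (intro mult_mono) auto
      ultimately show ?thesis
        using exp_gt_zero[of x] by (cases "x \<ge> 0") (auto simp del: exp_gt_zero)
    qed
    then have "exp 0 - 1 - 0\<^sup>2 \<le> exp t - 1 - t\<^sup>2"
      by (intro DERIV_nonneg_imp_nondecreasing[OF t]) (use m in blast)
    then show ?thesis by simp
  qed
  then show ?thesis using ln_le_cancel_iff[of "1+t\<^sup>2" "exp t"] by (simp add: add_pos_nonneg)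
qed

context
  fixes \<epsilon> :: real and v :: "real^2"
  assumes eps: "\<epsilon> > 0" and v: "v$2 > 0"
begin

lemma L_fun_nonneg: "0 \<le> L_fun \<epsilon> v"
  by (simp add: L_fun_eq[OF v])

lemma L_fun_ge: "\<epsilon>\<^sup>2 / ((norm v)\<^sup>2 + \<epsilon>\<^sup>2) \<le> L_fun \<epsilon> v"
proof -
  have "(norm v)\<^sup>2 > 0" using norm_pos_upper[OF v] by simp
  then have "\<epsilon>\<^sup>2 / ((norm v)\<^sup>2 + \<epsilon>\<^sup>2) = \<epsilon>\<^sup>2 / (norm v)\<^sup>2 / (1 + \<epsilon>\<^sup>2 / (norm v)\<^sup>2)"
    by (simp add: distrib_left)
  also have "\<dots> \<le> ln (1 + \<epsilon>\<^sup>2 / (norm v)\<^sup>2)"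
    by (rule ln_one_plus_ge) simp
  finally show ?thesis unfolding L_fun_eq[OF v] .
qed

lemma L_fun_le: "L_fun \<epsilon> v \<le> \<epsilon>\<^sup>2 / (norm v)\<^sup>2"
  using ln_add_one_self_le_self[of "\<epsilon>\<^sup>2 / (norm v)\<^sup>2"] by (simp add: L_fun_eq[OF v])

lemma L_fun_le': "L_fun \<epsilon> v \<le> \<epsilon> / norm v"
  using ln_one_plus_square_le[of "\<epsilon> / norm v"] eps by (simp add: L_fun_eq[OF v] power_divide)

text \<open>The left side equals 2 E / (r^2 + E) with E = \<epsilon>^2, which
  \<open>L_fun_ge\<close> compares with the logarithm. Thus L alone controls every term of the
  product rule.\<close>

lemma M_fun_le: "(norm v)\<^sup>2 * \<bar>M_fun \<epsilon> v\<bar> \<le> 2 * L_fun \<epsilon> v"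
proof -
  define s where "s = (norm v)\<^sup>2"
  have s: "s > 0" "s + \<epsilon>\<^sup>2 > 0" using norm_pos_upper[OF v] by (auto simp: s_def add_pos_nonneg)
  have "M_fun \<epsilon> v = - (2 * \<epsilon>\<^sup>2 / (s * (s + \<epsilon>\<^sup>2)))"
    using s by (simp add: M_fun_def norm_sq_2[symmetric] s_def[symmetric] divide_simps)
  then have "s * \<bar>M_fun \<epsilon> v\<bar> = 2 * (\<epsilon>\<^sup>2 / (s + \<epsilon>\<^sup>2))"
    using s by (simp add: abs_mult)
  then show ?thesis using L_fun_ge by (simp add: s_def)
qed

lemma M2_fun_le: "(norm v)^4 * \<bar>M2_fun \<epsilon> v\<bar> \<le> 8 * L_fun \<epsilon> v"
proof -
  define s where "s = (norm v)\<^sup>2"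
  have s: "s > 0" "s + \<epsilon>\<^sup>2 > 0" using norm_pos_upper[OF v] by (auto simp: s_def add_pos_nonneg)
  have s4: "(norm v)^4 = s\<^sup>2" by (simp add: s_def)
  have "M2_fun \<epsilon> v = 4 * \<epsilon>\<^sup>2 * (2 * s + \<epsilon>\<^sup>2) / (s\<^sup>2 * (s + \<epsilon>\<^sup>2)\<^sup>2)"
    using s by (simp add: M2_fun_def norm_sq_2[symmetric] s_def[symmetric] divide_simps)
       (simp add: algebra_simps power2_eq_square)
  then have "s\<^sup>2 * \<bar>M2_fun \<epsilon> v\<bar> = 4 * \<epsilon>\<^sup>2 * (2 * s + \<epsilon>\<^sup>2) / (s + \<epsilon>\<^sup>2)\<^sup>2"
    using s by (simp add: abs_mult)
  also have "\<dots> \<le> 4 * \<epsilon>\<^sup>2 * (2 * (s + \<epsilon>\<^sup>2)) / (s + \<epsilon>\<^sup>2)\<^sup>2"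
    by (intro divide_right_mono mult_left_mono) auto
  also have "\<dots> = 8 * (\<epsilon>\<^sup>2 / (s + \<epsilon>\<^sup>2))"
  proof -
    have "4 * e * (2 * t) / t\<^sup>2 = 8 * (e / t)" if "t > 0" for e t :: real
      using that by (simp add: power2_eq_square)
    from this[OF s(2)] show ?thesis .
  qed
  also have "\<dots> \<le> 8 * L_fun \<epsilon> v" using L_fun_ge by (simp add: s_def)
  finally show ?thesis unfolding s4 .
qed

lemma abs_Im_power_le: "\<bar>Im (toC v ^ n)\<bar> \<le> norm v ^ n"
  using abs_Im_le_cmod[of "toC v ^ n"] by (simp add: norm_power norm_toC)

lemma abs_Re_power_le: "\<bar>Re (toC v ^ n)\<bar> \<le> norm v ^ n"
  using abs_Re_le_cmod[of "toC v ^ n"] by (simp add: norm_power norm_toC)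

lemma abs_component_le: "\<bar>v$i\<bar> \<le> norm v"
  by (rule component_le_norm_cart)

lemma abs_u_diff_le: "\<bar>u_diff \<epsilon> k v\<bar> \<le> norm v ^ k * L_fun \<epsilon> v"
proof -
  have "\<bar>u_diff \<epsilon> k v\<bar> = 1 / (2*pi) * (L_fun \<epsilon> v * \<bar>Im (toC v ^ k)\<bar>)"
    using L_fun_nonneg by (simp add: u_diff_eq abs_mult)
  also have "\<dots> \<le> 1 * (L_fun \<epsilon> v * norm v ^ k)"
    using L_fun_nonneg abs_Im_power_le pi_gt3
    by (intro mult_mono mult_left_mono) auto
  finally show ?thesis by (simp add: mult.commute)
qed

lemma norm_vec2_le: "norm (vector [a, b] :: 'a::real_normed_vector^2) \<le> norm a + norm b"
  using sqrt_sum_squares_le_sum[of "norm a" "norm b"] by (simp add: norm_vec_def sum_2 L2_set_def)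

text \<open>Each of the two components is at most 2 + k times r^(k-1) L: 2 from
  \<open>M_fun_le\<close> and k from differentiating Im z^k. The prefactor 1 / (2 pi) is bounded by
  1.\<close>

lemma norm_grad_explicit_le: 
  assumes "k \<ge> 1"
  shows "norm (grad_explicit \<epsilon> k v) \<le> (2 * k + 4) * (norm v ^ (k-1) * L_fun \<epsilon> v)"
proof -
  define r where "r = norm v"
  define B where "B = r ^ (k-1) * L_fun \<epsilon> v"
  have r: "r > 0" using norm_pos_upper[OF v] by (simp add: r_def)
  have 1: "\<bar>v$i * M_fun \<epsilon> v * Im (toC v ^ k)\<bar> \<le> 2 * B" for i
  proof -
    have "\<bar>v$i * M_fun \<epsilon> v * Im (toC v ^ k)\<bar> = \<bar>v$i\<bar> * \<bar>M_fun \<epsilon> v\<bar> * \<bar>Im (toC v ^ k)\<bar>" by (simp add: abs_mult)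
    also have "\<dots> \<le> r * \<bar>M_fun \<epsilon> v\<bar> * r ^ k"
      unfolding r_def by (intro mult_mono mult_right_mono abs_component_le abs_Im_power_le) auto
    also have "\<dots> = r ^ (k-1) * (r\<^sup>2 * \<bar>M_fun \<epsilon> v\<bar>)"
      using assms by (cases k) (auto simp: power2_eq_square)
    also have "\<dots> \<le> r ^ (k-1) * (2 * L_fun \<epsilon> v)"
      using M_fun_le r by (intro mult_left_mono) (auto simp: r_def)
    finally show ?thesis by (simp add: B_def)
  qed
  have 2: "\<bar>L_fun \<epsilon> v * (k * w)\<bar> \<le> k * B" if "\<bar>w\<bar> \<le> r ^ (k-1)" for w :: real
  proof -
    have "\<bar>L_fun \<epsilon> v * (k * w)\<bar> = k * (\<bar>w\<bar> * L_fun \<epsilon> v)" using L_fun_nonneg by (simp add: abs_mult)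
    also have "\<dots> \<le> k * B" unfolding B_def by (intro mult_left_mono mult_right_mono that L_fun_nonneg) auto
    finally show ?thesis .
  qed
  define A1 where "A1 = v$1 * M_fun \<epsilon> v * Im (toC v ^ k) + L_fun \<epsilon> v * (k * Im (toC v ^ (k-1)))"
  define A2 where "A2 = v$2 * M_fun \<epsilon> v * Im (toC v ^ k) + L_fun \<epsilon> v * (k * Re (toC v ^ (k-1)))"
  have A: "\<bar>A1\<bar> \<le> 2 * B + k * B" "\<bar>A2\<bar> \<le> 2 * B + k * B"
    unfolding A1_def A2_def r_def
    by (intro order_trans[OF abs_triangle_ineq] add_mono 1 2; simp add: abs_Im_power_le abs_Re_power_le r_def)+
  have "norm (grad_explicit \<epsilon> k v) = 1 / (2*pi) * norm (vector [A1, A2] :: real^2)"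
    by (simp add: grad_explicit_def A1_def A2_def)
  also have "\<dots> \<le> 1 * norm (vector [A1, A2] :: real^2)"
    using pi_gt3 by (intro mult_right_mono) auto
  also have "\<dots> \<le> \<bar>A1\<bar> + \<bar>A2\<bar>" using norm_vec2_le[of A1 A2] by simp
  also have "\<dots> \<le> (2 * k + 4) * B" using A by (simp add: algebra_simps)
  finally show ?thesis by (simp add: B_def r_def)
qed

text \<open>Each of the four entries is at most 10 + 4 k + k^2 times r^(k-2) L: 2 + 8 from
  \<open>M_fun\<close> and \<open>M2_fun\<close>, 4 k from the products of first derivatives, and
  k^2 from the second derivatives of Im z^k.\<close>

lemma norm_hess_explicit_le: 
  assumes "k \<ge> 2"
  shows "norm (hess_explicit \<epsilon> k v) \<le> (4 * (10 + 4 * k + k * k)) * (norm v ^ (k-2) * L_fun \<epsilon> v)"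
proof -
  define r where "r = norm v"
  define B where "B = r ^ (k-2) * L_fun \<epsilon> v"
  have r: "r > 0" using norm_pos_upper[OF v] by (simp add: r_def)
  obtain j where j: "k = j + 2" using assms by (metis le_add_diff_inverse2)
  have M: "\<bar>M_fun \<epsilon> v * Im (toC v ^ k)\<bar> \<le> 2 * B"
  proof -
    have "\<bar>M_fun \<epsilon> v * Im (toC v ^ k)\<bar> \<le> \<bar>M_fun \<epsilon> v\<bar> * r ^ k"
      unfolding r_def abs_mult by (intro mult_left_mono abs_Im_power_le) auto
    also have "\<dots> = r ^ (k-2) * (r\<^sup>2 * \<bar>M_fun \<epsilon> v\<bar>)"
      by (simp add: j power_add power2_eq_square)
    also have "\<dots> \<le> r ^ (k-2) * (2 * L_fun \<epsilon> v)"
      using M_fun_le r by (intro mult_left_mono) (auto simp: r_def)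
    finally show ?thesis by (simp add: B_def)
  qed
  have M2: "\<bar>v$i * (v$i' * M2_fun \<epsilon> v) * Im (toC v ^ k)\<bar> \<le> 8 * B" for i i'
  proof -
    have "\<bar>v$i * (v$i' * M2_fun \<epsilon> v) * Im (toC v ^ k)\<bar> = \<bar>v$i\<bar> * (\<bar>v$i'\<bar> * \<bar>M2_fun \<epsilon> v\<bar>) * \<bar>Im (toC v ^ k)\<bar>"
      by (simp add: abs_mult)
    also have "\<dots> \<le> r * (r * \<bar>M2_fun \<epsilon> v\<bar>) * r ^ k"
      unfolding r_def by (intro mult_mono mult_right_mono abs_component_le abs_Im_power_le mult_nonneg_nonneg) auto
    also have "\<dots> = r ^ (k-2) * (r^4 * \<bar>M2_fun \<epsilon> v\<bar>)"
      by (simp add: j power_add power4_eq_xxxx power2_eq_square)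
    also have "\<dots> \<le> r ^ (k-2) * (8 * L_fun \<epsilon> v)"
      using M2_fun_le r by (intro mult_left_mono) (auto simp: r_def)
    finally show ?thesis by (simp add: B_def)
  qed
  have M1: "\<bar>v$i * M_fun \<epsilon> v * (k * w)\<bar> \<le> 2 * (k * B)" if "\<bar>w\<bar> \<le> r ^ (k-1)" for w :: real and i
  proof -
    have "\<bar>v$i * M_fun \<epsilon> v * (k * w)\<bar> = \<bar>v$i\<bar> * \<bar>M_fun \<epsilon> v\<bar> * (k * \<bar>w\<bar>)" by (simp add: abs_mult)
    also have "\<dots> \<le> r * \<bar>M_fun \<epsilon> v\<bar> * (k * r ^ (k-1))"
      using that r unfolding r_def 
      by (intro mult_mono mult_right_mono mult_left_mono abs_component_le mult_nonneg_nonneg) auto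
    also have "\<dots> = k * (r ^ (k-2) * (r\<^sup>2 * \<bar>M_fun \<epsilon> v\<bar>))"
      by (simp add: j power_add power2_eq_square)
    also have "\<dots> \<le> k * (r ^ (k-2) * (2 * L_fun \<epsilon> v))"
      using M_fun_le r by (intro mult_left_mono) (auto simp: r_def)
    finally show ?thesis by (simp add: B_def)
  qed
  have L: "\<bar>L_fun \<epsilon> v * (k * (real (k-1) * w))\<bar> \<le> k * k * B" if "\<bar>w\<bar> \<le> r ^ (k-2)" for w :: real
  proof -
    have "\<bar>L_fun \<epsilon> v * (k * (real (k-1) * w))\<bar> = k * (real (k-1) * (\<bar>w\<bar> * L_fun \<epsilon> v))"
      using L_fun_nonneg by (simp add: abs_mult)
    also have "\<dots> \<le> k * (k * B)" unfolding B_def using that r L_fun_nonneg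
      by (intro mult_left_mono mult_right_mono mult_mono that) auto
    finally show ?thesis by simp
  qed
  define P Px Py Pxx Pxy where "P = Im (toC v ^ k)" and "Px = k * Im (toC v ^ (k-1))"
    and "Py = k * Re (toC v ^ (k-1))"
    and "Pxx = k * (real (k-1) * Im (toC v ^ (k-2)))" and "Pxy = k * (real (k-1) * Re (toC v ^ (k-2)))"
  define M' M2' L' where "M' = M_fun \<epsilon> v" and "M2' = M2_fun \<epsilon> v" and "L' = L_fun \<epsilon> v"
  have b: "\<bar>M' * P\<bar> \<le> 2 * B" "\<bar>v$i * (v$i' * M2') * P\<bar> \<le> 8 * B" "\<bar>v$i * M' * Px\<bar> \<le> 2 * (k * B)"
    "\<bar>v$i * M' * Py\<bar> \<le> 2 * (k * B)" "\<bar>L' * Pxx\<bar> \<le> k * k * B" "\<bar>L' * Pxy\<bar> \<le> k * k * B" for i i'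
    unfolding P_def Px_def Py_def Pxx_def Pxy_def M'_def M2'_def L'_def
    by (intro M M1 M2 L; simp add: abs_Im_power_le abs_Re_power_le r_def)+
  have B0: "B \<ge> 0" "k * k * B \<ge> 0" "k * B \<ge> 0" using r L_fun_nonneg by (auto simp: B_def)
  define T where "T = 10 * B + 4 * (k * B) + k * k * B"
  define a11 where "a11 = M' * P + v$1 * (v$1 * M2') * P + 2 * (v$1 * M' * Px) + L' * Pxx"
  define a12 where "a12 = v$1 * (v$2 * M2') * P + v$1 * M' * Py + v$2 * M' * Px + L' * Pxy"
  define a22 where "a22 = M' * P + v$2 * (v$2 * M2') * P + 2 * (v$2 * M' * Py) - L' * Pxx"
  have "\<bar>a11\<bar> \<le> T" using b(1,5) b(2)[of 1 1] b(3)[of 1] B0 unfolding a11_def T_def of_nat_mult by linarith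
  moreover have "\<bar>a12\<bar> \<le> T" using b(6) b(2)[of 1 2] b(4)[of 1] b(3)[of 2] B0 unfolding a12_def T_def of_nat_mult by linarith
  moreover have "\<bar>a22\<bar> \<le> T" using b(1,5) b(2)[of 2 2] b(4)[of 2] B0 unfolding a22_def T_def of_nat_mult by linarith
  moreover have "norm (hess_explicit \<epsilon> k v) \<le> \<bar>a11\<bar> + \<bar>a12\<bar> + (\<bar>a12\<bar> + \<bar>a22\<bar>)"
  proof -
    let ?V = "vector [vector [a11, a12], vector [a12, a22]] :: real^2^2"
    have "hess_explicit \<epsilon> k v = (-1 / (2*pi)) *\<^sub>R ?V"
      by (simp add: hess_explicit_def Let_def a11_def a12_def a22_def P_def Px_def Py_def Pxx_def Pxy_def M'_def M2'_def L'_def)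
    then have "norm (hess_explicit \<epsilon> k v) = 1 / (2*pi) * norm ?V" by simp
    also have "\<dots> \<le> 1 * norm ?V"
      using pi_gt3 by (intro mult_right_mono) auto
    also have "norm ?V \<le> norm (vector [a11, a12] :: real^2) + norm (vector [a12, a22] :: real^2)"
      by (rule norm_vec2_le)
    also have "\<dots> \<le> \<bar>a11\<bar> + \<bar>a12\<bar> + (\<bar>a12\<bar> + \<bar>a22\<bar>)"
      using norm_vec2_le[of a11 a12] norm_vec2_le[of a12 a22] by simp
    finally show ?thesis by simp
  qed
  ultimately have "norm (hess_explicit \<epsilon> k v) \<le> 4 * T" by linarith
  also have "\<dots> = (4 * (10 + 4 * k + k * k)) * B" by (simp add: T_def algebra_simps)
  finally show ?thesis by (simp add: B_def r_def)
qed

end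

section \<open>$L^p$ estimates on the half disc\<close>

text \<open>Integration in polar coordinates for radial functions. The disc of radius a has area pi
  a^2, whose derivative is the density; the half lines are an intersection-stable generator on which
  the two measures can be compared. The maximum with 0 removes negative radii.\<close>

lemma distr_norm_lborel_2:
  "distr lborel borel (norm :: real^2 \<Rightarrow> real) = density lborel (\<lambda>s. ennreal (2 * pi * max 0 s))"
proof (rule measure_eqI_generator_eq[where E="range (\<lambda>a. {..<a})" and \<Omega>=UNIV and A="\<lambda>n. {..<real n}"])
  let ?N = "density lborel (\<lambda>s. ennreal (2 * pi * max 0 s))"
  have e1: "emeasure (distr lborel borel (norm :: real^2 \<Rightarrow> real)) {..<a} = ennreal (pi * (max 0 a)\<^sup>2)" for a :: real
  proof -
    have "emeasure (distr lborel borel (norm :: real^2 \<Rightarrow> real)) {..<a} = emeasure lborel (norm -` {..<a} :: (real^2) set)"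
      by (subst emeasure_distr) auto
    also have "norm -` {..<a} = ball (0::real^2) (max 0 a)" by (auto simp: less_max_iff_disj)
    also have "emeasure lborel \<dots> = ennreal (pi * (max 0 a)\<^sup>2)"
      by (simp add: emeasure_ball unit_ball_vol_2)
    finally show ?thesis .
  qed
  have e2: "emeasure ?N {..<a} = ennreal (pi * (max 0 a)\<^sup>2)" for a :: real
  proof (cases "a \<ge> 0")
    case True
    have "emeasure ?N {..<a} = (\<integral>\<^sup>+x. ennreal (2 * pi * max 0 x) * indicator {..<a} x \<partial>lborel)"
      by (subst emeasure_density) auto
    also have "\<dots> = (\<integral>\<^sup>+x. ennreal (2 * pi * x) * indicator {0..a} x \<partial>lborel)"
    proof (rule nn_integral_cong_AE)
      \<comment> \<open>The indicators differ at the single point \<open>a\<close>; the closed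
        interval is the form required by the fundamental theorem of calculus.\<close>
      show "AE x in lborel. ennreal (2 * pi * max 0 x) * indicator {..<a} x = ennreal (2 * pi * x) * indicator {0..a} x"
        using AE_lborel_singleton[of a] by eventually_elim (auto simp: indicator_def max_def)
    qed
    also have "\<dots> = ennreal (pi * a\<^sup>2 - pi * 0\<^sup>2)"
      using True by (intro nn_integral_FTC_Icc) (auto intro!: derivative_eq_intros)
    finally show ?thesis using True by simp
  next
    case False
    have "emeasure ?N {..<a} = (\<integral>\<^sup>+x. ennreal (2 * pi * max 0 x) * indicator {..<a} x \<partial>lborel)"
      by (subst emeasure_density) auto
    also have "\<dots> = (\<integral>\<^sup>+x. 0 \<partial>(lborel :: real measure))"
      using False by (intro nn_integral_cong) (auto simp: indicator_def max_def)
    finally show ?thesis using False by simp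
  qed
  show "Int_stable (range (\<lambda>a::real. {..<a}))"
  proof -
    have "{..<a} \<inter> {..<b} = {..<min a b}" for a b :: real by auto
    then show ?thesis by (auto simp: Int_stable_def)
  qed
  show "X \<in> range (\<lambda>a. {..<a}) \<Longrightarrow> emeasure (distr lborel borel (norm :: real^2 \<Rightarrow> real)) X = emeasure ?N X" for X
    using e1 e2 by auto
  show "sets (distr lborel borel (norm :: real^2 \<Rightarrow> real)) = sigma_sets UNIV (range (\<lambda>a. {..<a}))"
    by (simp add: borel_Iio)
  show "sets ?N = sigma_sets UNIV (range (\<lambda>a. {..<a}))"
    by (simp add: borel_Iio)
  show "(\<Union>i. {..<real i}) = UNIV"
    by (auto simp: reals_Archimedean2)
  show "emeasure (distr lborel borel (norm :: real^2 \<Rightarrow> real)) {..<real i} \<noteq> \<infinity>" for i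
    by (simp add: e1)
qed auto

lemma nn_integral_radial_2:
  fixes g :: "real \<Rightarrow> ennreal"
  assumes [measurable]: "g \<in> borel_measurable borel"
  shows "(\<integral>\<^sup>+x. g (norm (x::real^2)) \<partial>lborel) = (\<integral>\<^sup>+s. ennreal (2 * pi * max 0 s) * g s \<partial>lborel)"
proof -
  have "(\<integral>\<^sup>+x. g (norm (x::real^2)) \<partial>lborel) = (\<integral>\<^sup>+s. g s \<partial>distr lborel borel (norm :: real^2 \<Rightarrow> real))"
    by (subst nn_integral_distr) auto
  also have "\<dots> = (\<integral>\<^sup>+s. ennreal (2 * pi * max 0 s) * g s \<partial>lborel)"
    unfolding distr_norm_lborel_2 by (subst nn_integral_density) auto
  finally show ?thesis .
qed

lemma half_disc_sub_ball: "half_disc R \<subseteq> ball 0 \<bar>R\<bar>"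
proof
  fix v assume "v \<in> half_disc R"
  then have "(norm v)\<^sup>2 < \<bar>R\<bar>\<^sup>2"
    by (simp add: half_disc_def norm_vec_def L2_set_def sum_2)
  then show "v \<in> ball 0 \<bar>R\<bar>" by (auto intro: power2_less_imp_less)
qed

lemma half_discD: "v \<in> half_disc R \<Longrightarrow> v$2 > 0" "v \<in> half_disc R \<Longrightarrow> R > 0 \<Longrightarrow> norm v < R" "v \<in> half_disc R \<Longrightarrow> norm v > 0"
  using half_disc_sub_ball[of R] by (auto simp: half_disc_def)

lemma open_half_disc: "open (half_disc R)"
  unfolding half_disc_def Collect_conj_eq by (intro open_Int open_Collect_less continuous_intros)

lemma sets_half_disc [measurable]: "half_disc R \<in> sets borel" "half_disc R \<in> sets lebesgue"
  using open_half_disc by auto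

text \<open>Enlarging the half disc to the disc costs a factor 2 for a radial majorant, and leaves a
  one-dimensional integral with the weight 2 pi s.\<close>

lemma nn_integral_half_disc_le:
  fixes f :: "real^2 \<Rightarrow> ennreal" and g :: "real \<Rightarrow> ennreal"
  assumes [measurable]: "g \<in> borel_measurable borel" and "R > 0"
    and le: "\<And>v. v \<in> half_disc R \<Longrightarrow> f v \<le> g (norm v)"
  shows "(\<integral>\<^sup>+v. f v \<partial>lebesgue_on (half_disc R)) \<le> (\<integral>\<^sup>+s. ennreal (2 * pi * s) * g s * indicator {0..R} s \<partial>lborel)"
proof -
  have "(\<integral>\<^sup>+v. f v \<partial>lebesgue_on (half_disc R)) = (\<integral>\<^sup>+v. f v * indicator (half_disc R) v \<partial>lebesgue)"
    by (subst nn_integral_restrict_space) auto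
  also have "\<dots> \<le> (\<integral>\<^sup>+v. g (norm (v::real^2)) * indicator {0..R} (norm v) \<partial>lebesgue)"
    by (intro nn_integral_mono) (use half_disc_sub_ball[of R] \<open>R > 0\<close> in \<open>auto simp: indicator_def intro!: le\<close>)
  also have "\<dots> = (\<integral>\<^sup>+v. g (norm (v::real^2)) * indicator {0..R} (norm v) \<partial>lborel)"
    by (rule nn_integral_completion)
  also have "\<dots> = (\<integral>\<^sup>+s. ennreal (2 * pi * max 0 s) * (g s * indicator {0..R} s) \<partial>lborel)"
    by (rule nn_integral_radial_2[of "\<lambda>s. g s * indicator {0..R} s"]) measurable
  also have "\<dots> = (\<integral>\<^sup>+s. ennreal (2 * pi * s) * g s * indicator {0..R} s \<partial>lborel)"
    by (intro nn_integral_cong) (auto simp: indicator_def max_def)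
  finally show ?thesis .
qed

section \<open>L^p norms with constants that do not depend on p\<close>

lemma Lp_norm_le:
  fixes f :: "'a::euclidean_space \<Rightarrow> 'b::euclidean_space"
  assumes "f \<in> borel_measurable (lebesgue_on D)" "q > 0" "J \<ge> 0"
    and "(\<integral>\<^sup>+x. ennreal (norm (f x) powr q) \<partial>lebesgue_on D) \<le> ennreal J"
  shows "Lp_norm (ennreal q) D f \<le> ennreal (J powr (1 / q))"
proof -
  define I where "I = (\<integral>\<^sup>+x. ennreal (norm (f x) powr q) \<partial>lebesgue_on D)"
  have "I \<noteq> \<infinity>" "enn2real I \<le> J"
    using assms(3,4) unfolding I_def[symmetric] by (auto simp: top_unique enn2real_leI)
  then have "Lp_norm (ennreal q) D f = ennreal (enn2real I powr (1 / q))"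
    using assms(1,2) by (simp add: Lp_norm_def Let_def I_def)
  also have "\<dots> \<le> ennreal (J powr (1/q))"
    using \<open>enn2real I \<le> J\<close> \<open>q > 0\<close> by (intro ennreal_leI powr_mono2) auto
  finally show ?thesis .
qed

lemma Linf_norm_le:
  fixes f :: "'a::euclidean_space \<Rightarrow> 'b::euclidean_space"
  assumes "f \<in> borel_measurable (lebesgue_on D)" and "\<And>x. x \<in> D \<Longrightarrow> norm (f x) \<le> K"
    and "D \<in> sets lebesgue"
  shows "Lp_norm \<infinity> D f \<le> ennreal K"
  using assms by (auto simp: Lp_norm_def intro!: esssup_I ennreal_leI AE_I2)

text \<open>The constant is uniform in p because m^(1/q) \<ge> min 1 m for q \<ge> 1. For p =
  \<infinity>, an essential supremum below \<open>K\<close> would make \<open>S\<close> a null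
  set.\<close>

lemma Lp_norm_ge:
  fixes f :: "'a::euclidean_space \<Rightarrow> 'b::euclidean_space"
  assumes f: "f \<in> borel_measurable (lebesgue_on D)" and "1 \<le> p"
    and S: "S \<in> sets lebesgue" "S \<subseteq> D" "D \<in> sets lebesgue" "emeasure lebesgue S = ennreal m" "m > 0"
    and ge: "\<And>x. x \<in> S \<Longrightarrow> K \<le> norm (f x)" and "K \<ge> 0"
  shows "ennreal (K * min 1 m) \<le> Lp_norm p D f"
proof (cases "p = \<infinity>")
  case True
  have "ennreal K \<le> esssup (lebesgue_on D) (\<lambda>x. ennreal (norm (f x)))" (is "_ \<le> ?E")
  proof (rule ccontr)
    assume "\<not> ennreal K \<le> ?E"
    then have E: "?E < ennreal K" by simp
    have "AE x in lebesgue_on D. ennreal (norm (f x)) \<le> ?E"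
      using f by (intro esssup_AE) 
    then have "AE x in lebesgue_on D. x \<notin> S"
      by eventually_elim (use E ge in \<open>meson ennreal_leI leD order_le_less_trans\<close>)
    then have "AE x in lebesgue. x \<notin> S"
      using S by (subst (asm) AE_restrict_space_iff) (auto elim: eventually_mono)
    then have "emeasure lebesgue S = 0"
      using S by (subst (asm) AE_iff_measurable[of S]) auto
    then show False using S by simp
  qed
  moreover have "ennreal (K * min 1 m) \<le> ennreal K"
    using \<open>K \<ge> 0\<close> \<open>m > 0\<close> by (intro ennreal_leI) (simp add: mult_left_le)
  ultimately show ?thesis using True f by (simp add: Lp_norm_def)
next
  case False
  then obtain q where q: "p = ennreal q" "q \<ge> 0" by (cases p) auto
  with \<open>1 \<le> p\<close> have q1: "q \<ge> 1" by (metis ennreal_1 ennreal_le_iff2 not_one_le_zero)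
  define I where "I = (\<integral>\<^sup>+x. ennreal (norm (f x) powr q) \<partial>lebesgue_on D)"
  have "ennreal (K powr q * m) = ennreal (K powr q) * emeasure lebesgue S"
    using S by (simp add: ennreal_mult)
  also have "\<dots> = (\<integral>\<^sup>+x. ennreal (K powr q) * indicator S x \<partial>lebesgue)"
    using S by (simp add: nn_integral_cmult_indicator)
  also have "\<dots> \<le> (\<integral>\<^sup>+x. ennreal (norm (f x) powr q) * indicator D x \<partial>lebesgue)"
    using S ge q1 \<open>K \<ge> 0\<close> by (intro nn_integral_mono) (auto simp: indicator_def intro!: ennreal_leI powr_mono2)
  also have "\<dots> = I" unfolding I_def using S by (subst nn_integral_restrict_space) auto
  finally have I: "ennreal (K powr q * m) \<le> I" .
  show ?thesis
  proof (cases "I = \<infinity>")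
    case True
    then show ?thesis using q q1 f by (simp add: Lp_norm_def Let_def I_def)
  next
    case False
    then have "K powr q * m \<le> enn2real I"
      using I S False ennreal_le_iff[of "enn2real I" "K powr q * m"]
      by (metis ennreal_enn2real_if ennreal_le_iff enn2real_nonneg infinity_ennreal_def)
    then have "(K powr q * m) powr (1/q) \<le> enn2real I powr (1 / q)"
      using q1 S by (intro powr_mono2) auto
    moreover have "(K powr q * m) powr (1/q) = K * m powr (1/q)"
      using q1 S \<open>K \<ge> 0\<close> by (simp add: powr_mult powr_powr)
    moreover have "min 1 m \<le> m powr (1/q)"
    proof (cases "m \<ge> 1")
      case True
      then show ?thesis using q1 by (simp add: ge_one_powr_ge_zero)
    next
      case False
      then have "m powr 1 \<le> m powr (1/q)" using q1 S by (intro powr_mono') auto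
      then show ?thesis using False S by simp
    qed
    ultimately have "K * min 1 m \<le> enn2real I powr (1 / q)"
      using \<open>K \<ge> 0\<close> by (smt (verit) mult_left_mono)
    then show ?thesis using q q1 f False 
      by (simp add: Lp_norm_def Let_def I_def ennreal_leI)
  qed
qed

lemma borel_measurable_half_disc:
  fixes f :: "real^2 \<Rightarrow> 'b::euclidean_space"
  assumes "continuous_on (half_disc R) g" "\<And>v. v \<in> half_disc R \<Longrightarrow> f v = g v"
  shows "f \<in> borel_measurable (lebesgue_on (half_disc R))"
proof -
  have "continuous_on (half_disc R) f" using assms continuous_on_cong by metis
  then show ?thesis by (intro continuous_imp_measurable_on_sets_lebesgue) auto
qed

text \<open>The counterpart for upper bounds: roots of a constant stay below one constant for all
  q.\<close>

lemma powr_inverse_le_max: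
  assumes "c \<ge> 0" "q \<ge> (1::real)" shows "c powr (1 / q) \<le> max 1 c"
proof (cases "c \<ge> 1")
  case True
  then have "c powr (1/q) \<le> c powr 1" using assms by (intro powr_mono) auto
  then show ?thesis using True by simp
next
  case False
  then show ?thesis using assms powr_le1[of "1/q" c] by auto
qed

text \<open>The singularity A / r is cancelled by the weight 2 pi r, so the inner part contributes 2
  pi A \<epsilon>. Outside, \<open>h\<close> is the majorant with the weight included, integrated by
  means of its primitive \<open>H\<close>. The upper end \<open>M\<close> may exceed
  \<open>R\<close>, which covers the case \<epsilon> > R as well.\<close>

lemma nn_integral_half_disc_split:
  fixes f :: "real^2 \<Rightarrow> ennreal" and h H :: "real \<Rightarrow> real"
  assumes R: "R > 0" "R \<le> M" and \<epsilon>: "0 < \<epsilon>" "\<epsilon> \<le> M" and "A \<ge> 0"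
    and [measurable]: "h \<in> borel_measurable borel"
    and h: "\<And>s. \<epsilon> \<le> s \<Longrightarrow> h s \<ge> 0" "\<And>s. \<epsilon> \<le> s \<Longrightarrow> (H has_real_derivative h s) (at s)"
    and inner: "\<And>v. v \<in> half_disc R \<Longrightarrow> norm v < \<epsilon> \<Longrightarrow> f v \<le> ennreal (A / norm v)"
    and outer: "\<And>v. v \<in> half_disc R \<Longrightarrow> norm v \<ge> \<epsilon> \<Longrightarrow> f v \<le> ennreal (h (norm v) / (2 * pi * norm v))"
  shows "(\<integral>\<^sup>+v. f v \<partial>lebesgue_on (half_disc R)) \<le> ennreal (2 * pi * A * \<epsilon> + (H M - H \<epsilon>))"
proof -
  define g where "g s = (if s < \<epsilon> then A / s else h s / (2 * pi * s))" for s
  have [measurable]: "g \<in> borel_measurable borel" unfolding g_def by measurable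
  have "(\<integral>\<^sup>+v. f v \<partial>lebesgue_on (half_disc R)) \<le> (\<integral>\<^sup>+s. ennreal (2 * pi * s) * ennreal (g s) * indicator {0..R} s \<partial>lborel)"
    by (rule nn_integral_half_disc_le) (use R inner outer in \<open>auto simp: g_def\<close>)
  also have "\<dots> \<le> (\<integral>\<^sup>+s. ennreal (2 * pi * A) * indicator {0..\<epsilon>} s + ennreal (h s) * indicator {\<epsilon>..M} s \<partial>lborel)"
  proof (rule nn_integral_mono)
    fix s :: real
    show "ennreal (2 * pi * s) * ennreal (g s) * indicator {0..R} s \<le> ennreal (2 * pi * A) * indicator {0..\<epsilon>} s + ennreal (h s) * indicator {\<epsilon>..M} s"
    proof (cases "0 < s \<and> s \<le> R")
      case False
      then show ?thesis by (auto simp: indicator_def)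
    next
      case True
      have "ennreal (2 * pi * s) * ennreal (g s) = ennreal (2 * pi * s * g s)"
        using True by (simp add: ennreal_mult')
      also have "2 * pi * s * g s = (if s < \<epsilon> then 2 * pi * A else h s)"
        using True by (simp add: g_def)
      finally show ?thesis using True R by (auto simp: indicator_def)
    qed
  qed
  also have "\<dots> = (\<integral>\<^sup>+s. ennreal (2 * pi * A) * indicator {0..\<epsilon>} s \<partial>lborel) + (\<integral>\<^sup>+s. ennreal (h s) * indicator {\<epsilon>..M} s \<partial>lborel)"
    by (rule nn_integral_add) auto
  also have "(\<integral>\<^sup>+s. ennreal (2 * pi * A) * indicator {0..\<epsilon>} s \<partial>lborel) = ennreal (2 * pi * A * \<epsilon>)"
    using \<epsilon> \<open>A \<ge> 0\<close> by (simp add: nn_integral_cmult_indicator ennreal_mult)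
  also have "(\<integral>\<^sup>+s. ennreal (h s) * indicator {\<epsilon>..M} s \<partial>lborel) = ennreal (H M - H \<epsilon>)"
    by (rule nn_integral_FTC_Icc)
       (use h \<epsilon> in \<open>auto simp: has_real_derivative_iff_has_vector_derivative intro: has_vector_derivative_at_within\<close>)
  also have "ennreal (2 * pi * A * \<epsilon>) + ennreal (H M - H \<epsilon>) = ennreal (2 * pi * A * \<epsilon> + (H M - H \<epsilon>))"
  proof (rule ennreal_plus[symmetric])
    show "0 \<le> 2 * pi * A * \<epsilon>" using \<epsilon> \<open>A \<ge> 0\<close> by simp
    have "H \<epsilon> \<le> H M"
      using \<epsilon> h by (intro DERIV_nonneg_imp_nondecreasing[of \<epsilon> M H]) auto
    then show "0 \<le> H M - H \<epsilon>" by simp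
  qed
  finally show ?thesis .
qed

text \<open>Meant for the gradient, and for the Hessian if k > 2. Put t = r L. Since t \<le>
  \<epsilon> < 1, also t^q \<le> t, and t \<le> \<epsilon>^2 / r has an integral of order
  \<epsilon>^2. The q-th root then gives \<epsilon>^(2/q) with a constant that is the same for all
  q.\<close>

lemma Lp_norm_half_disc_le:
  fixes f :: "real^2 \<Rightarrow> 'b::euclidean_space"
  assumes f: "f \<in> borel_measurable (lebesgue_on (half_disc R))"
    and R: "R > 0" and \<epsilon>: "0 < \<epsilon>" "\<epsilon> < 1" and "K \<ge> 0" and "1 \<le> p"
    and le: "\<And>v. v \<in> half_disc R \<Longrightarrow> norm (f v) \<le> K * (norm v * L_fun \<epsilon> v)"
  shows "Lp_norm p (half_disc R) f \<le> ennreal (K * max 1 (2 * pi * R + 2 * pi) * \<epsilon> powr enn2real (2 / p))"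
proof -
  let ?D = "half_disc R"
  have L: "norm v * L_fun \<epsilon> v \<le> \<epsilon>" "norm v * L_fun \<epsilon> v \<le> \<epsilon>\<^sup>2 / norm v" "0 \<le> norm v * L_fun \<epsilon> v" if "v \<in> ?D" for v
  proof -
    note v = half_discD(1,3)[OF that]
    show "norm v * L_fun \<epsilon> v \<le> \<epsilon>" using L_fun_le'[OF \<epsilon>(1) v(1)] v(2) by (simp add: field_simps)
    have "norm v * L_fun \<epsilon> v \<le> norm v * (\<epsilon>\<^sup>2 / (norm v)\<^sup>2)" using L_fun_le[OF \<epsilon>(1) v(1)] by (intro mult_left_mono) auto
    then show "norm v * L_fun \<epsilon> v \<le> \<epsilon>\<^sup>2 / norm v" using v(2) by (simp add: power2_eq_square)
    show "0 \<le> norm v * L_fun \<epsilon> v" using L_fun_nonneg[OF \<epsilon>(1) v(1)] by simp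
  qed
  show ?thesis
  proof (cases "p = \<infinity>")
    case True
    have "norm (f v) \<le> K * max 1 (2 * pi * R + 2 * pi)" if "v \<in> ?D" for v
    proof -
      have "norm (f v) \<le> K * (norm v * L_fun \<epsilon> v)" by (rule le[OF that])
      also have "\<dots> \<le> K * 1" using L(1)[OF that] \<epsilon> \<open>K \<ge> 0\<close> by (intro mult_left_mono) auto
      also have "\<dots> \<le> K * max 1 (2 * pi * R + 2 * pi)" using \<open>K \<ge> 0\<close> by (intro mult_left_mono) auto
      finally show ?thesis .
    qed
    \<comment> \<open>Here \<open>2 / p\<close> is 0, so that the power of \<epsilon> is 1.\<close>
    from Linf_norm_le[OF f this] show ?thesis using True \<epsilon> by simp
  next
    case False
    then obtain q where q: "p = ennreal q" "q \<ge> 0" by (cases p) auto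
    with \<open>1 \<le> p\<close> have q1: "q \<ge> 1" by (metis ennreal_1 ennreal_le_iff2 not_one_le_zero)
    have e2q: "enn2real (2 / p) = 2 / q"
      using q1 q divide_ennreal[of 2 q] by simp
    define A where "A = K powr q * \<epsilon>\<^sup>2"
    have A: "A \<ge> 0" by (simp add: A_def)
    have bd: "norm (f v) powr q \<le> A / norm v" if "v \<in> ?D" for v
    proof -
      define t where "t = norm v * L_fun \<epsilon> v"
      have "norm (f v) powr q \<le> (K * t) powr q"
        using le[OF that] q1 by (intro powr_mono2) (auto simp: t_def)
      also have "\<dots> = K powr q * t powr q" using \<open>K \<ge> 0\<close> L(3)[OF that] by (simp add: powr_mult t_def)
      also have "t powr q \<le> t powr 1"
        using L(1,3)[OF that] \<epsilon> q1 by (intro powr_mono') (auto simp: t_def)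
      also have "t powr 1 \<le> \<epsilon>\<^sup>2 / norm v" using L(2,3)[OF that] by (simp add: t_def)
      finally show ?thesis by (simp add: A_def mult_left_mono)
    qed
    define J where "J = 2 * pi * A * \<epsilon> + (2 * pi * A * max R \<epsilon> - 2 * pi * A * \<epsilon>)"
    have "(\<integral>\<^sup>+v. ennreal (norm (f v) powr q) \<partial>lebesgue_on ?D) \<le> ennreal J"
      unfolding J_def
      \<comment> \<open>The bound \<open>A / norm v\<close> serves on both sides of r = \<epsilon>,
        so the weighted majorant is constant.\<close>
      by (rule nn_integral_half_disc_split[where h = "\<lambda>s. 2 * pi * A"])
         (use R \<epsilon> A in \<open>auto intro!: derivative_eq_intros ennreal_leI bd\<close>)
    moreover have "J \<ge> 0" using A \<epsilon> by (simp add: J_def max_def)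
    ultimately have "Lp_norm p ?D f \<le> ennreal (J powr (1 / q))"
      unfolding q(1) using q1 by (intro Lp_norm_le f) auto
    also have "J powr (1 / q) = K * \<epsilon> powr (2 / q) * (2 * pi * max R \<epsilon>) powr (1 / q)"
    proof -
      have "J = (K powr q * \<epsilon> powr 2) * (2 * pi * max R \<epsilon>)" using \<epsilon> by (simp add: J_def A_def)
      then have "J powr (1/q) = (K powr q) powr (1/q) * (\<epsilon> powr 2) powr (1/q) * (2 * pi * max R \<epsilon>) powr (1/q)"
        using \<open>K \<ge> 0\<close> \<epsilon> R by (simp add: powr_mult)
      then show ?thesis using q1 \<open>K \<ge> 0\<close> by (simp add: powr_powr)
    qed
    also have "\<dots> \<le> K * \<epsilon> powr (2 / q) * max 1 (2 * pi * R + 2 * pi)"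
    proof (intro mult_left_mono)
      have "(2 * pi * max R \<epsilon>) powr (1 / q) \<le> max 1 (2 * pi * max R \<epsilon>)"
        using R q1 by (intro powr_inverse_le_max) auto
      also have "2 * pi * max R \<epsilon> \<le> 2 * pi * (R + 1)" using R \<epsilon> by (intro mult_left_mono) auto
      finally show "(2 * pi * max R \<epsilon>) powr (1 / q) \<le> max 1 (2 * pi * R + 2 * pi)" by (simp add: algebra_simps max_def split: if_splits)
    qed (use \<open>K \<ge> 0\<close> in auto)
    finally show ?thesis by (simp add: e2q ac_simps ennreal_leI)
  qed
qed

text \<open>A logarithm is bounded by every positive power. The exponent 1 / (2 q) is chosen so that
  the q-th power leaves sqrt (1 + t^2) \<le> 2 t; with t = \<epsilon> / r this is again an
  integrable singularity.\<close>

lemma ln_one_plus_square_powr_le: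
  assumes "t \<ge> 1" "q \<ge> 1" 
  shows "ln (1 + t\<^sup>2) powr q \<le> (2 * (2 * q) powr q) * (t::real)"
proof -
  have "ln (1 + t\<^sup>2) \<le> (1 + t\<^sup>2) powr (1/(2*q)) / (1/(2*q))"
    using assms by (intro ln_powr_bound) auto
  then have "ln (1 + t\<^sup>2) powr q \<le> ((1 + t\<^sup>2) powr (1/(2*q)) * (2 * q)) powr q"
    using assms by (intro powr_mono2) auto
  also have "\<dots> = (1 + t\<^sup>2) powr (1/2) * (2 * q) powr q"
    using assms by (simp add: powr_mult powr_powr)
  also have "\<dots> \<le> (2 * t) * (2 * q) powr q"
  proof (rule mult_right_mono)
    have "(1 + t\<^sup>2) powr (1/2) = sqrt (1 + t\<^sup>2)" by (simp add: powr_half_sqrt add_nonneg_nonneg)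
    also have "\<dots> \<le> sqrt ((2 * t)\<^sup>2)"
      using power_mono[OF assms(1), of 2] by (intro real_sqrt_le_mono) (simp add: power_mult_distrib)
    also have "sqrt ((2 * t)\<^sup>2) = 2 * t" using assms by (intro real_sqrt_unique) auto
    finally show "(1 + t\<^sup>2) powr (1/2) \<le> 2 * t" .
  qed simp
  finally show ?thesis by (simp add: mult_ac)
qed

text \<open>Without a factor r the bound is unbounded at the origin. For r < \<epsilon>, L^q is at
  most a multiple of \<epsilon> / r; for r \<ge> \<epsilon> it is at most (\<epsilon> / r)^(2 q),
  and the weighted tail s^(1 - 2 q) is integrable at infinity because q > 1. The constant
  \<open>T\<close> contains 1 / (2 q - 2) and thus degenerates as q tends to 1.\<close>

lemma Lp_norm_half_disc_le_log:
  fixes f :: "real \<Rightarrow> real^2 \<Rightarrow> 'b::euclidean_space"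
  assumes f: "\<And>\<epsilon>. f \<epsilon> \<in> borel_measurable (lebesgue_on (half_disc R))"
    and R: "R > 0" and "K \<ge> 0" and q: "q > 1"
    and le: "\<And>\<epsilon> v. 0 < \<epsilon> \<Longrightarrow> v \<in> half_disc R \<Longrightarrow> norm (f \<epsilon> v) \<le> K * L_fun \<epsilon> v"
  shows "\<exists>C>0. \<forall>\<epsilon>. 0 < \<epsilon> \<longrightarrow> \<epsilon> < 1 \<longrightarrow> Lp_norm (ennreal q) (half_disc R) (f \<epsilon>) \<le> ennreal (C * \<epsilon> powr (2 / q))"
proof -
  let ?D = "half_disc R"
  define c where "c = 2 * (2 * q) powr q"
  define Kq where "Kq = K powr q"
  define T where "T = 2 * pi * (Kq * c) + 2 * pi * Kq / (2 * q - 2)"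
  have T: "T \<ge> 0" and c: "c \<ge> 0" and Kq: "Kq \<ge> 0" using q by (auto simp: T_def Kq_def c_def)
  have *: "Lp_norm (ennreal q) ?D (f \<epsilon>) \<le> ennreal ((T powr (1/q) + 1) * \<epsilon> powr (2 / q))" if \<epsilon>: "0 < \<epsilon>" "\<epsilon> < 1" for \<epsilon>
  proof -
    define h where "h s = 2 * pi * Kq * \<epsilon> powr (2 * q) * s powr (1 - 2 * q)" for s
    define H where "H s = 2 * pi * Kq * \<epsilon> powr (2 * q) * (s powr (2 - 2 * q) / (2 - 2 * q))" for s
    have bd: "norm (f \<epsilon> v) powr q \<le> Kq * L_fun \<epsilon> v powr q" if "v \<in> ?D" for v
    proof -
      have "norm (f \<epsilon> v) powr q \<le> (K * L_fun \<epsilon> v) powr q"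
        using le[OF \<epsilon>(1) that] q by (intro powr_mono2) auto
      then show ?thesis using \<open>K \<ge> 0\<close> L_fun_nonneg[OF \<epsilon>(1) half_discD(1)[OF that]] by (simp add: powr_mult Kq_def)
    qed
    have "(\<integral>\<^sup>+v. ennreal (norm (f \<epsilon> v) powr q) \<partial>lebesgue_on ?D) \<le> ennreal (2 * pi * (Kq * c * \<epsilon>) * \<epsilon> + (H (max R \<epsilon>) - H \<epsilon>))"
    proof (rule nn_integral_half_disc_split[where h = h])
      show "h \<in> borel_measurable borel" unfolding h_def by measurable
      show "(H has_real_derivative h s) (at s)" if "\<epsilon> \<le> s" for s
      proof -
        have "((\<lambda>s. s powr (2 - 2 * q)) has_real_derivative (2 - 2 * q) * s powr (1 - 2 * q)) (at s)"
          using has_real_derivative_powr[of s "2 - 2 * q"] that \<epsilon> by simp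
        from DERIV_cmult[OF DERIV_cdivide[OF this, of "2 - 2 * q"], of "2 * pi * Kq * \<epsilon> powr (2 * q)"]
        show ?thesis using q by (simp add: H_def[abs_def] h_def)
      qed
      show "ennreal (norm (f \<epsilon> v) powr q) \<le> ennreal (Kq * c * \<epsilon> / norm v)" if "v \<in> ?D" "norm v < \<epsilon>" for v
      proof (rule ennreal_leI)
        have v: "norm v > 0" "v$2 > 0" using half_discD that by auto
        have "L_fun \<epsilon> v powr q \<le> c * (\<epsilon> / norm v)"
          using ln_one_plus_square_powr_le[of "\<epsilon> / norm v" q] q v that
          by (simp add: L_fun_eq[OF v(2)] c_def power_divide)
        then have "Kq * L_fun \<epsilon> v powr q \<le> Kq * (c * (\<epsilon> / norm v))" using Kq by (rule mult_left_mono)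
        then show "norm (f \<epsilon> v) powr q \<le> Kq * c * \<epsilon> / norm v" using bd[OF that(1)] by simp
      qed
      show "ennreal (norm (f \<epsilon> v) powr q) \<le> ennreal (h (norm v) / (2 * pi * norm v))" if "v \<in> ?D" "norm v \<ge> \<epsilon>" for v
      proof (rule ennreal_leI)
        have v: "norm v > 0" "v$2 > 0" using half_discD that by auto
        have "L_fun \<epsilon> v powr q \<le> ((\<epsilon> / norm v)\<^sup>2) powr q"
          using L_fun_le[OF \<epsilon>(1) v(2)] L_fun_nonneg[OF \<epsilon>(1) v(2)] q 
          by (intro powr_mono2) (auto simp: power_divide)
        also have "\<dots> = ((\<epsilon> / norm v) powr 2) powr q" using \<epsilon> v by simp
        also have "\<dots> = \<epsilon> powr (2 * q) / norm v powr (2 * q)"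
          unfolding powr_powr using \<epsilon> v by (intro powr_divide; simp)
        finally have "Kq * L_fun \<epsilon> v powr q \<le> Kq * (\<epsilon> powr (2 * q) / norm v powr (2 * q))" using Kq by (rule mult_left_mono)
        also have "\<dots> = h (norm v) / (2 * pi * norm v)"
          using v by (simp add: h_def powr_diff)
        finally show "norm (f \<epsilon> v) powr q \<le> h (norm v) / (2 * pi * norm v)" using bd[OF that(1)] by simp
      qed
    qed (use R \<epsilon> c Kq in \<open>auto simp: h_def\<close>)
    also have "\<dots> \<le> ennreal (T * \<epsilon> powr 2)"
    proof (rule ennreal_leI)
      have "H (max R \<epsilon>) \<le> 0" using q Kq by (auto simp: H_def intro!: mult_nonneg_nonpos divide_nonneg_neg)
      moreover have "- H \<epsilon> = (2 * pi * Kq / (2 * q - 2)) * \<epsilon> powr 2"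
      proof -
        have "\<epsilon> powr (2 * q) * \<epsilon> powr (2 - 2 * q) = \<epsilon> powr 2" using \<epsilon> by (simp flip: powr_add)
        moreover have "- (a * b * (d / (2 - 2 * q))) = a / (2 * q - 2) * (b * d)" for a b d
          using q by (simp add: field_simps)
        ultimately show ?thesis unfolding H_def by simp
      qed
      ultimately show "2 * pi * (Kq * c * \<epsilon>) * \<epsilon> + (H (max R \<epsilon>) - H \<epsilon>) \<le> T * \<epsilon> powr 2"
        using \<epsilon> by (simp add: T_def algebra_simps power2_eq_square)
    qed
    finally have "Lp_norm (ennreal q) ?D (f \<epsilon>) \<le> ennreal ((T * \<epsilon> powr 2) powr (1/q))"
      using T q by (intro Lp_norm_le f) auto
    also have "(T * \<epsilon> powr 2) powr (1/q) = T powr (1/q) * \<epsilon> powr (2 / q)"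
      using T by (simp add: powr_mult powr_powr)
    also have "\<dots> \<le> (T powr (1/q) + 1) * \<epsilon> powr (2 / q)" by (intro mult_right_mono) auto
    finally show ?thesis by (simp add: ennreal_leI)
  qed
  show ?thesis
    by (intro exI[of _ "T powr (1/q) + 1"]) (use * in \<open>auto intro: add_nonneg_pos\<close>)
qed

text \<open>The borderline case q = 1: the weighted tail is \<epsilon>^2 / s up to a constant, and
  its integral \<epsilon>^2 ln (M / \<epsilon>) is the source of the logarithmic factor.\<close>

lemma L1_norm_half_disc_le_log:
  fixes f :: "real^2 \<Rightarrow> 'b::euclidean_space"
  assumes f: "f \<in> borel_measurable (lebesgue_on (half_disc R))"
    and R: "R > 0" and "K \<ge> 0" and \<epsilon>: "0 < \<epsilon>" "\<epsilon> < 1/2"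
    and le: "\<And>v. v \<in> half_disc R \<Longrightarrow> norm (f v) \<le> K * L_fun \<epsilon> v"
  shows "Lp_norm 1 (half_disc R) f \<le> ennreal (2 * pi * K * ((1 + ln (max R 1)) / ln 2 + 1) * \<epsilon>\<^sup>2 * \<bar>ln \<epsilon>\<bar>)"
proof -
  let ?D = "half_disc R"
  define h where "h s = 2 * pi * K * \<epsilon>\<^sup>2 / s" for s
  define H where "H s = 2 * pi * K * \<epsilon>\<^sup>2 * ln s" for s
  \<comment> \<open>The maximum with 1 ensures both ln M \<ge> 0 and M \<ge> \<epsilon>.\<close>
  define M where "M = max R 1"
  have M: "M \<ge> 1" by (simp add: M_def)
  define J where "J = 2 * pi * (K * \<epsilon>) * \<epsilon> + (H M - H \<epsilon>)"
  have "(\<integral>\<^sup>+v. ennreal (norm (f v) powr 1) \<partial>lebesgue_on ?D) \<le> ennreal J"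
    unfolding J_def
  proof (rule nn_integral_half_disc_split[where h = h])
    show "h \<in> borel_measurable borel" unfolding h_def by measurable
    show "(H has_real_derivative h s) (at s)" if "\<epsilon> \<le> s" for s
      unfolding H_def h_def using that \<epsilon>
      by (auto intro!: derivative_eq_intros simp: field_simps)
    show "ennreal (norm (f v) powr 1) \<le> ennreal (K * \<epsilon> / norm v)" if "v \<in> ?D" "norm v < \<epsilon>" for v
    proof (rule ennreal_leI)
      have v: "norm v > 0" "v$2 > 0" using half_discD that by auto
      have "K * L_fun \<epsilon> v \<le> K * (\<epsilon> / norm v)"
        using L_fun_le'[OF \<epsilon>(1) v(2)] \<open>K \<ge> 0\<close> by (intro mult_left_mono) auto
      then show "norm (f v) powr 1 \<le> K * \<epsilon> / norm v" using le[OF that(1)] by simp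
    qed
    show "ennreal (norm (f v) powr 1) \<le> ennreal (h (norm v) / (2 * pi * norm v))" if "v \<in> ?D" "norm v \<ge> \<epsilon>" for v
    proof (rule ennreal_leI)
      have v: "norm v > 0" "v$2 > 0" using half_discD that by auto
      have "K * L_fun \<epsilon> v \<le> K * (\<epsilon>\<^sup>2 / (norm v)\<^sup>2)"
        using L_fun_le[OF \<epsilon>(1) v(2)] \<open>K \<ge> 0\<close> by (intro mult_left_mono) auto
      also have "\<dots> = h (norm v) / (2 * pi * norm v)" using v by (simp add: h_def power2_eq_square)
      finally show "norm (f v) powr 1 \<le> h (norm v) / (2 * pi * norm v)" using le[OF that(1)] by simp
    qed
  qed (use R \<epsilon> M \<open>K \<ge> 0\<close> in \<open>auto simp: h_def M_def\<close>)
  moreover have lnM: "ln M \<ge> 0" and lne: "ln \<epsilon> \<le> - ln 2" "\<bar>ln \<epsilon>\<bar> = - ln \<epsilon>"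
    using M \<epsilon> ln_le_cancel_iff[of \<epsilon> "1/2"] by (auto simp: ln_div)
  have Jeq: "J = 2 * pi * K * \<epsilon>\<^sup>2 * (1 + ln M + \<bar>ln \<epsilon>\<bar>)"
    using lne by (simp add: J_def H_def algebra_simps power2_eq_square)
  have J0: "J \<ge> 0" unfolding Jeq using \<open>K \<ge> 0\<close> lnM by simp
  ultimately have "Lp_norm (ennreal 1) ?D f \<le> ennreal (J powr (1 / 1))"
    using J0 by (intro Lp_norm_le f) auto
  also have "J powr (1 / 1) = J" using J0 by simp
  also have "J \<le> 2 * pi * K * ((1 + ln M) / ln 2 + 1) * \<epsilon>\<^sup>2 * \<bar>ln \<epsilon>\<bar>"
  proof -
    have l2: "ln (2::real) > 0" by simp
    \<comment> \<open>As \<epsilon> < 1/2, the logarithm of \<epsilon> has modulus at least ln 2,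
      and the bounded term 1 + ln M is absorbed.\<close>
    have "(1 + ln M) * ln 2 \<le> (1 + ln M) * \<bar>ln \<epsilon>\<bar>" using lne lnM by (intro mult_left_mono) auto
    then have "1 + ln M \<le> (1 + ln M) / ln 2 * \<bar>ln \<epsilon>\<bar>" using l2 by (simp add: field_simps)
    then have "1 + ln M + \<bar>ln \<epsilon>\<bar> \<le> ((1 + ln M) / ln 2 + 1) * \<bar>ln \<epsilon>\<bar>" by (simp add: algebra_simps)
    then have "2 * pi * K * \<epsilon>\<^sup>2 * (1 + ln M + \<bar>ln \<epsilon>\<bar>) \<le> 2 * pi * K * \<epsilon>\<^sup>2 * (((1 + ln M) / ln 2 + 1) * \<bar>ln \<epsilon>\<bar>)"
      using \<open>K \<ge> 0\<close> by (intro mult_left_mono) auto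
    also have "\<dots> = 2 * pi * K * ((1 + ln M) / ln 2 + 1) * \<epsilon>\<^sup>2 * \<bar>ln \<epsilon>\<bar>" by (simp only: mult_ac)
    finally show ?thesis unfolding Jeq .
  qed
  finally show ?thesis by (simp add: M_def ennreal_leI)
qed

section \<open>Measurability and the L^p estimates of the difference\<close>

lemma continuous_on_L_fun [continuous_intros]: "continuous_on (half_disc R) (L_fun \<epsilon>)"
  by (intro continuous_at_imp_continuous_on ballI has_derivative_continuous[OF has_derivative_L] half_discD(1))

lemma continuous_on_M_fun [continuous_intros]: "continuous_on (half_disc R) (M_fun \<epsilon>)"
  by (intro continuous_at_imp_continuous_on ballI has_derivative_continuous[OF has_derivative_M] half_discD(1))

lemma continuous_on_M2_fun [continuous_intros]: "continuous_on (half_disc R) (M2_fun \<epsilon>)"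
proof -
  have "(v$1)\<^sup>2 + (v$2)\<^sup>2 \<noteq> 0" "(v$1)\<^sup>2 + (v$2)\<^sup>2 + \<epsilon>\<^sup>2 \<noteq> 0" if "v \<in> half_disc R" for v
    using sum_squares_pos[OF half_discD(1)[OF that]] by (metis less_numeral_extra(3))+
  then show ?thesis unfolding M2_fun_def[abs_def] by (intro continuous_intros) auto
qed

lemma continuous_on_toC [continuous_intros]: "continuous_on S toC"
  using bounded_linear_toC by (rule linear_continuous_on)

lemma continuous_on_vector2:
  fixes f g :: "'a::topological_space \<Rightarrow> 'b::real_normed_vector"
  assumes "continuous_on S f" "continuous_on S g"
  shows "continuous_on S (\<lambda>x. vector [f x, g x] :: 'b^2)"
proof -
  have "(\<lambda>x. vector [f x, g x] :: 'b^2) = (\<lambda>x. \<chi> i. if i = 1 then f x else g x)"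
    by (auto simp: vec_eq_iff forall_2)
  moreover have "continuous_on S (\<lambda>x. if i = 1 then f x else g x)" for i :: 2
    using assms by (cases "i = 1") auto
  ultimately show ?thesis by (simp only: continuous_on_vec_lambda)
qed

lemma measurable_u_diff: "u_diff \<epsilon> k \<in> borel_measurable (lebesgue_on (half_disc R))"
  by (rule borel_measurable_half_disc[where g = "\<lambda>v. - 1 / (2 * pi) * (L_fun \<epsilon> v * Im (toC v ^ k))"])
     (auto simp: u_diff_eq intro!: continuous_intros)

lemma measurable_grad_u_diff: "grad (u_diff \<epsilon> k) \<in> borel_measurable (lebesgue_on (half_disc R))"
  by (rule borel_measurable_half_disc[where g = "grad_explicit \<epsilon> k"])
     (auto simp: grad_u_diff half_discD grad_explicit_def intro!: continuous_intros continuous_on_vector2)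

lemma measurable_hessian_u_diff: "hessian (u_diff \<epsilon> k) \<in> borel_measurable (lebesgue_on (half_disc R))"
  by (rule borel_measurable_half_disc[where g = "hess_explicit \<epsilon> k"])
     (auto simp: hessian_u_diff half_discD hess_explicit_def Let_def intro!: continuous_intros continuous_on_vector2)

lemma norm_power_le_half_disc:
  assumes "v \<in> half_disc R" "R > 0" shows "norm v ^ m \<le> R ^ m"
  using half_discD(2)[OF assms] by (intro power_mono) auto

lemma Lp_norm_grad_u_diff_le:
  assumes R: "R > 0" and k: "k \<ge> 2"
  shows "\<exists>C>0. \<forall>p::ennreal. 1 \<le> p \<longrightarrow> (\<forall>\<epsilon>\<in>{0<..<1/2}.
        Lp_norm p (half_disc R) (grad (u_diff \<epsilon> k)) \<le> ennreal (C * \<epsilon> powr enn2real (2 / p)))"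
proof -
  define K where "K = (2 * k + 4) * R ^ (k - 2)"
  have K: "K > 0" using R k by (simp add: K_def)
  have le: "norm (grad (u_diff \<epsilon> k) v) \<le> K * (norm v * L_fun \<epsilon> v)" if "0 < \<epsilon>" "v \<in> half_disc R" for \<epsilon> v
  proof -
    note v = half_discD(1)[OF that(2)]
    have "norm (grad (u_diff \<epsilon> k) v) \<le> (2 * k + 4) * (norm v ^ (k-1) * L_fun \<epsilon> v)"
      using norm_grad_explicit_le[OF that(1) v, of k] k by (simp add: grad_u_diff[OF v])
    also have "norm v ^ (k-1) = norm v ^ (k-2) * norm v"
    proof -
      have "k - 1 = Suc (k - 2)" using k by simp
      then show ?thesis by simp
    qed
    also have "\<dots> * L_fun \<epsilon> v \<le> R ^ (k-2) * norm v * L_fun \<epsilon> v"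
      using L_fun_nonneg[OF that(1) v] by (intro mult_right_mono norm_power_le_half_disc that R) auto
    finally show ?thesis by (simp add: K_def mult_ac mult_left_mono)
  qed
  show ?thesis
  proof (intro exI[of _ "K * max 1 (2 * pi * R + 2 * pi)"] conjI allI impI ballI)
    fix p :: ennreal and \<epsilon> :: real assume "1 \<le> p" "\<epsilon> \<in> {0<..<1/2}"
    then show "Lp_norm p (half_disc R) (grad (u_diff \<epsilon> k)) \<le> ennreal (K * max 1 (2 * pi * R + 2 * pi) * \<epsilon> powr enn2real (2 / p))"
      using K R by (intro Lp_norm_half_disc_le measurable_grad_u_diff le) auto
  qed (use K in auto)
qed

lemma Lp_norm_hessian_u_diff_le:
  assumes R: "R > 0" and k: "k \<ge> 2" and p: "1 \<le> p"
  shows "\<exists>C>0. \<forall>\<epsilon>\<in>{0<..<1/2}.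
        (k > 2 \<or> (1 < p \<and> p < \<infinity>) \<longrightarrow>
           Lp_norm p (half_disc R) (hessian (u_diff \<epsilon> k)) \<le> ennreal (C * \<epsilon> powr enn2real (2 / p))) \<and>
        (k = 2 \<and> p = 1 \<longrightarrow>
           Lp_norm p (half_disc R) (hessian (u_diff \<epsilon> k)) \<le> ennreal (C * \<epsilon>\<^sup>2 * \<bar>ln \<epsilon>\<bar>))"
proof -
  define N where "N = real (4 * (10 + 4 * k + k * k))"
  have N: "N > 0" by (simp add: N_def add_pos_nonneg)
  have le: "norm (hessian (u_diff \<epsilon> k) v) \<le> N * (norm v ^ (k-2) * L_fun \<epsilon> v)" if "0 < \<epsilon>" "v \<in> half_disc R" for \<epsilon> v
    using norm_hess_explicit_le[OF that(1) half_discD(1)[OF that(2)] k]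
    by (simp add: hessian_u_diff[OF half_discD(1)[OF that(2)]] N_def)
  consider "k > 2" | "k = 2" "p = 1" | "k = 2" "1 < p" "p < \<infinity>" | "k = 2" "p = \<infinity>"
    using k p le_less[of 2 k] le_less[of 1 p] top.not_eq_extremum[of p] by auto
  then show ?thesis
  proof cases
    case 1
    \<comment> \<open>One factor r is kept next to L, as \<open>Lp_norm_half_disc_le\<close>
      demands; the other k - 3 are bounded by R.\<close>
    define K where "K = N * R ^ (k - 3)"
    have K: "K > 0" using R N by (simp add: K_def)
    have le': "norm (hessian (u_diff \<epsilon> k) v) \<le> K * (norm v * L_fun \<epsilon> v)" if "0 < \<epsilon>" "v \<in> half_disc R" for \<epsilon> v
    proof -
      note v = half_discD(1)[OF that(2)]
      have "k - 2 = Suc (k - 3)" using 1 by simp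
      then have "norm v ^ (k-2) * L_fun \<epsilon> v = norm v ^ (k-3) * norm v * L_fun \<epsilon> v" by simp
      also have "\<dots> \<le> R ^ (k-3) * norm v * L_fun \<epsilon> v"
        using L_fun_nonneg[OF that(1) v] by (intro mult_right_mono norm_power_le_half_disc that R) auto
      finally have "N * (norm v ^ (k-2) * L_fun \<epsilon> v) \<le> N * (R ^ (k-3) * norm v * L_fun \<epsilon> v)"
        using N by (intro mult_left_mono) auto
      with le[OF that] show ?thesis by (simp add: K_def mult_ac)
    qed
    show ?thesis
    proof (intro exI[of _ "K * max 1 (2 * pi * R + 2 * pi)"] conjI impI ballI)
      fix \<epsilon> :: real assume "\<epsilon> \<in> {0<..<1/2}"
      then show "Lp_norm p (half_disc R) (hessian (u_diff \<epsilon> k)) \<le> ennreal (K * max 1 (2 * pi * R + 2 * pi) * \<epsilon> powr enn2real (2 / p))"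
        using K R p by (intro Lp_norm_half_disc_le measurable_hessian_u_diff le') auto
    qed (use K 1 in auto)
  next
    case 2
    show ?thesis
    proof (intro exI[of _ "2 * pi * N * ((1 + ln (max R 1)) / ln 2 + 1)"] conjI impI ballI)
      show "0 < 2 * pi * N * ((1 + ln (max R 1)) / ln 2 + 1)"
        using N by (intro mult_pos_pos add_nonneg_pos) auto
      fix \<epsilon> :: real assume "\<epsilon> \<in> {0<..<1/2}"
      then show "Lp_norm p (half_disc R) (hessian (u_diff \<epsilon> k)) \<le> ennreal (2 * pi * N * ((1 + ln (max R 1)) / ln 2 + 1) * \<epsilon>\<^sup>2 * \<bar>ln \<epsilon>\<bar>)"
        unfolding 2(2)
        using N R le[of \<epsilon>] 2(1) by (intro L1_norm_half_disc_le_log measurable_hessian_u_diff) auto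
    qed (use 2 in auto)
  next
    case 3
    then obtain q where q: "p = ennreal q" "q \<ge> 0" by (cases p) auto
    with \<open>1 < p\<close> have q1: "q > 1" by (metis ennreal_1 ennreal_less_iff zero_le_one)
    have e2q: "enn2real (2 / p) = 2 / q"
      using q1 q divide_ennreal[of 2 q] by simp
    have "\<exists>C>0. \<forall>\<epsilon>. 0 < \<epsilon> \<longrightarrow> \<epsilon> < 1 \<longrightarrow> Lp_norm (ennreal q) (half_disc R) (hessian (u_diff \<epsilon> k)) \<le> ennreal (C * \<epsilon> powr (2 / q))"
      by (rule Lp_norm_half_disc_le_log[of _ _ N]) (use measurable_hessian_u_diff R N q1 le 3 in auto)
    then show ?thesis using 3 e2q q(1) by auto
  next
    case 4
    \<comment> \<open>For k = 2 and p = \<infinity> both implications have a false premise, so any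
      positive constant will do.\<close>
    then show ?thesis using p by (intro exI[of _ 1]) auto
  qed
qed

text \<open>The upper bound is pointwise: r^k L \<le> r^(k-2) \<epsilon>^2. For the lower bound, Im
  z^k is bounded away from 0 on a fixed nonempty open set, and L \<ge> \<epsilon>^2 / (R^2 + 1)
  there, so neither the set nor the constant depends on \<epsilon>.\<close>

lemma Lp_norm_u_diff_bounds:
  assumes R: "R > 0" and k: "k \<ge> 2"
  shows "\<exists>c>0. \<exists>C>0. \<forall>p::ennreal. 1 \<le> p \<longrightarrow> (\<forall>\<epsilon>\<in>{0<..<1/2}.
        ennreal (c * R ^ (k - 2) * \<epsilon>\<^sup>2) \<le> Lp_norm p (half_disc R) (u_diff \<epsilon> k) \<and>
        Lp_norm p (half_disc R) (u_diff \<epsilon> k) \<le> ennreal (C * R ^ (k - 2) * \<epsilon>\<^sup>2))"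
proof -
  let ?D = "half_disc R"
  define P where "P v = Im (toC v ^ k)" for v
  define S where "S = ?D \<inter> {v. P v > (R/2)^k / 2}"
  have S: "open S"
    unfolding S_def P_def by (intro open_Int open_half_disc open_Collect_less continuous_intros)
  have "S \<noteq> {}"
  proof -
    \<comment> \<open>At this angle sin (k \<theta>) = 1, so Im z^k takes its largest value (R/2)^k
      on the circle of radius R/2.\<close>
    define \<theta> where "\<theta> = pi / (2 * k)"
    have th: "0 < \<theta>" "\<theta> < pi" "k * \<theta> = pi / 2" using k by (auto simp: \<theta>_def field_simps)
    define v :: "real^2" where "v = vector [R/2 * cos \<theta>, R/2 * sin \<theta>]"
    have "toC v = complex_of_real (R/2) * cis \<theta>" by (simp add: toC_def v_def complex_eq_iff)
    then have "toC v ^ k = complex_of_real ((R/2)^k) * cis (k * \<theta>)"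
      by (simp only: power_mult_distrib Complex.DeMoivre of_real_power)
    then have "P v = (R/2)^k" by (simp add: P_def th)
    moreover have "(v$1)\<^sup>2 + (v$2)\<^sup>2 = (R/2)\<^sup>2"
    proof -
      have v: "v$1 = R/2 * cos \<theta>" "v$2 = R/2 * sin \<theta>" by (simp_all add: v_def)
      show ?thesis unfolding v power_mult_distrib distrib_left[symmetric] by simp
    qed
    moreover have "(R/2)\<^sup>2 < R\<^sup>2" using R by (simp add: power_divide)
    moreover have "v$2 > 0" using R th sin_gt_zero[of \<theta>] by (simp add: v_def)
    ultimately have "v \<in> ?D" "P v = (R/2)^k" by (simp_all add: half_disc_def)
    then have "v \<in> S" using R by (simp add: S_def)
    then show ?thesis by auto
  qed
  have "S \<subseteq> ball 0 R" using half_disc_sub_ball[of R] R by (auto simp: S_def)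
  then have "bounded S" by (rule bounded_subset[OF bounded_ball])
  from emeasure_bounded_finite[OF this] have fin: "emeasure lborel S \<noteq> \<infinity>" by simp
  define m where "m = measure lborel S"
  have m: "emeasure lebesgue S = ennreal m"
    using fin S by (simp add: m_def emeasure_eq_ennreal_measure)
  have "m > 0"
  proof -
    have "\<not> negligible S" using S \<open>S \<noteq> {}\<close> open_not_negligible by blast
    then have "emeasure lebesgue S \<noteq> 0" using S by (auto simp: negligible_iff_null_sets null_sets_def)
    then show ?thesis using m by (metis ennreal_0 ennreal_eq_0_iff not_le)
  qed
  \<comment> \<open>The factor 4 pi is the 2 pi from the prefactor of the difference times the 2 in
    the threshold that defines \<open>S\<close>; R^2 + 1 bounds r^2 + \<epsilon>^2.\<close>
  define \<delta> where "\<delta> = (R/2)^k / (4 * pi * (R\<^sup>2 + 1))"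
  have \<delta>: "\<delta> > 0" using R by (simp add: \<delta>_def add_nonneg_pos)
  have lower: "ennreal (\<delta> * min 1 m * \<epsilon>\<^sup>2) \<le> Lp_norm p ?D (u_diff \<epsilon> k)"
    if "1 \<le> p" "0 < \<epsilon>" "\<epsilon> < 1/2" for p \<epsilon>
  proof -
    have "\<delta> * \<epsilon>\<^sup>2 \<le> norm (u_diff \<epsilon> k v)" if "v \<in> S" for v
    proof -
      have v: "v \<in> ?D" "P v > (R/2)^k / 2" using that by (auto simp: S_def)
      note v' = half_discD(1)[OF v(1)]
      have nv: "(norm v)\<^sup>2 \<le> R\<^sup>2" using half_discD(2)[OF v(1) R] by (intro power_mono) auto
      have e1: "\<epsilon>\<^sup>2 \<le> 1" using \<open>0 < \<epsilon>\<close> \<open>\<epsilon> < 1/2\<close> by (simp add: power_le_one)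
      have "\<epsilon>\<^sup>2 / (R\<^sup>2 + 1) \<le> \<epsilon>\<^sup>2 / ((norm v)\<^sup>2 + \<epsilon>\<^sup>2)"
        using nv e1 \<open>0 < \<epsilon>\<close> by (intro divide_left_mono mult_pos_pos add_nonneg_pos) auto
      also have "\<dots> \<le> L_fun \<epsilon> v" by (rule L_fun_ge[OF \<open>0 < \<epsilon>\<close> v'])
      finally have L: "\<epsilon>\<^sup>2 / (R\<^sup>2 + 1) \<le> L_fun \<epsilon> v" .
      have "\<delta> * \<epsilon>\<^sup>2 = 1 / (2 * pi) * (\<epsilon>\<^sup>2 / (R\<^sup>2 + 1) * ((R/2)^k / 2))"
      proof -
        have "a / (4 * pi * b) * e = 1 / (2 * pi) * (e / b * (a / 2))" for a b e :: real by (simp add: mult_ac)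
        then show ?thesis unfolding \<delta>_def .
      qed
      also have "\<dots> \<le> 1 / (2 * pi) * (L_fun \<epsilon> v * P v)"
        using L v R L_fun_nonneg[OF \<open>0 < \<epsilon>\<close> v'] by (intro mult_left_mono mult_mono) auto
      also have "\<dots> = \<bar>- 1 / (2 * pi) * (L_fun \<epsilon> v * P v)\<bar>"
      proof -
        have "P v > 0" using v(2) zero_less_power[of "R/2" k] R by linarith
        then show ?thesis using L_fun_nonneg[OF \<open>0 < \<epsilon>\<close> v'] by (simp add: abs_mult)
      qed
      finally show ?thesis by (simp only: u_diff_eq P_def real_norm_def)
    qed
    then have "ennreal (\<delta> * \<epsilon>\<^sup>2 * min 1 m) \<le> Lp_norm p ?D (u_diff \<epsilon> k)"
      using that m \<open>m > 0\<close> S \<delta> by (intro Lp_norm_ge[where S=S] measurable_u_diff) (auto simp: S_def)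
    then show ?thesis by (simp add: mult_ac)
  qed
  define J where "J = pi * R\<^sup>2"
  have J: "emeasure lebesgue ?D \<le> ennreal J"
  proof -
    have "emeasure lebesgue ?D \<le> emeasure lebesgue (ball (0::real^2) R)"
      using half_disc_sub_ball[of R] R by (intro emeasure_mono) auto
    also have "\<dots> = ennreal J" using R by (simp add: J_def emeasure_ball unit_ball_vol_2)
    finally show ?thesis .
  qed
  have upper: "Lp_norm p ?D (u_diff \<epsilon> k) \<le> ennreal (max 1 J * R ^ (k-2) * \<epsilon>\<^sup>2)"
    if "1 \<le> p" "0 < \<epsilon>" "\<epsilon> < 1/2" for p \<epsilon>
  proof -
    define K where "K = R ^ (k-2) * \<epsilon>\<^sup>2"
    have K: "K \<ge> 0" using R by (simp add: K_def)
    have le: "norm (u_diff \<epsilon> k v) \<le> K" if "v \<in> ?D" for v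
    proof -
      note v = half_discD(1,3)[OF that]
      have "norm (u_diff \<epsilon> k v) \<le> norm v ^ k * L_fun \<epsilon> v"
        using abs_u_diff_le[OF \<open>0 < \<epsilon>\<close> v(1)] by simp
      also have "\<dots> \<le> norm v ^ k * (\<epsilon>\<^sup>2 / (norm v)\<^sup>2)"
        by (intro mult_left_mono L_fun_le \<open>0 < \<epsilon>\<close> v) auto
      also have "\<dots> = norm v ^ (k-2) * \<epsilon>\<^sup>2"
        using v k by (simp add: power_diff)
      also have "\<dots> \<le> K" unfolding K_def using norm_power_le_half_disc[OF that R] by (intro mult_right_mono) auto
      finally show ?thesis .
    qed
    have "Lp_norm p ?D (u_diff \<epsilon> k) \<le> ennreal (K * max 1 J)"
    proof (cases "p = \<infinity>")
      case True
      have "Lp_norm p ?D (u_diff \<epsilon> k) \<le> ennreal K"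
        unfolding True by (intro Linf_norm_le measurable_u_diff le) auto
      also have "\<dots> \<le> ennreal (K * max 1 J)" using K mult_left_mono[of 1 "max 1 J" K] by (intro ennreal_leI) auto
      finally show ?thesis .
    next
      case False
      then obtain q where q: "p = ennreal q" "q \<ge> 0" by (cases p) auto
      with \<open>1 \<le> p\<close> have q1: "q \<ge> 1" by (metis ennreal_1 ennreal_le_iff2 not_one_le_zero)
      have "(\<integral>\<^sup>+v. ennreal (norm (u_diff \<epsilon> k v) powr q) \<partial>lebesgue_on ?D) \<le> (\<integral>\<^sup>+v. ennreal (K powr q) \<partial>lebesgue_on ?D)"
        using q1 le by (intro nn_integral_mono) (auto intro!: ennreal_leI powr_mono2)
      also have "\<dots> = ennreal (K powr q) * emeasure lebesgue ?D"
        by (simp add: emeasure_restrict_space)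
      also have "\<dots> \<le> ennreal (K powr q) * ennreal J" by (intro mult_left_mono J) auto
      also have "\<dots> = ennreal (K powr q * J)" by (simp add: ennreal_mult')
      finally have "Lp_norm p ?D (u_diff \<epsilon> k) \<le> ennreal ((K powr q * J) powr (1/q))"
        unfolding q(1) using q1 by (intro Lp_norm_le measurable_u_diff) (auto simp: J_def)
      also have "(K powr q * J) powr (1/q) = K * J powr (1/q)"
        using q1 K by (simp add: powr_mult powr_powr J_def)
      also have "\<dots> \<le> K * max 1 J"
        using K q1 by (intro mult_left_mono powr_inverse_le_max) (auto simp: J_def)
      finally show ?thesis by (simp add: ennreal_leI)
    qed
    then show ?thesis by (simp add: K_def mult_ac)
  qed
  \<comment> \<open>The constant may depend on R, so the power of R in the claim is divided
    out.\<close>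
  define c where "c = \<delta> * min 1 m / R ^ (k-2)"
  have "c > 0" using \<delta> \<open>m > 0\<close> R by (simp add: c_def)
  moreover have "max 1 J > 0" by simp
  moreover have "\<forall>p::ennreal. 1 \<le> p \<longrightarrow> (\<forall>\<epsilon>\<in>{0<..<1/2}.
        ennreal (c * R ^ (k - 2) * \<epsilon>\<^sup>2) \<le> Lp_norm p ?D (u_diff \<epsilon> k) \<and>
        Lp_norm p ?D (u_diff \<epsilon> k) \<le> ennreal (max 1 J * R ^ (k - 2) * \<epsilon>\<^sup>2))"
    using lower upper R by (simp add: c_def)
  ultimately show ?thesis by blast
qed

section \<open>Angular integrals\<close>

lemma antiderivative_exists:
  fixes g :: "real \<Rightarrow> real"
  assumes "continuous_on UNIV g"
  obtains F where "\<And>x. (F has_real_derivative g x) (at x)" "F a = 0"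
proof -
  have "\<exists>F. \<forall>x::real. -\<infinity> < ereal x \<longrightarrow> ereal x < \<infinity> \<longrightarrow> (F has_vector_derivative g x) (at x)"
    by (rule einterval_antiderivative) (use assms in \<open>auto simp: continuous_on_eq_continuous_at\<close>)
  then obtain F where F: "\<And>x. (F has_real_derivative g x) (at x)"
    by (auto simp: has_real_derivative_iff_has_vector_derivative)
  have "((\<lambda>x. F x - F a) has_real_derivative g x) (at x)" for x
    using DERIV_diff[OF F DERIV_const] by simp
  then show thesis by (intro that[of "\<lambda>x. F x - F a"]) auto
qed

text \<open>Iterated primitives, prepended one at a time. Their common zero at \<open>a\<close>
  makes Taylor polynomials at \<open>a\<close> vanish later on.\<close>

lemma antiderivative_chain_exists:
  fixes g :: "real \<Rightarrow> real"
  assumes "continuous_on UNIV g"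
  shows "\<exists>F. F n = g \<and> (\<forall>j<n. F j a = 0 \<and> (\<forall>x. (F j has_real_derivative F (Suc j) x) (at x)))"
proof (induction n)
  case 0
  then show ?case by (intro exI[of _ "\<lambda>_. g"]) auto
next
  case (Suc n)
  then obtain F where F: "F n = g" "\<And>j x. j < n \<Longrightarrow> (F j has_real_derivative F (Suc j) x) (at x)" "\<And>j. j < n \<Longrightarrow> F j a = 0" by blast
  have "continuous_on UNIV (F 0)"
  proof (cases "n = 0")
    case True then show ?thesis using F assms by simp
  next
    case False then show ?thesis using F(2)[of 0] by (intro DERIV_continuous_on) (auto intro: DERIV_subset)
  qed
  then obtain G where G: "\<And>x. (G has_real_derivative F 0 x) (at x)" "G a = 0" 
    using antiderivative_exists by metis
  let ?F = "\<lambda>j. case j of 0 \<Rightarrow> G | Suc i \<Rightarrow> F i"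
  show ?case
    by (rule exI[of _ ?F]) (use F G in \<open>auto split: nat.splits\<close>)
qed

lemma has_integral_derivative_real:
  fixes F f :: "real \<Rightarrow> real"
  assumes "a \<le> b" "\<And>x. (F has_real_derivative f x) (at x)"
  shows "(f has_integral (F b - F a)) {a..b}"
  by (rule fundamental_theorem_of_calculus[OF assms(1)])
     (use assms(2) in \<open>auto simp: has_real_derivative_iff_has_vector_derivative intro: has_vector_derivative_at_within\<close>)

lemma integral_periodic_derivative_eq_0:
  assumes "\<And>x. (F has_real_derivative f x) (at x)" "F (2 * pi) = F 0"
  shows "integral {0..2*pi} f = 0"
  using has_integral_derivative_real[of 0 "2*pi" F f] assms by (simp add: integral_unique)

text \<open>For a primitive H, the function H (x + 2 pi) - H x has derivative 0, so all periods have
  the same integral.\<close>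

lemma integral_periodic_shift:
  fixes h :: "real \<Rightarrow> real"
  assumes "continuous_on UNIV h" "\<And>x. h (x + 2 * pi) = h x"
  shows "integral {0..2*pi} (\<lambda>x. h (x + c)) = integral {0..2*pi} h"
proof -
  obtain H where H: "\<And>x. (H has_real_derivative h x) (at x)"
    using antiderivative_exists[OF assms(1)] by metis
  have "((\<lambda>x. H (x + 2 * pi) - H x) has_real_derivative 0) (at x)" for x
  proof -
    have "((\<lambda>x. H (x + 2 * pi)) has_real_derivative h (x + 2 * pi)) (at x)"
      using H DERIV_shift by blast
    from DERIV_diff[OF this H] show ?thesis by (simp add: assms(2))
  qed
  from DERIV_isconst_all[OF allI, OF this, of c 0]
  have "H (2 * pi + c) - H (0 + c) = H (2 * pi) - H 0" by (simp add: add.commute)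
  moreover have "((\<lambda>x. h (x + c)) has_integral (H (2 * pi + c) - H (0 + c))) {0..2*pi}"
    by (intro has_integral_derivative_real DERIV_shift[THEN iffD1] H) auto
  moreover have "(h has_integral (H (2 * pi) - H 0)) {0..2*pi}"
    using H by (intro has_integral_derivative_real) auto
  ultimately show ?thesis by (simp add: integral_unique)
qed

lemma integral_periodic_odd:
  fixes h :: "real \<Rightarrow> real"
  assumes "continuous_on UNIV h" "\<And>x. h (x + 2 * pi) = h x" "\<And>x. h (- x) = - h x"
  shows "integral {0..2*pi} h = 0"
proof -
  obtain H where H: "\<And>x. (H has_real_derivative h x) (at x)"
    using antiderivative_exists[OF assms(1)] by metis
  have "((\<lambda>x. H (- x) - H x) has_real_derivative 0) (at x)" for x
    using DERIV_diff[OF DERIV_mirror[THEN iffD1, OF H[of "- x"]] H[of x]] by (simp add: assms(3))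
  from DERIV_isconst_all[OF allI, OF this, of pi 0] have "H (- pi) = H pi" by simp
  moreover have "((\<lambda>x. h (x + (- pi))) has_integral (H (2 * pi + (- pi)) - H (0 + (- pi)))) {0..2*pi}"
    by (intro has_integral_derivative_real DERIV_shift[THEN iffD1] H) auto
  ultimately have "integral {0..2*pi} (\<lambda>x. h (x + (- pi))) = 0" by (simp add: integral_unique)
  then show ?thesis unfolding integral_periodic_shift[OF assms(1,2)] .
qed

lemma continuous_integrable: "continuous_on UNIV h \<Longrightarrow> (h :: real \<Rightarrow> real) integrable_on {a..b}"
  by (meson continuous_on_subset integrable_continuous_real top_greatest)

section \<open>Rodrigues' formula and convolution on the circle\<close>

text \<open>The reciprocal of the double factorial (2 n - 1)!!, the normalising constant of
  Rodrigues' formula for Chebyshev polynomials.\<close>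

definition chebyshev_const :: "nat \<Rightarrow> real" where
  "chebyshev_const n = (\<Prod>i<n. 1 / (2 * real i + 1))"

lemma chebyshev_const_pos: "chebyshev_const n > 0"
  unfolding chebyshev_const_def by (intro prod_pos) auto

lemma chebyshev_const_Suc: "chebyshev_const (Suc n) = chebyshev_const n / (2 * n + 1)"
  by (simp add: chebyshev_const_def)

text \<open>In the variable x = cos \<phi> this is n-fold integration by parts against the Chebyshev
  polynomial. The proof instead uses the recurrence cos ((k+1) \<phi>) = 2 cos \<phi> cos (k \<phi>)
  - cos ((k-1) \<phi>), which needs the two preceding cases and avoids half-integer powers of 1 -
  x^2.\<close>

lemma rodrigues_integral:
  fixes G :: "nat \<Rightarrow> real \<Rightarrow> real"
  assumes "\<And>j x. j < n \<Longrightarrow> (G j has_real_derivative G (Suc j) x) (at x)" "continuous_on UNIV (G n)"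
  shows "integral {0..2*pi} (\<lambda>\<phi>. cos (n * \<phi>) * G 0 (cos \<phi>))
       = chebyshev_const n * integral {0..2*pi} (\<lambda>\<phi>. sin \<phi> ^ (2*n) * G n (cos \<phi>))"
  using assms
proof (induction n arbitrary: G rule: induct_nat_012)
  case 0
  then show ?case by (simp add: chebyshev_const_def)
next
  case (1 G)
  have c: "continuous_on UNIV (G 0)" "continuous_on UNIV (G 1)"
    using 1 by (auto intro!: DERIV_continuous_on[where f="G 0" and D="G 1"] intro: DERIV_subset)
  have cc: "continuous_on UNIV (\<lambda>x. cos x * G 0 (cos x))" "continuous_on UNIV (\<lambda>x. (sin x)\<^sup>2 * G 1 (cos x))"
    by (intro continuous_intros continuous_on_compose2[OF c(1)] continuous_on_compose2[OF c(2)]; simp)+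
  have "integral {0..2*pi} (\<lambda>x. cos x * G 0 (cos x) - (sin x)\<^sup>2 * G 1 (cos x)) = 0"
  proof (rule integral_periodic_derivative_eq_0)
    show "((\<lambda>x. sin x * G 0 (cos x)) has_real_derivative cos x * G 0 (cos x) - (sin x)\<^sup>2 * G 1 (cos x)) (at x)" for x
      by (rule derivative_eq_intros DERIV_chain2[OF 1(1)[of 0]] refl | simp add: power2_eq_square)+
  qed simp
  then show ?case
    using integral_diff[OF cc[THEN continuous_integrable], of 0 "2*pi"]
    by (simp add: chebyshev_const_def power2_eq_square)
next
  case (ge2 n G)
  define k where "k = Suc n"
  note G = ge2(3)
  have cG: "continuous_on UNIV (G j)" if "j \<le> Suc k" for j
  proof (cases "j = Suc k")
    case True then show ?thesis using ge2(4) by (simp add: k_def)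
  next
    case False
    then have "j < Suc (Suc n)" using that by (simp add: k_def)
    then show ?thesis by (intro DERIV_continuous_on[where D="G (Suc j)"]) (auto intro: DERIV_subset G)
  qed
  define I where "I h = integral {0..2*pi} h" for h :: "real \<Rightarrow> real"
  define A where "A = I (\<lambda>\<phi>. sin \<phi> ^ (2 * n) * G n (cos \<phi>))"
  define B where "B = I (\<lambda>\<phi>. sin \<phi> ^ (2 * k) * G n (cos \<phi>))"
  define I1 where "I1 = I (\<lambda>\<phi>. sin \<phi> ^ (2 * k) * cos \<phi> * G k (cos \<phi>))"
  define Z where "Z = I (\<lambda>\<phi>. sin \<phi> ^ (2 * Suc k) * G (Suc k) (cos \<phi>))"
  have cc [continuous_intros]: "continuous_on UNIV (\<lambda>x. G j (cos x))" if "j \<le> Suc k" for j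
    by (rule continuous_on_compose2[OF cG[OF that]]) (auto intro: continuous_intros)
  have der: "((\<lambda>x. G j (cos x)) has_real_derivative - sin x * G (Suc j) (cos x)) (at x)" if "j \<le> k" for j x
    using DERIV_chain2[OF G[of j "cos x"] DERIV_cos[of x]] that by (simp add: k_def mult.commute)
  have add: "I (\<lambda>x. f x + g x) = I f + I g" if "continuous_on UNIV f" "continuous_on UNIV g" for f g
    unfolding I_def by (intro integral_add continuous_integrable that)
  have diff: "I (\<lambda>x. f x - g x) = I f - I g" if "continuous_on UNIV f" "continuous_on UNIV g" for f g
    unfolding I_def by (intro integral_diff continuous_integrable that)
  have cmult: "I (\<lambda>x. c * f x) = c * I f" for f c
    unfolding I_def by simp
  have ibp1: "(2 * k + 1) * I1 = Z"
  proof -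
    have "I (\<lambda>x. (2 * k + 1) * (sin x ^ (2 * k) * cos x * G k (cos x)) - sin x ^ (2 * Suc k) * G (Suc k) (cos x)) = 0"
      unfolding I_def
    proof (rule integral_periodic_derivative_eq_0)
      show "((\<lambda>x. sin x ^ (2 * k + 1) * G k (cos x)) has_real_derivative
        (2 * k + 1) * (sin x ^ (2 * k) * cos x * G k (cos x)) - sin x ^ (2 * Suc k) * G (Suc k) (cos x)) (at x)" for x
        by (rule derivative_eq_intros der refl order_refl)+ (simp add: algebra_simps)
    qed simp
    then show ?thesis unfolding I1_def Z_def
      by (subst (asm) diff) (auto intro!: continuous_intros simp: cmult simp del: power_Suc)
  qed
  \<comment> \<open>Comes from the periodic function sin^(2 n + 1) cos G n (cos). It eliminates
    \<open>A\<close> and \<open>B\<close>, which the recurrence produces, in favour of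
    \<open>I1\<close>; \<open>ibp1\<close> then links \<open>I1\<close> to the target
    \<open>Z\<close>.\<close>
  have ibp2: "(2 * k - 1) * A - 2 * k * B = I1"
  proof -
    have "I (\<lambda>x. (2 * real k - 1) * (sin x ^ (2 * n) * G n (cos x)) - 2 * k * (sin x ^ (2 * k) * G n (cos x)) - sin x ^ (2 * k) * cos x * G k (cos x)) = 0"
      unfolding I_def
    proof (rule integral_periodic_derivative_eq_0)
      fix x :: real
      have c2: "cos x * cos x = 1 - sin x * sin x" using sin_cos_squared_add[of x] by (simp add: power2_eq_square)
      have "((\<lambda>x. sin x ^ (2 * n + 1) * cos x * G n (cos x)) has_real_derivative
        ((2 * n + 1) * (sin x ^ (2 * n)) * (cos x * cos x) - sin x ^ (2 * n + 1) * sin x) * G n (cos x) - sin x ^ (2 * n + 2) * cos x * G k (cos x)) (at x)"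
        by (rule derivative_eq_intros der refl order_refl | simp add: k_def algebra_simps)+
      also have "((2 * n + 1) * (sin x ^ (2 * n)) * (cos x * cos x) - sin x ^ (2 * n + 1) * sin x) * G n (cos x) - sin x ^ (2 * n + 2) * cos x * G k (cos x)
        = (2 * real k - 1) * (sin x ^ (2 * n) * G n (cos x)) - 2 * k * (sin x ^ (2 * k) * G n (cos x)) - sin x ^ (2 * k) * cos x * G k (cos x)"
        unfolding c2 by (simp add: k_def algebra_simps)
      finally show "((\<lambda>x. sin x ^ (2 * n + 1) * cos x * G n (cos x)) has_real_derivative
        (2 * real k - 1) * (sin x ^ (2 * n) * G n (cos x)) - 2 * k * (sin x ^ (2 * k) * G n (cos x)) - sin x ^ (2 * k) * cos x * G k (cos x)) (at x)" .
    qed simp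
    then have "(2 * real k - 1) * A - 2 * k * B - I1 = 0"
      unfolding A_def B_def I1_def
      by (subst (asm) diff, (intro continuous_intros; simp add: k_def)+, subst (asm) diff, (intro continuous_intros; simp add: k_def)+, simp add: cmult mult.assoc)
    then show ?thesis by (simp add: k_def)
  qed
  \<comment> \<open>By Leibniz' rule these are the successive derivatives of x G 0 x; the truncated
    \<open>j - 1\<close> at j = 0 is multiplied by 0. The factor x absorbs the cos \<phi> of the
    recurrence, so the induction hypothesis for \<open>k\<close> applies to
    \<open>T\<close>.\<close>
  define T where "T j x = x * G j x + j * G (j - 1) x" for j x
  have T: "I (\<lambda>\<phi>. cos (k * \<phi>) * T 0 (cos \<phi>)) = chebyshev_const k * I (\<lambda>\<phi>. sin \<phi> ^ (2*k) * T k (cos \<phi>))"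
    unfolding I_def k_def
  proof (rule ge2(2))
    show "(T j has_real_derivative T (Suc j) x) (at x)" if "j < Suc n" for j x
    proof (cases j)
      case 0
      show ?thesis unfolding T_def[abs_def] 0
        by (rule derivative_eq_intros G refl | simp)+
    next
      case (Suc i)
      show ?thesis unfolding T_def[abs_def] Suc
        by (rule derivative_eq_intros G refl | use that Suc in \<open>simp add: algebra_simps\<close>)+
    qed
    show "continuous_on UNIV (T (Suc n))"
      unfolding T_def[abs_def] by (intro continuous_intros cG) (auto simp: k_def)
  qed
  have lower: "I (\<lambda>\<phi>. cos (n * \<phi>) * G 0 (cos \<phi>)) = chebyshev_const n * A"
    unfolding I_def A_def by (rule ge2(1)) (use G cG in \<open>auto simp: k_def\<close>)
  have split: "cos (Suc k * \<phi>) * G 0 (cos \<phi>) = 2 * (cos (k * \<phi>) * T 0 (cos \<phi>)) - cos (n * \<phi>) * G 0 (cos \<phi>)" for \<phi> :: real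
  proof -
    have "cos (Suc k * \<phi>) + cos (n * \<phi>) = 2 * cos \<phi> * cos (k * \<phi>)"
    proof -
      have "Suc k * \<phi> = k * \<phi> + \<phi>" "n * \<phi> = k * \<phi> - \<phi>" by (simp_all add: k_def algebra_simps)
      then show ?thesis by (simp add: cos_add cos_diff)
    qed
    then have "cos (Suc k * \<phi>) = 2 * cos \<phi> * cos (k * \<phi>) - cos (n * \<phi>)" by linarith
    then have "cos (Suc k * \<phi>) * G 0 (cos \<phi>) = (2 * cos \<phi> * cos (k * \<phi>) - cos (n * \<phi>)) * G 0 (cos \<phi>)"
      by (rule arg_cong)
    then show ?thesis unfolding T_def left_diff_distrib by (simp add: mult_ac)
  qed
  have "I (\<lambda>\<phi>. cos (Suc k * \<phi>) * G 0 (cos \<phi>)) = 2 * I (\<lambda>\<phi>. cos (k * \<phi>) * T 0 (cos \<phi>)) - chebyshev_const n * A"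
    unfolding split lower[symmetric] T_def
    by (subst diff) (auto intro!: continuous_intros simp: cmult)
  also have "I (\<lambda>\<phi>. cos (k * \<phi>) * T 0 (cos \<phi>)) = chebyshev_const k * (I1 + k * B)"
  proof -
    have "I (\<lambda>\<phi>. sin \<phi> ^ (2*k) * T k (cos \<phi>)) = I (\<lambda>\<phi>. sin \<phi> ^ (2*k) * cos \<phi> * G k (cos \<phi>) + k * (sin \<phi> ^ (2*k) * G n (cos \<phi>)))"
      by (intro arg_cong[where f=I] ext) (simp add: T_def k_def algebra_simps)
    also have "\<dots> = I1 + k * B"
      unfolding I1_def B_def by (subst add) (auto intro!: continuous_intros simp: cmult k_def)
    finally show ?thesis using T by simp
  qed
  also have "chebyshev_const n = (2 * k - 1) * chebyshev_const k"
    by (simp add: k_def chebyshev_const_Suc)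
  \<comment> \<open>\<open>A\<close> and \<open>B\<close> occur exactly in the combination that
    \<open>ibp2\<close> evaluates to \<open>I1\<close>.\<close>
  also have "2 * (chebyshev_const k * (I1 + k * B)) - (2 * k - 1) * chebyshev_const k * A = chebyshev_const k * (2 * I1 - ((2 * k - 1) * A - 2 * k * B))"
    by (simp add: algebra_simps)
  also have "\<dots> = chebyshev_const k * I1" unfolding ibp2 by simp
  also have "\<dots> = chebyshev_const (Suc k) * Z"
    unfolding ibp1[symmetric] by (simp add: chebyshev_const_Suc)
  finally show ?case unfolding I_def Z_def k_def .
qed

text \<open>Trigonometric functions are eigenfunctions of convolution with an even kernel: after a
  shift by \<theta> and the addition formula, the part with sin (m x) is odd and integrates to
  0.\<close>

lemma angular_integral_shift:
  fixes \<Phi> :: "real \<Rightarrow> real" and m :: nat and \<theta> :: real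
  assumes \<Phi>: "continuous_on UNIV \<Phi>"
  shows "integral {0..2*pi} (\<lambda>\<phi>. sin (m * \<phi>) * \<Phi> (cos (\<phi> - \<theta>))) = sin (m * \<theta>) * integral {0..2*pi} (\<lambda>\<phi>. cos (m * \<phi>) * \<Phi> (cos \<phi>))"
    and "integral {0..2*pi} (\<lambda>\<phi>. cos (m * \<phi>) * \<Phi> (cos (\<phi> - \<theta>))) = cos (m * \<theta>) * integral {0..2*pi} (\<lambda>\<phi>. cos (m * \<phi>) * \<Phi> (cos \<phi>))"
proof -
  have c [continuous_intros]: "continuous_on UNIV (\<lambda>x. \<Phi> (cos (f x)))" if "continuous_on UNIV f" for f :: "real \<Rightarrow> real"
    by (rule continuous_on_compose2[OF \<Phi>]) (auto intro!: continuous_intros that)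
  have per: "sin (m * (x + 2 * pi)) = sin (m * x)" "cos (m * (x + 2 * pi)) = cos (m * x)" for x :: real
  proof -
    have "m * (x + 2 * pi) = m * x + 2 * real m * pi" by (simp add: algebra_simps)
    then show "sin (m * (x + 2 * pi)) = sin (m * x)" "cos (m * (x + 2 * pi)) = cos (m * x)"
      by (simp_all add: sin_add cos_add sin_2npi cos_2npi)
  qed
  define C where "C = integral {0..2*pi} (\<lambda>\<phi>. cos (m * \<phi>) * \<Phi> (cos \<phi>))"
  define S where "S = integral {0..2*pi} (\<lambda>\<phi>. sin (m * \<phi>) * \<Phi> (cos \<phi>))"
  have "S = 0" unfolding S_def
    by (rule integral_periodic_odd) (auto intro!: continuous_intros simp: per)
  have lin: "integral {0..2*pi} (\<lambda>x. a * (sin (m * x) * \<Phi> (cos x)) + b * (cos (m * x) * \<Phi> (cos x))) = b * C" for a b :: real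
  proof -
    have "integral {0..2*pi} (\<lambda>x. a * (sin (m * x) * \<Phi> (cos x)) + b * (cos (m * x) * \<Phi> (cos x))) = a * S + b * C"
      unfolding S_def C_def
      by (subst integral_add) (auto intro!: continuous_integrable continuous_intros)
    then show ?thesis by (simp add: \<open>S = 0\<close>)
  qed
  have "integral {0..2*pi} (\<lambda>\<phi>. sin (m * \<phi>) * \<Phi> (cos (\<phi> - \<theta>)))
      = integral {0..2*pi} (\<lambda>x. sin (m * (x + \<theta>)) * \<Phi> (cos (x + \<theta> - \<theta>)))"
    by (rule integral_periodic_shift[symmetric]) (intro continuous_intros, simp add: per cos_diff)
  also have "\<dots> = integral {0..2*pi} (\<lambda>x. cos (m * \<theta>) * (sin (m * x) * \<Phi> (cos x)) + sin (m * \<theta>) * (cos (m * x) * \<Phi> (cos x)))"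
    by (intro arg_cong[where f="integral _"] ext) (simp add: distrib_left sin_add algebra_simps)
  finally show "integral {0..2*pi} (\<lambda>\<phi>. sin (m * \<phi>) * \<Phi> (cos (\<phi> - \<theta>))) = sin (m * \<theta>) * integral {0..2*pi} (\<lambda>\<phi>. cos (m * \<phi>) * \<Phi> (cos \<phi>))"
    unfolding lin C_def .
  have "integral {0..2*pi} (\<lambda>\<phi>. cos (m * \<phi>) * \<Phi> (cos (\<phi> - \<theta>)))
      = integral {0..2*pi} (\<lambda>x. cos (m * (x + \<theta>)) * \<Phi> (cos (x + \<theta> - \<theta>)))"
    by (rule integral_periodic_shift[symmetric]) (intro continuous_intros, simp add: per cos_diff)
  also have "\<dots> = integral {0..2*pi} (\<lambda>x. (- sin (m * \<theta>)) * (sin (m * x) * \<Phi> (cos x)) + cos (m * \<theta>) * (cos (m * x) * \<Phi> (cos x)))"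
    by (intro arg_cong[where f="integral _"] ext) (simp add: distrib_left cos_add algebra_simps)
  finally show "integral {0..2*pi} (\<lambda>\<phi>. cos (m * \<phi>) * \<Phi> (cos (\<phi> - \<theta>))) = cos (m * \<theta>) * integral {0..2*pi} (\<lambda>\<phi>. cos (m * \<phi>) * \<Phi> (cos \<phi>))"
    unfolding lin C_def .
qed

section \<open>The profile that generates the logarithm\<close>

text \<open>The linear ODE is solved with the integrating factor w = (t^2 + E)^(k + 1/2), for which
  w N has derivative t^2 w / (t^2 + E). The initial value N 0 = 0 yields \<bar>N t\<bar> \<le>
  \<bar>t\<bar>, which in turn bounds g.\<close>

lemma log_kernel_exists:
  fixes E :: real and k :: nat
  assumes E: "E > 0"
  obtains N g :: "real \<Rightarrow> real" where
    "\<And>t::real. (N has_real_derivative t * g t) (at t)"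
    "\<And>t::real. (t\<^sup>2 + E) * (t * g t) + (2 * k + 1) * (t * N t) = t\<^sup>2"
    "\<And>t::real. \<bar>g t\<bar> \<le> (2 * k + 2) * \<bar>t\<bar> / (t\<^sup>2 + E)"
    "continuous_on UNIV g"
proof -
  have pos: "t\<^sup>2 + E > 0" for t :: real using E by (simp add: add_nonneg_pos)
  define w where "w t = (t\<^sup>2 + E) powr (k + 1/2)" for t :: real
  have w0: "w t > 0" for t :: real using pos[of t] by (simp add: w_def)
  have w: "(w has_real_derivative (2 * k + 1) * t * w t / (t\<^sup>2 + E)) (at t)" for t :: real
  proof -
    have "(w has_real_derivative (k + 1/2) * (t\<^sup>2 + E) powr (k + 1/2 - 1) * (2 * t)) (at t)"
      unfolding w_def[abs_def]
      using pos[of t] by (auto intro!: derivative_eq_intros)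
    also have "(t\<^sup>2 + E) powr (k + 1/2 - 1) = w t / (t\<^sup>2 + E)"
      using pos[of t] unfolding w_def by (subst powr_diff) simp
    also have "(k + 1/2) * (w t / (t\<^sup>2 + E)) * (2 * t) = (2 * k + 1) * t * w t / (t\<^sup>2 + E)"
    proof -
      have "(c + 1/2) * (y / p) * (2 * s) = (2 * c + 1) * s * y / p" for c y p s :: real
        by (cases "p = 0") (auto simp: field_simps)
      then show ?thesis by simp
    qed
    finally show ?thesis .
  qed
  have cw: "continuous_on UNIV w" using w by (intro DERIV_continuous_on) (auto intro: DERIV_subset)
  have "continuous_on UNIV (\<lambda>t. t\<^sup>2 * w t / (t\<^sup>2 + E))"
    using pos by (intro continuous_intros cw) (metis less_irrefl)
  then obtain B where B: "\<And>t::real. (B has_real_derivative t\<^sup>2 * w t / (t\<^sup>2 + E)) (at t)" "B 0 = 0"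
    using antiderivative_exists[of _ 0] by blast
  define N where "N t = B t / w t" for t :: real
  \<comment> \<open>N' / t read off from the ODE, so that no division by t occurs and g is
    continuous at 0.\<close>
  define g where "g t = (t - (2 * k + 1) * N t) / (t\<^sup>2 + E)" for t :: real
  have dN: "(N has_real_derivative t * g t) (at t)" for t :: real
  proof -
    have "(N has_real_derivative (t\<^sup>2 * w t / (t\<^sup>2 + E) * w t - B t * ((2 * k + 1) * t * w t / (t\<^sup>2 + E))) / (w t * w t)) (at t)"
      unfolding N_def[abs_def] using w0[of t] by (intro DERIV_divide B w) auto
    also have "(t\<^sup>2 * w t / (t\<^sup>2 + E) * w t - B t * ((2 * k + 1) * t * w t / (t\<^sup>2 + E))) / (w t * w t) = t * g t"
    proof -
      have "(x\<^sup>2 * y / p * y - b * (c * x * y / p)) / (y * y) = x * ((x - c * (b / y)) / p)"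
        if "y > 0" "p > 0" for x y p b c :: real
        using that by (simp add: field_simps power2_eq_square)
      from this[OF w0 pos] show ?thesis unfolding g_def N_def by blast
    qed
    finally show ?thesis .
  qed
  have cN: "continuous_on UNIV N" using dN by (intro DERIV_continuous_on) (auto intro: DERIV_subset)
  have ode: "(t\<^sup>2 + E) * (t * g t) + (2 * k + 1) * (t * N t) = t\<^sup>2" for t :: real
    using pos[of t] by (simp add: g_def field_simps power2_eq_square)
  have Bbound: "\<bar>B t\<bar> \<le> \<bar>t\<bar> * w t" for t :: real
  proof -
    \<comment> \<open>Both B and t w - B are nondecreasing and vanish at 0, so B lies between 0 and
      t w on either side of 0.\<close>
    define D where "D t = t * w t - B t" for t :: real
    have D: "(D has_real_derivative (w t + t * ((2 * k + 1) * t * w t / (t\<^sup>2 + E)) - t\<^sup>2 * w t / (t\<^sup>2 + E))) (at t)" for t :: real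
      unfolding D_def[abs_def] by (rule derivative_eq_intros w B refl | simp)+
    have D': "0 \<le> w t + t * ((2 * k + 1) * t * w t / (t\<^sup>2 + E)) - t\<^sup>2 * w t / (t\<^sup>2 + E)" for t :: real
    proof -
      have "w t + t * ((2 * k + 1) * t * w t / (t\<^sup>2 + E)) - t\<^sup>2 * w t / (t\<^sup>2 + E) = w t + 2 * k * (t\<^sup>2 * w t / (t\<^sup>2 + E))"
        by (simp add: power2_eq_square algebra_simps add_divide_distrib)
      moreover have "0 \<le> t\<^sup>2 * w t / (t\<^sup>2 + E)" using pos[of t] w0[of t] by simp
      then have "0 \<le> w t + 2 * k * (t\<^sup>2 * w t / (t\<^sup>2 + E))"
        using w0[of t] by (intro add_nonneg_nonneg mult_nonneg_nonneg) (auto simp: less_imp_le)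
      ultimately show ?thesis by (simp only:)
    qed
    have B': "0 \<le> t\<^sup>2 * w t / (t\<^sup>2 + E)" for t :: real using pos[of t] w0[of t] by simp
    have monoD: "D x \<le> D y" and monoB: "B x \<le> B y" if "x \<le> y" for x y
      using DERIV_nonneg_imp_nondecreasing[OF that] D D' B(1) B' by blast+
    have "D 0 = 0" by (simp add: D_def B)
    then show ?thesis
      using monoD[of 0 t] monoB[of 0 t] monoD[of t 0] monoB[of t 0] B(2)
      by (cases "t \<ge> 0") (auto simp: D_def)
  qed
  have Nb: "\<bar>N t\<bar> \<le> \<bar>t\<bar>" for t :: real
    using Bbound[of t] w0[of t] by (simp add: N_def field_simps)
  have gb: "\<bar>g t\<bar> \<le> (2 * k + 2) * \<bar>t\<bar> / (t\<^sup>2 + E)" for t :: real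
  proof -
    have "\<bar>t - (2 * k + 1) * N t\<bar> \<le> \<bar>t\<bar> + \<bar>(2 * k + 1) * N t\<bar>" by (rule abs_triangle_ineq4)
    also have "\<bar>(2 * k + 1) * N t\<bar> = (2 * k + 1) * \<bar>N t\<bar>" by (simp add: abs_mult)
    also have "\<bar>t\<bar> + (2 * k + 1) * \<bar>N t\<bar> \<le> \<bar>t\<bar> + (2 * k + 1) * \<bar>t\<bar>" by (intro add_left_mono mult_left_mono Nb) auto
    also have "\<dots> = (2 * k + 2) * \<bar>t\<bar>" by (simp add: algebra_simps)
    finally show ?thesis using pos[of t] by (simp add: g_def abs_divide divide_right_mono)
  qed
  have "continuous_on UNIV g"
    unfolding g_def[abs_def] using pos by (intro continuous_intros cN) (metis less_irrefl)
  from that[OF dN ode gb this] show thesis .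
qed

definition sin_moment :: "nat \<Rightarrow> real" where
  "sin_moment k = integral {0..2*pi} (\<lambda>\<phi>. sin \<phi> ^ (2 * k))"
definition sin_cos_moment :: "nat \<Rightarrow> real" where
  "sin_cos_moment k = integral {0..2*pi} (\<lambda>\<phi>. sin \<phi> ^ (2 * k) * (cos \<phi>)\<^sup>2)"

text \<open>Integration by parts against the ODE for \<open>N\<close> turns the derivative of the angular integral into \<open>r / (r\<^sup>2 + E)\<close>.\<close>

lemma angular_integral_log_kernel:
  fixes E :: real and k :: nat and N g \<psi> :: "real \<Rightarrow> real"
  assumes E: "E > 0"
    and N: "\<And>t::real. (N has_real_derivative t * g t) (at t)"
    and ode: "\<And>t::real. (t\<^sup>2 + E) * (t * g t) + (2 * k + 1) * (t * N t) = t\<^sup>2"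
    and g: "continuous_on UNIV g" "g 0 = 0"
    and \<psi>: "\<And>t::real. (\<psi> has_real_derivative g t) (at t)"
  shows "integral {0..2*pi} (\<lambda>\<phi>. sin \<phi> ^ (2 * k) * \<psi> (r * cos \<phi>))
       = sin_moment k * \<psi> 0 + sin_cos_moment k / 2 * (ln (r\<^sup>2 + E) - ln E)"
proof -
  define Q where "Q r = integral {0..2*pi} (\<lambda>\<phi>. sin \<phi> ^ (2 * k) * \<psi> (r * cos \<phi>))" for r
  define Q' where "Q' r = integral {0..2*pi} (\<lambda>\<phi>. sin \<phi> ^ (2 * k) * (cos \<phi> * g (r * cos \<phi>)))" for r
  have cN: "continuous_on UNIV N" using N by (intro DERIV_continuous_on) (auto intro: DERIV_subset)
  have c\<psi>: "continuous_on UNIV \<psi>" using \<psi> by (intro DERIV_continuous_on) (auto intro: DERIV_subset)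
  have c [continuous_intros]: "continuous_on UNIV (\<lambda>x. h (r * cos x))" if "continuous_on UNIV h" for h :: "real \<Rightarrow> real" and r
    by (rule continuous_on_compose2[OF that]) (auto intro!: continuous_intros)
  have dQ: "(Q has_real_derivative Q' r) (at r)" for r :: real
    unfolding Q_def[abs_def] Q'_def cbox_interval[symmetric]
  proof (rule leibniz_rule_field_derivative[where U=UNIV and fx="\<lambda>r \<phi>. sin \<phi> ^ (2 * k) * (cos \<phi> * g (r * cos \<phi>))"])
    show "((\<lambda>r. sin t ^ (2 * k) * \<psi> (r * cos t)) has_real_derivative sin t ^ (2 * k) * (cos t * g (x * cos t))) (at x)" for x t
      by (rule derivative_eq_intros DERIV_chain2[OF \<psi>] refl | simp)+
    show "(\<lambda>\<phi>. sin \<phi> ^ (2 * k) * \<psi> (x * cos \<phi>)) integrable_on cbox 0 (2 * pi)" for x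
      unfolding cbox_interval by (intro continuous_integrable continuous_intros c\<psi>)
    show "continuous_on (UNIV \<times> cbox 0 (2*pi)) (\<lambda>(x, t). sin t ^ (2 * k) * (cos t * g (x * cos t)))"
      unfolding case_prod_beta 
      by (intro continuous_intros continuous_on_compose2[OF g(1), where f="\<lambda>z. fst z * cos (snd z)"]) auto
  qed auto
  have eq: "(r\<^sup>2 + E) * Q' r = sin_cos_moment k * r" for r :: real
  \<comment> \<open>At r = 0 the claim follows from g 0 = 0. Otherwise it is multiplied by r, so
    that r cos \<phi> g (r cos \<phi>) becomes T g (T), the form in which the ODE applies.\<close>
  proof (cases "r = 0")
    case True
    then show ?thesis by (simp add: Q'_def g)
  next
    case False
    define I where "I h = integral {0..2*pi} h" for h :: "real \<Rightarrow> real"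
    have add: "I (\<lambda>x. f x + g x) = I f + I g" if "continuous_on UNIV f" "continuous_on UNIV g" for f g
      unfolding I_def by (intro integral_add continuous_integrable that)
    have diff: "I (\<lambda>x. f x - g x) = I f - I g" if "continuous_on UNIV f" "continuous_on UNIV g" for f g
      unfolding I_def by (intro integral_diff continuous_integrable that)
    have cmult: "I (\<lambda>x. c * f x) = c * I f" for f c
      unfolding I_def by simp
    define T where "T x = r * cos x" for x
    have cT [continuous_intros]: "continuous_on UNIV T" unfolding T_def by (intro continuous_intros)
    have cT' [continuous_intros]: "continuous_on UNIV (\<lambda>x. g (T x))" "continuous_on UNIV (\<lambda>x. N (T x))"
      unfolding T_def by (intro continuous_intros g cN)+
    have "I (\<lambda>x. (2 * k + 1) * (sin x ^ (2 * k) * (T x * N (T x))) - r\<^sup>2 * (sin x ^ (2 * k) * ((sin x)\<^sup>2 * (T x * g (T x))))) = 0"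
      unfolding I_def
    proof (rule integral_periodic_derivative_eq_0)
      show "((\<lambda>x. r * (sin x ^ (2 * k + 1) * N (r * cos x))) has_real_derivative
        (2 * k + 1) * (sin x ^ (2 * k) * (T x * N (T x))) - r\<^sup>2 * (sin x ^ (2 * k) * ((sin x)\<^sup>2 * (T x * g (T x))))) (at x)" for x
        unfolding T_def
        by (rule derivative_eq_intros DERIV_chain2[OF N] refl)+ (simp add: algebra_simps power2_eq_square)
    qed simp
    then have ibp: "(2 * k + 1) * I (\<lambda>x. sin x ^ (2 * k) * (T x * N (T x))) = r\<^sup>2 * I (\<lambda>x. sin x ^ (2 * k) * ((sin x)\<^sup>2 * (T x * g (T x))))"
      by (subst (asm) diff) (auto intro!: continuous_intros simp: cmult)
    have "r * ((r\<^sup>2 + E) * Q' r) = I (\<lambda>x. (r\<^sup>2 + E) * (sin x ^ (2 * k) * (T x * g (T x))))"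
      unfolding Q'_def I_def[symmetric] cmult[symmetric] T_def
      by (intro arg_cong[where f=I] ext) (simp add: algebra_simps)
    also have "\<dots> = I (\<lambda>x. r\<^sup>2 * (sin x ^ (2 * k) * ((sin x)\<^sup>2 * (T x * g (T x)))) + (r\<^sup>2 * (sin x ^ (2 * k) * (cos x)\<^sup>2) - (2 * k + 1) * (sin x ^ (2 * k) * (T x * N (T x)))))"
    proof (intro arg_cong[where f=I] ext)
      fix x
      have "(r\<^sup>2 + E) * (T x * g (T x)) = r\<^sup>2 * (sin x)\<^sup>2 * (T x * g (T x)) + ((T x)\<^sup>2 + E) * (T x * g (T x))"
      proof -
        have "r\<^sup>2 = r\<^sup>2 * ((sin x)\<^sup>2 + (cos x)\<^sup>2)" by simp
        also have "\<dots> = r\<^sup>2 * (sin x)\<^sup>2 + (T x)\<^sup>2" unfolding T_def power_mult_distrib by (rule distrib_left)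
        finally have "r\<^sup>2 + E = r\<^sup>2 * (sin x)\<^sup>2 + ((T x)\<^sup>2 + E)" by simp
        then show ?thesis by (simp only: distrib_right)
      qed
      also have "((T x)\<^sup>2 + E) * (T x * g (T x)) = r\<^sup>2 * (cos x)\<^sup>2 - (2 * k + 1) * (T x * N (T x))"
        using ode[of "T x"] by (simp add: T_def power_mult_distrib)
      finally have *: "(r\<^sup>2 + E) * (T x * g (T x)) = r\<^sup>2 * (sin x)\<^sup>2 * (T x * g (T x)) + (r\<^sup>2 * (cos x)\<^sup>2 - (2 * k + 1) * (T x * N (T x)))" .
      have "(r\<^sup>2 + E) * (sin x ^ (2 * k) * (T x * g (T x))) = sin x ^ (2 * k) * ((r\<^sup>2 + E) * (T x * g (T x)))"
        by (rule mult.left_commute)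
      also have "\<dots> = r\<^sup>2 * (sin x ^ (2 * k) * ((sin x)\<^sup>2 * (T x * g (T x)))) + (r\<^sup>2 * (sin x ^ (2 * k) * (cos x)\<^sup>2) - (2 * k + 1) * (sin x ^ (2 * k) * (T x * N (T x))))"
        unfolding * distrib_left right_diff_distrib by (simp only: mult_ac)
      finally show "(r\<^sup>2 + E) * (sin x ^ (2 * k) * (T x * g (T x))) = r\<^sup>2 * (sin x ^ (2 * k) * ((sin x)\<^sup>2 * (T x * g (T x)))) + (r\<^sup>2 * (sin x ^ (2 * k) * (cos x)\<^sup>2) - (2 * k + 1) * (sin x ^ (2 * k) * (T x * N (T x))))" .
    qed
    also have "\<dots> = r\<^sup>2 * I (\<lambda>x. sin x ^ (2 * k) * ((sin x)\<^sup>2 * (T x * g (T x)))) + (r\<^sup>2 * I (\<lambda>x. sin x ^ (2 * k) * (cos x)\<^sup>2) - (2 * k + 1) * I (\<lambda>x. sin x ^ (2 * k) * (T x * N (T x))))"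
      by (subst add, (intro continuous_intros)+, subst diff, (intro continuous_intros)+, simp only: cmult)
    also have "\<dots> = r * (sin_cos_moment k * r)"
      unfolding ibp by (simp add: sin_cos_moment_def I_def power2_eq_square)
    finally show ?thesis using False by simp
  qed
  have pos: "r\<^sup>2 + E > 0" for r :: real using E by (simp add: add_nonneg_pos)
  have "((\<lambda>r. Q r - sin_cos_moment k / 2 * ln (r\<^sup>2 + E)) has_real_derivative 0) (at r)" for r :: real
  proof -
    have "((\<lambda>r. sin_cos_moment k / 2 * ln (r\<^sup>2 + E)) has_real_derivative sin_cos_moment k * r / (r\<^sup>2 + E)) (at r)"
    proof -
      have "((\<lambda>r. ln (r\<^sup>2 + E)) has_real_derivative 2 * r / (r\<^sup>2 + E)) (at r)"
        using pos[of r] by (auto intro!: derivative_eq_intros)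
      from DERIV_cmult[OF this, of "sin_cos_moment k / 2"] show ?thesis by simp
    qed
    moreover have "Q' r = sin_cos_moment k * r / (r\<^sup>2 + E)"
      using eq[of r] pos[of r] by (simp add: field_simps)
    ultimately show ?thesis using DERIV_diff[OF dQ] by fastforce
  qed
  from DERIV_isconst_all[OF allI, OF this, of r 0]
  have "Q r = Q 0 + sin_cos_moment k / 2 * (ln (r\<^sup>2 + E) - ln E)" by (simp add: algebra_simps)
  moreover have "Q 0 = sin_moment k * \<psi> 0" by (simp add: Q_def sin_moment_def)
  ultimately show ?thesis by (simp add: Q_def)
qed

text \<open>The shift extracts sin (k \<theta>), and Rodrigues' formula for t \<mapsto> F 0 (r t)
  yields both r^k and the k-th derivative F k, a primitive of g. The base point \<open>a\<close> is
  left free: a = -R will suit Taylor's formula, at the price that F k 0 need not vanish.\<close>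

lemma log_representation:
  fixes E a :: real and k :: nat
  assumes E: "E > 0"
  obtains F :: "nat \<Rightarrow> real \<Rightarrow> real" where
    "\<And>j (t::real). j \<le> k \<Longrightarrow> (F j has_real_derivative F (Suc j) t) (at t)" "\<And>j. j \<le> k \<Longrightarrow> F j a = 0"
    "continuous_on UNIV (F (Suc k))"
    "\<And>t::real. \<bar>F (Suc k) t\<bar> \<le> (2 * k + 2) * \<bar>t\<bar> / (t\<^sup>2 + E)"
    "\<And>r \<theta> :: real. integral {0..2*pi} (\<lambda>\<phi>. sin (k * \<phi>) * F 0 (r * cos (\<phi> - \<theta>)))
       = chebyshev_const k * (r ^ k * sin (k * \<theta>)) * (sin_moment k * F k 0 + sin_cos_moment k / 2 * (ln (r\<^sup>2 + E) - ln E))"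
proof -
  obtain N g :: "real \<Rightarrow> real" where N: "\<And>t::real. (N has_real_derivative t * g t) (at t)"
    and ode: "\<And>t::real. (t\<^sup>2 + E) * (t * g t) + (2 * k + 1) * (t * N t) = t\<^sup>2"
    and gb: "\<And>t::real. \<bar>g t\<bar> \<le> (2 * k + 2) * \<bar>t\<bar> / (t\<^sup>2 + E)"
    and g: "continuous_on UNIV g"
    by (rule log_kernel_exists[OF E, of k]) blast
  have g0: "g 0 = 0" using gb[of 0] by simp
  obtain F where F: "F (Suc k) = g" "\<And>j. j \<le> k \<Longrightarrow> F j a = 0"
    "\<And>j x. j \<le> k \<Longrightarrow> (F j has_real_derivative F (Suc j) x) (at x)"
    using antiderivative_chain_exists[OF g, of "Suc k" a] by (auto simp: less_Suc_eq_le)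
  have cF: "continuous_on UNIV (F j)" if "j \<le> k" for j
    using F(3)[OF that] by (intro DERIV_continuous_on) (auto intro: DERIV_subset)
  show thesis
  proof (rule that)
    fix r \<theta> :: real
    have "integral {0..2*pi} (\<lambda>\<phi>. sin (k * \<phi>) * F 0 (r * cos (\<phi> - \<theta>))) = sin (k * \<theta>) * integral {0..2*pi} (\<lambda>\<phi>. cos (k * \<phi>) * F 0 (r * cos \<phi>))"
      by (rule angular_integral_shift(1)[where \<Phi>="\<lambda>t. F 0 (r * t)"])
         (auto intro!: continuous_on_compose2[OF cF] continuous_intros)
    also have "integral {0..2*pi} (\<lambda>\<phi>. cos (k * \<phi>) * F 0 (r * cos \<phi>))
      = chebyshev_const k * integral {0..2*pi} (\<lambda>\<phi>. sin \<phi> ^ (2*k) * (r ^ k * F k (r * cos \<phi>)))"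
    proof -
      define G where "G j t = r ^ j * F j (r * t)" for j t
      have "(G j has_real_derivative G (Suc j) x) (at x)" if "j < k" for j x
        unfolding G_def[abs_def] 
        by (rule derivative_eq_intros DERIV_chain2[OF F(3)] refl | use that in simp)+
      moreover have "continuous_on UNIV (G k)"
        unfolding G_def[abs_def] by (auto intro!: continuous_on_compose2[OF cF] continuous_intros)
      ultimately show ?thesis using rodrigues_integral[of k G] by (simp add: G_def)
    qed
    also have "integral {0..2*pi} (\<lambda>\<phi>. sin \<phi> ^ (2*k) * (r ^ k * F k (r * cos \<phi>))) = r ^ k * integral {0..2*pi} (\<lambda>\<phi>. sin \<phi> ^ (2*k) * F k (r * cos \<phi>))"
      by (subst integral_mult_right[symmetric]) (simp only: mult_ac)
    also have "integral {0..2*pi} (\<lambda>\<phi>. sin \<phi> ^ (2*k) * F k (r * cos \<phi>)) = sin_moment k * F k 0 + sin_cos_moment k / 2 * (ln (r\<^sup>2 + E) - ln E)"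
      by (rule angular_integral_log_kernel[OF E N ode g g0]) (use F in auto)
    finally show "integral {0..2*pi} (\<lambda>\<phi>. sin (k * \<phi>) * F 0 (r * cos (\<phi> - \<theta>)))
       = chebyshev_const k * (r ^ k * sin (k * \<theta>)) * (sin_moment k * F k 0 + sin_cos_moment k / 2 * (ln (r\<^sup>2 + E) - ln E))"
      by (simp add: mult_ac)
  qed (use F g gb in auto)
qed

lemma integral_pos_continuous:
  fixes f :: "real \<Rightarrow> real"
  assumes "continuous_on UNIV f" "\<And>x. f x \<ge> 0" "a < c" "c < b" "f c > 0"
  shows "integral {a..b} f > 0"
proof -
  have "integral {a..b} f \<noteq> 0"
  proof
    assume "integral {a..b} f = 0"
    moreover have "(f has_integral integral {a..b} f) {a..b}"
      by (intro integrable_integral continuous_integrable assms)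
    ultimately have "(f has_integral 0) (cbox a b)" by simp
    then have "f c = 0"
      using assms by (intro has_integral_0_cbox_imp_0[of a b f]) (auto intro: continuous_on_subset)
    then show False using assms by simp
  qed
  moreover have "integral {a..b} f \<ge> 0"
    using assms(2) by (intro integral_nonneg continuous_integrable assms(1)) auto
  ultimately show ?thesis by simp
qed

lemma sin_cos_moment_pos: "sin_cos_moment k > 0"
  unfolding sin_cos_moment_def
  by (rule integral_pos_continuous[where c = "pi/4"]) (auto intro!: continuous_intros zero_le_even_power mult_nonneg_nonneg simp: sin_45 cos_45)

lemma sin_moment_pos: "sin_moment k > 0"
  unfolding sin_moment_def
  by (rule integral_pos_continuous[where c = "pi/2"]) (auto intro!: continuous_intros zero_le_even_power)

text \<open>Taylor's formula with integral remainder at \<open>a\<close>, where the Taylor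
  polynomial is 0: F 0 is a superposition of neurons with bias -s and density F (k+1). For s > t the
  integrand vanishes because k > 0, so the interval of integration does not depend on t.\<close>

lemma ridge_representation:
  fixes F :: "nat \<Rightarrow> real \<Rightarrow> real"
  assumes F: "\<And>j t. j \<le> k \<Longrightarrow> (F j has_real_derivative F (Suc j) t) (at t)" "\<And>j. j \<le> k \<Longrightarrow> F j a = 0"
    and c: "continuous_on UNIV (F (Suc k))" and k: "k > 0" and t: "a \<le> t" "t \<le> b"
  shows "set_integrable lborel {a..b} (\<lambda>s. F (Suc k) s * max (t - s) 0 ^ k)"
    and "(LINT s:{a..b}|lborel. F (Suc k) s * max (t - s) 0 ^ k) = fact k * F 0 t"
proof -
  have cont: "continuous_on {a..b} (\<lambda>s. F (Suc k) s * max (t - s) 0 ^ k)"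
    by (intro continuous_intros continuous_on_subset[OF c]) auto
  show int: "set_integrable lborel {a..b} (\<lambda>s. F (Suc k) s * max (t - s) 0 ^ k)"
    by (rule borel_integrable_atLeastAtMost'[OF cont])
  have "((\<lambda>s. ((t - s) ^ (Suc k - 1) / fact (Suc k - 1)) *\<^sub>R F (Suc k) s) has_integral F 0 t - (\<Sum>i<Suc k. ((t - a) ^ i / fact i) *\<^sub>R F i a)) {a..t}"
    by (rule Taylor_has_integral)
       (use F t in \<open>auto simp: less_Suc_eq_le has_real_derivative_iff_has_vector_derivative[symmetric] intro: DERIV_subset\<close>)
  also have "(\<Sum>i<Suc k. ((t - a) ^ i / fact i) *\<^sub>R F i a) = 0"
    using F(2) by (intro sum.neutral) (auto simp: less_Suc_eq_le)
  finally have "((\<lambda>s. (t - s) ^ k / fact k * F (Suc k) s) has_integral F 0 t) {a..t}" by simp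
  from has_integral_mult_right[OF this, of "fact k"]
  have "((\<lambda>s. F (Suc k) s * (t - s) ^ k) has_integral fact k * F 0 t) {a..t}"
    by (simp add: field_simps)
  then have 1: "((\<lambda>s. F (Suc k) s * max (t - s) 0 ^ k) has_integral fact k * F 0 t) {a..t}"
    by (rule has_integral_eq[rotated]) (auto simp: max_def)
  have "((\<lambda>s. 0::real) has_integral 0) {t..b}" by simp
  then have 2: "((\<lambda>s. F (Suc k) s * max (t - s) 0 ^ k) has_integral 0) {t..b}"
    by (rule has_integral_eq[rotated]) (use k in \<open>auto simp: max_def\<close>)
  have "((\<lambda>s. F (Suc k) s * max (t - s) 0 ^ k) has_integral (fact k * F 0 t + 0)) {a..b}"
    by (rule has_integral_combine[OF t 1 2])
  then show "(LINT s:{a..b}|lborel. F (Suc k) s * max (t - s) 0 ^ k) = fact k * F 0 t"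
    unfolding set_borel_integral_eq_integral(2)[OF int] by (simp add: integral_unique)
qed

lemma set_integral_continuous:
  fixes f :: "real \<Rightarrow> real"
  assumes "continuous_on UNIV f"
  shows "set_integrable lborel {a..b} f" "(LINT x:{a..b}|lborel. f x) = integral {a..b} f"
proof -
  show 1: "set_integrable lborel {a..b} f"
    by (rule borel_integrable_atLeastAtMost'[OF continuous_on_subset[OF assms]]) simp
  show "(LINT x:{a..b}|lborel. f x) = integral {a..b} f"
    by (rule set_borel_integral_eq_integral(2)[OF 1])
qed

text \<open>Says that r^k h is a superposition of neurons of bias 0 with a bounded angular density.
  The restriction to the angles of the half disc matters: the integral is periodic in \<theta>,
  whereas \<theta> cos (k \<theta>) is not.\<close>

definition angular_rep :: "nat \<Rightarrow> (real \<Rightarrow> real) \<Rightarrow> bool" where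
  "angular_rep k h \<longleftrightarrow> (\<exists>D B. D \<in> borel_measurable borel \<and> (\<forall>\<phi>. \<bar>D \<phi>\<bar> \<le> B) \<and>
     (\<forall>\<theta>\<in>{0<..<pi}. (LINT \<phi>:{0..2*pi}|lborel. D \<phi> * max (cos (\<phi> - \<theta>)) 0 ^ k) = h \<theta>))"

lemma angular_repE:
  assumes "angular_rep k h"
  obtains D B where "D \<in> borel_measurable borel" "\<And>\<phi>. \<bar>D \<phi>\<bar> \<le> B"
    "\<And>\<theta>. \<theta> \<in> {0<..<pi} \<Longrightarrow> (LINT \<phi>:{0..2*pi}|lborel. D \<phi> * max (cos (\<phi> - \<theta>)) 0 ^ k) = h \<theta>"
  using assms unfolding angular_rep_def by blast

lemma set_integrable_angular:
  fixes D :: "real \<Rightarrow> real"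
  assumes [measurable]: "D \<in> borel_measurable borel" and D: "\<And>\<phi>. \<bar>D \<phi>\<bar> \<le> B"
  shows "set_integrable lborel {0..2*pi} (\<lambda>\<phi>. D \<phi> * max (cos (\<phi> - \<theta>)) 0 ^ k)"
  unfolding set_integrable_def
proof (rule integrableI_bounded_set_indicator[where B = B])
  have "norm (D x * max (cos (x - \<theta>)) 0 ^ k) \<le> B" for x
  proof -
    have "norm (D x * max (cos (x - \<theta>)) 0 ^ k) = \<bar>D x\<bar> * max (cos (x - \<theta>)) 0 ^ k" by (simp add: abs_mult)
    also have "\<dots> \<le> B * 1"
    proof (rule mult_mono)
      show "max (cos (x - \<theta>)) 0 ^ k \<le> 1" by (intro power_le_one) auto
    qed (use D[of x] in auto)
    finally show ?thesis by simp
  qed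
  then show "AE x in lborel. x \<in> {0..2*pi} \<longrightarrow> norm (D x * max (cos (x - \<theta>)) 0 ^ k) \<le> B" by simp
qed auto

lemma angular_rep_add:
  assumes "angular_rep k f" "angular_rep k g" shows "angular_rep k (\<lambda>\<theta>. f \<theta> + g \<theta>)"
proof -
  from assms obtain D1 B1 D2 B2 where
    D [measurable]: "D1 \<in> borel_measurable borel" "D2 \<in> borel_measurable borel" and
    B: "\<And>\<phi>. \<bar>D1 \<phi>\<bar> \<le> B1" "\<And>\<phi>. \<bar>D2 \<phi>\<bar> \<le> B2" and
    I: "\<And>\<theta>. \<theta> \<in> {0<..<pi} \<Longrightarrow> (LINT \<phi>:{0..2*pi}|lborel. D1 \<phi> * max (cos (\<phi> - \<theta>)) 0 ^ k) = f \<theta>"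
       "\<And>\<theta>. \<theta> \<in> {0<..<pi} \<Longrightarrow> (LINT \<phi>:{0..2*pi}|lborel. D2 \<phi> * max (cos (\<phi> - \<theta>)) 0 ^ k) = g \<theta>"
    unfolding angular_rep_def by blast
  show ?thesis unfolding angular_rep_def
  proof (intro exI conjI allI ballI)
    show "(\<lambda>\<phi>. D1 \<phi> + D2 \<phi>) \<in> borel_measurable borel" by measurable
    show "\<bar>D1 \<phi> + D2 \<phi>\<bar> \<le> B1 + B2" for \<phi> using B(1)[of \<phi>] B(2)[of \<phi>] by linarith
    fix \<theta> assume \<theta>: "\<theta> \<in> {0<..<pi}"
    show "(LINT \<phi>:{0..2*pi}|lborel. (D1 \<phi> + D2 \<phi>) * max (cos (\<phi> - \<theta>)) 0 ^ k) = f \<theta> + g \<theta>"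
      unfolding distrib_right
      by (subst set_integral_add(2)[OF set_integrable_angular[OF D(1) B(1)] set_integrable_angular[OF D(2) B(2)]])
         (simp only: I[OF \<theta>])
  qed
qed

lemma angular_rep_cmult:
  assumes "angular_rep k f" shows "angular_rep k (\<lambda>\<theta>. c * f \<theta>)"
proof -
  from assms obtain D B where
    D [measurable]: "D \<in> borel_measurable borel" and B: "\<And>\<phi>. \<bar>D \<phi>\<bar> \<le> B" and
    I: "\<And>\<theta>. \<theta> \<in> {0<..<pi} \<Longrightarrow> (LINT \<phi>:{0..2*pi}|lborel. D \<phi> * max (cos (\<phi> - \<theta>)) 0 ^ k) = f \<theta>"
    unfolding angular_rep_def by blast
  show ?thesis unfolding angular_rep_def
  proof (intro exI conjI allI ballI)
    show "(\<lambda>\<phi>. c * D \<phi>) \<in> borel_measurable borel" by measurable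
    show "\<bar>c * D \<phi>\<bar> \<le> \<bar>c\<bar> * B" for \<phi> unfolding abs_mult by (intro mult_left_mono B) auto
    fix \<theta> assume \<theta>: "\<theta> \<in> {0<..<pi}"
    show "(LINT \<phi>:{0..2*pi}|lborel. c * D \<phi> * max (cos (\<phi> - \<theta>)) 0 ^ k) = c * f \<theta>"
      unfolding mult.assoc set_integral_mult_right I[OF \<theta>] ..
  qed
qed

lemma angular_rep_sum:
  assumes "finite J" "\<And>j. j \<in> J \<Longrightarrow> angular_rep k (f j)"
  shows "angular_rep k (\<lambda>\<theta>. \<Sum>j\<in>J. f j \<theta>)"
  using assms
proof (induction J rule: finite_induct)
  case empty
  show ?case unfolding angular_rep_def
    by (intro exI[of _ "\<lambda>_. 0"] exI[of _ 0]) auto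
next
  case (insert x J)
  then show ?case by (simp add: angular_rep_add)
qed

text \<open>This eigenvalue of the neuron kernel must not be 0, since it will be divided by. A shift
  by pi exchanges the positive and negative parts of cos with the sign (-1)^(k+m) = 1, so twice the
  moment is the integral of cos (m \<phi>) cos \<phi> ^ k. Rodrigues' formula leaves an integrand
  that is nonnegative because k - m is even.\<close>

lemma angular_moment_pos:
  fixes m k :: nat
  assumes "m \<le> k" "even (k - m)" "k > 0"
  shows "integral {0..2*pi} (\<lambda>\<phi>. cos (m * \<phi>) * max (cos \<phi>) 0 ^ k) > 0"
proof -
  define I where "I h = integral {0..2*pi} h" for h :: "real \<Rightarrow> real"
  define G where "G j t = fact k / fact (k - j) * t ^ (k - j)" for j and t :: real
  have km: "even (k + m)" using assms by presburger
  have per: "cos (m * (x + 2 * pi)) = cos (m * x)" for x :: real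
  proof -
    have "m * (x + 2 * pi) = m * x + 2 * real m * pi" by (simp add: algebra_simps)
    then show ?thesis by (simp add: cos_add sin_2npi cos_2npi)
  qed
  have shift: "cos (m * (x + pi)) = (-1) ^ m * cos (m * x)" for x :: real
  proof -
    have "m * (x + pi) = m * x + real m * pi" by (simp add: algebra_simps)
    then show ?thesis by (simp add: cos_add)
  qed
  have "I (\<lambda>\<phi>. (-1) ^ k * (cos (m * \<phi>) * max (- cos \<phi>) 0 ^ k)) = I (\<lambda>\<phi>. (-1) ^ k * (cos (m * (\<phi> + pi)) * max (- cos (\<phi> + pi)) 0 ^ k))"
    unfolding I_def by (rule integral_periodic_shift[symmetric]) (auto intro!: continuous_intros simp: per)
  also have "\<dots> = I (\<lambda>\<phi>. cos (m * \<phi>) * max (cos \<phi>) 0 ^ k)"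
  proof (intro arg_cong[where f=I] ext)
    fix \<phi> :: real
    have "(-1) ^ k * (-1) ^ m = (1::real)" using km by (simp flip: power_add)
    moreover have "(-1) ^ k * (cos (m * (\<phi> + pi)) * max (- cos (\<phi> + pi)) 0 ^ k) = ((-1) ^ k * (-1) ^ m) * (cos (m * \<phi>) * max (cos \<phi>) 0 ^ k)"
      unfolding shift cos_periodic_pi minus_minus by (simp only: mult.assoc)
    ultimately show "(-1) ^ k * (cos (m * (\<phi> + pi)) * max (- cos (\<phi> + pi)) 0 ^ k) = cos (m * \<phi>) * max (cos \<phi>) 0 ^ k"
      by simp
  qed
  finally have eq: "I (\<lambda>\<phi>. (-1) ^ k * (cos (m * \<phi>) * max (- cos \<phi>) 0 ^ k)) = I (\<lambda>\<phi>. cos (m * \<phi>) * max (cos \<phi>) 0 ^ k)" .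
  have "2 * I (\<lambda>\<phi>. cos (m * \<phi>) * max (cos \<phi>) 0 ^ k) = I (\<lambda>\<phi>. cos (m * \<phi>) * max (cos \<phi>) 0 ^ k) + I (\<lambda>\<phi>. (-1) ^ k * (cos (m * \<phi>) * max (- cos \<phi>) 0 ^ k))"
    using eq by simp
  also have "\<dots> = I (\<lambda>\<phi>. cos (m * \<phi>) * max (cos \<phi>) 0 ^ k + (-1) ^ k * (cos (m * \<phi>) * max (- cos \<phi>) 0 ^ k))"
    unfolding I_def by (intro integral_add[symmetric] continuous_integrable continuous_intros)
  also have "\<dots> = I (\<lambda>\<phi>. cos (m * \<phi>) * G 0 (cos \<phi>))"
  proof (intro arg_cong[where f=I] ext)
    fix \<phi> :: real
    have "max x 0 ^ k + (-1) ^ k * max (- x) 0 ^ k = x ^ k" for x :: real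
    proof (cases "x \<ge> 0")
      case True
      then show ?thesis using assms by (simp add: max_def)
    next
      case False
      have "(-1) ^ k * (- x) ^ k = x ^ k" by (simp flip: power_mult_distrib)
      then show ?thesis using False assms by (simp add: max_def)
    qed
    from this[of "cos \<phi>"]
    have "cos (m * \<phi>) * (max (cos \<phi>) 0 ^ k + (-1) ^ k * max (- cos \<phi>) 0 ^ k) = cos (m * \<phi>) * cos \<phi> ^ k" by simp
    then show "cos (m * \<phi>) * max (cos \<phi>) 0 ^ k + (-1) ^ k * (cos (m * \<phi>) * max (- cos \<phi>) 0 ^ k) = cos (m * \<phi>) * G 0 (cos \<phi>)"
      unfolding distrib_left by (simp add: G_def mult_ac)
  qed
  also have "\<dots> = chebyshev_const m * I (\<lambda>\<phi>. sin \<phi> ^ (2 * m) * G m (cos \<phi>))"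
    unfolding I_def
  proof (rule rodrigues_integral)
    show "(G j has_real_derivative G (Suc j) x) (at x)" if "j < m" for j x
    proof -
      define i where "i = k - Suc j"
      have i: "k - j = Suc i" and i': "k - Suc j = i" using that assms by (auto simp: i_def)
      have "((\<lambda>t. fact k / fact (Suc i) * t ^ Suc i) has_real_derivative fact k / fact (Suc i) * (Suc i * x ^ i)) (at x)"
        by (rule derivative_eq_intros refl | simp)+
      also have "fact k / fact (Suc i) * (Suc i * x ^ i) = fact k / fact i * x ^ i"
        by (simp add: divide_simps)
      finally show ?thesis unfolding G_def[abs_def] i i' .
    qed
    show "continuous_on UNIV (G m)" unfolding G_def[abs_def] by (intro continuous_intros)
  qed
  also have "\<dots> > 0"
    unfolding I_def
  proof (rule mult_pos_pos[OF chebyshev_const_pos integral_pos_continuous[where c = "pi/4"]])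
    show "continuous_on UNIV (\<lambda>\<phi>. sin \<phi> ^ (2 * m) * G m (cos \<phi>))"
      unfolding G_def by (intro continuous_intros)
    show "0 \<le> sin x ^ (2 * m) * G m (cos x)" for x
      unfolding G_def using assms by (intro mult_nonneg_nonneg zero_le_even_power) auto
    show "0 < sin (pi/4) ^ (2 * m) * G m (cos (pi/4))"
      unfolding G_def by (simp add: sin_45 cos_45)
  qed auto
  finally show ?thesis by (simp add: I_def)
qed

lemma angular_rep_sin_cos_nat:
  fixes m k :: nat
  assumes "m \<le> k" "even (k - m)" "k > 0"
  shows "angular_rep k (\<lambda>\<theta>. sin (m * \<theta>))" "angular_rep k (\<lambda>\<theta>. cos (m * \<theta>))"
proof -
  define \<gamma> where "\<gamma> = integral {0..2*pi} (\<lambda>\<phi>. cos (m * \<phi>) * max (cos \<phi>) 0 ^ k)"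
  have \<gamma>: "\<gamma> > 0" unfolding \<gamma>_def by (rule angular_moment_pos[OF assms])
  have c: "continuous_on UNIV (\<lambda>t::real. max t 0 ^ k)" by (intro continuous_intros)
  have 1: "(LINT \<phi>:{0..2*pi}|lborel. sin (m * \<phi>) * max (cos (\<phi> - \<theta>)) 0 ^ k) = sin (m * \<theta>) * \<gamma>"
    "(LINT \<phi>:{0..2*pi}|lborel. cos (m * \<phi>) * max (cos (\<phi> - \<theta>)) 0 ^ k) = cos (m * \<theta>) * \<gamma>" for \<theta> :: real
    unfolding \<gamma>_def angular_integral_shift[OF c, symmetric]
    by (rule set_integral_continuous(2), intro continuous_intros)+
  have "angular_rep k (\<lambda>\<theta>. sin (m * \<theta>) * \<gamma>)"
    unfolding angular_rep_def by (rule exI[of _ "\<lambda>\<phi>::real. sin (m * \<phi>)"], rule exI[of _ 1]) (use 1 in simp)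
  moreover have "angular_rep k (\<lambda>\<theta>. cos (m * \<theta>) * \<gamma>)"
    unfolding angular_rep_def by (rule exI[of _ "\<lambda>\<phi>::real. cos (m * \<phi>)"], rule exI[of _ 1]) (use 1 in simp)
  ultimately show "angular_rep k (\<lambda>\<theta>. sin (m * \<theta>))" "angular_rep k (\<lambda>\<theta>. cos (m * \<theta>))"
    using \<gamma> angular_rep_cmult[of k "\<lambda>\<theta>::real. sin (m * \<theta>) * \<gamma>" "1 / \<gamma>"]
      angular_rep_cmult[of k "\<lambda>\<theta>::real. cos (m * \<theta>) * \<gamma>" "1 / \<gamma>"] by simp_all
qed

text \<open>The frequencies k - 2 j have the parity of k but can be negative; oddness of the sine
  then reduces them to 2 j - k.\<close>

lemma angular_rep_sin_int:
  fixes j k :: nat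
  assumes "j \<le> k" "k > 0"
  shows "angular_rep k (\<lambda>\<theta>. sin ((real k - 2 * real j) * \<theta>))"
proof (cases "2 * j \<le> k")
  case True
  have "real (k - 2 * j) = real k - 2 * real j" using True by (simp add: of_nat_diff)
  moreover have "angular_rep k (\<lambda>\<theta>. sin (real (k - 2 * j) * \<theta>))"
    using assms True by (intro angular_rep_sin_cos_nat(1)) auto
  ultimately show ?thesis by simp
next
  case False
  have "real (2 * j - k) = - (real k - 2 * real j)" using False by (simp add: of_nat_diff)
  moreover have "angular_rep k (\<lambda>\<theta>. (-1) * sin (real (2 * j - k) * \<theta>))"
    using assms False by (intro angular_rep_cmult angular_rep_sin_cos_nat(1)) auto
  ultimately show ?thesis by (simp add: minus_mult_left[symmetric] del: minus_diff_eq)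
qed

text \<open>The resonant term \<open>j = 0\<close> of the binomial expansion produces the factor \<open>\<theta>\<close>.\<close>

lemma cos_times_cos_power:
  fixes \<phi> \<theta> :: real
  shows "2 ^ k * (cos (k * \<phi>) * cos (\<phi> - \<theta>) ^ k) = (\<Sum>j\<le>k. (k choose j) * cos (k * \<theta> + 2 * real j * (\<phi> - \<theta>)))"
proof -
  define \<alpha> where "\<alpha> = \<phi> - \<theta>"
  have "cis (k * \<phi>) * (2 * cos \<alpha>) ^ k = cis (k * \<theta>) * (cis \<alpha> * (2 * cos \<alpha>)) ^ k"
  proof -
    have "cis (k * \<phi>) = cis (k * \<theta>) * cis \<alpha> ^ k"
      unfolding Complex.DeMoivre cis_mult by (simp add: \<alpha>_def algebra_simps)
    then show ?thesis by (simp add: power_mult_distrib)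
  qed
  also have "cis \<alpha> * (2 * cos \<alpha>) = cis (2 * \<alpha>) + 1"
  proof -
    have "cis \<alpha> + cis (- \<alpha>) = 2 * cos \<alpha>" by (simp add: complex_eq_iff)
    then have "cis \<alpha> * (2 * cos \<alpha>) = cis \<alpha> * (cis \<alpha> + cis (- \<alpha>))" by simp
    also have "\<dots> = cis (2 * \<alpha>) + 1" unfolding distrib_left cis_mult by simp
    finally show ?thesis .
  qed
  also have "(cis (2 * \<alpha>) + 1) ^ k = (\<Sum>j\<le>k. of_nat (k choose j) * cis (2 * \<alpha>) ^ j)"
    by (subst binomial_ring) simp
  also have "cis (k * \<theta>) * \<dots> = (\<Sum>j\<le>k. of_nat (k choose j) * cis (k * \<theta> + 2 * real j * \<alpha>))"
    unfolding sum_distrib_left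
  proof (rule sum.cong[OF refl])
    fix j
    have "cis (k * \<theta>) * cis (2 * \<alpha>) ^ j = cis (k * \<theta> + 2 * real j * \<alpha>)"
      unfolding Complex.DeMoivre cis_mult by (simp add: mult_ac)
    then show "cis (k * \<theta>) * (of_nat (k choose j) * cis (2 * \<alpha>) ^ j) = of_nat (k choose j) * cis (k * \<theta> + 2 * real j * \<alpha>)"
      by (simp add: mult.left_commute)
  qed
  finally have "Re (cis (k * \<phi>) * (2 * cos \<alpha>) ^ k) = Re (\<Sum>j\<le>k. of_nat (k choose j) * cis (k * \<theta> + 2 * real j * \<alpha>))"
    by (rule arg_cong)
  moreover have "Re (cis (k * \<phi>) * (2 * cos \<alpha>) ^ k) = 2 ^ k * (cos (k * \<phi>) * cos \<alpha> ^ k)"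
  proof -
    have "(2 * cos \<alpha>) ^ k = complex_of_real ((2 * cos \<alpha>) ^ k)" by simp
    then show ?thesis by (simp only: times_complex.sel Re_complex_of_real Im_complex_of_real cis.sel) (simp add: power_mult_distrib)
  qed
  ultimately show ?thesis by (simp add: \<alpha>_def)
qed

text \<open>The density is a multiple of cos (k \<phi>) on [pi/2, 3 pi/2]. This half circle meets
  the one where cos (\<phi> - \<theta>) \<ge> 0 in an arc of length \<theta>, from pi/2 to \<theta>
  + pi/2. The term of the expansion that is constant in \<phi> gives \<theta> cos (k \<theta>); the
  others give sines of frequency k and k - 2 j, which are representable and are subtracted.\<close>

lemma angular_rep_theta_cos:
  assumes k: "k > 0"
  shows "angular_rep k (\<lambda>\<theta>. \<theta> * cos (k * \<theta>))"
proof -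
  define D where "D \<phi> = 2 ^ k * (indicator {pi/2..3*pi/2} \<phi> * cos (k * \<phi>))" for \<phi> :: real
  define T where "T \<theta> = \<theta> * cos (k * \<theta>) + (\<Sum>j=1..k. (k choose j) * (-1::real)^j / (2 * real j) * (sin (k * \<theta>) - sin ((real k - 2 * real j) * \<theta>)))" for \<theta> :: real
  have "(LINT \<phi>:{0..2*pi}|lborel. D \<phi> * max (cos (\<phi> - \<theta>)) 0 ^ k) = T \<theta>" if \<theta>: "\<theta> \<in> {0<..<pi}" for \<theta> :: real
  proof -
    have "(LINT \<phi>:{0..2*pi}|lborel. D \<phi> * max (cos (\<phi> - \<theta>)) 0 ^ k) = (LINT \<phi>:{pi/2..\<theta>+pi/2}|lborel. 2 ^ k * (cos (k * \<phi>) * cos (\<phi> - \<theta>) ^ k))"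
      unfolding set_lebesgue_integral_def
    proof (rule Bochner_Integration.integral_cong[OF refl])
      fix \<phi> :: real
      consider "\<phi> < pi/2 \<or> \<phi> > 3*pi/2" | "pi/2 \<le> \<phi>" "\<phi> \<le> \<theta> + pi/2" | "\<theta> + pi/2 < \<phi>" "\<phi> \<le> 3*pi/2" by linarith
      then show "indicator {0..2*pi} \<phi> *\<^sub>R (D \<phi> * max (cos (\<phi> - \<theta>)) 0 ^ k) = indicator {pi/2..\<theta>+pi/2} \<phi> *\<^sub>R (2 ^ k * (cos (k * \<phi>) * cos (\<phi> - \<theta>) ^ k))"
      proof cases
        case 1
        then show ?thesis using \<theta> by (auto simp: D_def)
      next
        case 2
        have "cos (\<phi> - \<theta>) \<ge> 0" using 2 \<theta> by (intro cos_ge_zero) auto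
        then show ?thesis using 2 \<theta> by (simp add: D_def)
      next
        case 3
        have "cos (\<phi> - \<theta> - pi) \<ge> 0" using 3 \<theta> by (intro cos_ge_zero) auto
        then have "cos (\<phi> - \<theta>) \<le> 0" by (simp add: cos_diff[of "\<phi> - \<theta>" pi])
        then have "max (cos (\<phi> - \<theta>)) 0 = 0" by simp
        then show ?thesis using 3 k by simp
      qed
    qed
    also have "\<dots> = integral {pi/2..\<theta>+pi/2} (\<lambda>\<phi>. 2 ^ k * (cos (k * \<phi>) * cos (\<phi> - \<theta>) ^ k))"
      by (intro set_integral_continuous continuous_intros)
    also have "\<dots> = T \<theta>"
    proof -
      \<comment> \<open>Termwise primitive of the expansion in \<open>cos_times_cos_power\<close>; j
        = 0 stands apart because it does not oscillate in \<phi>.\<close>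
      define A where "A \<phi> = \<phi> * cos (k * \<theta>) + (\<Sum>j=1..k. (k choose j) * sin (k * \<theta> + 2 * real j * (\<phi> - \<theta>)) / (2 * real j))" for \<phi> :: real
      have hi: "((\<lambda>\<phi>. 2 ^ k * (cos (k * \<phi>) * cos (\<phi> - \<theta>) ^ k)) has_integral A (\<theta> + pi/2) - A (pi/2)) {pi/2..\<theta>+pi/2}"
      proof (rule has_integral_derivative_real)
        fix \<phi> :: real
        have "(A has_real_derivative 1 * cos (k * \<theta>) + (\<Sum>j=1..k. (k choose j) * cos (k * \<theta> + 2 * real j * (\<phi> - \<theta>)))) (at \<phi>)"
          unfolding A_def[abs_def]
        proof (rule DERIV_add[OF DERIV_cmult_right[OF DERIV_ident] DERIV_sum])
          fix j assume "j \<in> {1..k}"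
          then show "((\<lambda>\<phi>. (k choose j) * sin (k * \<theta> + 2 * real j * (\<phi> - \<theta>)) / (2 * real j)) has_real_derivative (k choose j) * cos (k * \<theta> + 2 * real j * (\<phi> - \<theta>))) (at \<phi>)"
            by (auto intro!: derivative_eq_intros)
        qed
        also have "1 * cos (k * \<theta>) + (\<Sum>j=1..k. (k choose j) * cos (k * \<theta> + 2 * real j * (\<phi> - \<theta>))) = (\<Sum>j\<le>k. (k choose j) * cos (k * \<theta> + 2 * real j * (\<phi> - \<theta>)))"
          by (simp add: atMost_atLeast0 sum.atLeast_Suc_atMost)
        finally show "(A has_real_derivative 2 ^ k * (cos (k * \<phi>) * cos (\<phi> - \<theta>) ^ k)) (at \<phi>)"
          unfolding cos_times_cos_power .
      qed (use \<theta> in auto)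
      have AT: "A (\<theta> + pi/2) - A (pi/2) = T \<theta>"
      proof -
        \<comment> \<open>At the two ends of the arc the phases are k \<theta> + j pi and (k - 2 j)
          \<theta> + j pi, whence the common sign (-1)^j.\<close>
        have t: "(k choose j) * sin (k * \<theta> + 2 * real j * (\<theta> + pi/2 - \<theta>)) / (2 * real j) - (k choose j) * sin (k * \<theta> + 2 * real j * (pi/2 - \<theta>)) / (2 * real j)
           = (k choose j) * (-1::real)^j / (2 * real j) * (sin (k * \<theta>) - sin ((real k - 2 * real j) * \<theta>))" for j :: nat
        proof -
          have "k * \<theta> + 2 * real j * (\<theta> + pi/2 - \<theta>) = k * \<theta> + j * pi" by simp
          then have 1: "sin (k * \<theta> + 2 * real j * (\<theta> + pi/2 - \<theta>)) = (-1::real)^j * sin (k * \<theta>)" by (simp add: sin_add)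
          have "k * \<theta> + 2 * real j * (pi/2 - \<theta>) = (real k - 2 * real j) * \<theta> + j * pi" by (simp add: algebra_simps)
          then have 2: "sin (k * \<theta> + 2 * real j * (pi/2 - \<theta>)) = (-1::real)^j * sin ((real k - 2 * real j) * \<theta>)" by (simp add: sin_add)
          have "c * (m * x) / d - c * (m * y) / d = c * m / d * (x - y)" for c m x y d :: real
            by (simp add: right_diff_distrib diff_divide_distrib mult.assoc)
          then show ?thesis unfolding 1 2 .
        qed
        have e: "(\<theta> + pi/2) * cos (k * \<theta>) = \<theta> * cos (k * \<theta>) + pi/2 * cos (k * \<theta>)" by (rule distrib_right)
        show ?thesis unfolding A_def T_def t[symmetric] sum_subtractf e by linarith
      qed
      show ?thesis unfolding integral_unique[OF hi] by (rule AT)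
    qed
    finally show ?thesis .
  qed
  moreover have "\<bar>D \<phi>\<bar> \<le> 2 ^ k" for \<phi>
    by (auto simp: D_def abs_mult indicator_def)
  moreover have "D \<in> borel_measurable borel" unfolding D_def[abs_def] by measurable
  ultimately have T: "angular_rep k T" unfolding angular_rep_def by blast
  have "angular_rep k (\<lambda>\<theta>. T \<theta> + (-1) * (\<Sum>j=1..k. (k choose j) * (-1::real)^j / (2 * real j) * (sin (k * \<theta>) + (-1) * sin ((real k - 2 * real j) * \<theta>))))"
    by (intro angular_rep_add angular_rep_cmult angular_rep_sum T angular_rep_sin_int angular_rep_sin_cos_nat k) auto
  then show ?thesis by (simp add: T_def)
qed

section \<open>The Barron norm\<close>

lemma relu_pow_measurable [measurable]: "relu_pow \<alpha> \<in> borel_measurable borel"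
  unfolding relu_pow_def[abs_def] by measurable

lemma relu_pow_of_nat: "k > 0 \<Longrightarrow> relu_pow (real k) z = max z 0 ^ k"
  by (cases "z > 0") (auto simp: relu_pow_def powr_realpow max_def)

text \<open>Passes from signed densities to probability measures: the parameter is uniform on
  \<open>S\<close>, and the outer weight is multiplied by the volume \<open>m\<close>. As the cost
  is homogeneous of degree one in the outer weight, the normalisation cancels.\<close>

lemma barron_norm_le_set_integral:
  fixes S :: "'a::euclidean_space set" and a b :: "'a \<Rightarrow> real" and w :: "'a \<Rightarrow> real^'n"
  assumes [measurable]: "S \<in> sets borel" and m: "emeasure lborel S = ennreal m" "m > 0"
    and [measurable]: "a \<in> borel_measurable borel" "b \<in> borel_measurable borel" "w \<in> borel_measurable borel"
    and int: "\<And>x. x \<in> D \<Longrightarrow> set_integrable lborel S (\<lambda>t. a t * relu_pow \<alpha> (w t \<bullet> x + b t))"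
    and f: "\<And>x. x \<in> D \<Longrightarrow> f x = (LINT t:S|lborel. a t * relu_pow \<alpha> (w t \<bullet> x + b t))"
  shows "barron_norm \<alpha> D f \<le> (\<integral>\<^sup>+t. ennreal (\<bar>a t\<bar> * (norm (w t) + \<bar>b t\<bar>) powr \<alpha>) * indicator S t \<partial>lborel)"
proof -
  define U where "U = density lborel (\<lambda>t. ennreal (indicator S t / m))"
  define h where "h t = (m * a t, w t, b t)" for t
  have [measurable]: "h \<in> borel_measurable borel" 
    unfolding h_def[abs_def] by (intro borel_measurable_Pair) measurable
  have sU [measurable_cong, simp]: "sets U = sets borel" by (simp add: U_def)
  define \<pi> where "\<pi> = distr U borel h"
  have hU: "h \<in> measurable U borel" by measurable
  have neuron: "neuron \<alpha> x = (\<lambda>\<theta>. fst \<theta> * relu_pow \<alpha> (fst (snd \<theta>) \<bullet> x + snd (snd \<theta>)))" for x :: "real^'n"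
    by (auto simp: neuron_def fun_eq_iff)
  have [measurable]: "neuron \<alpha> x \<in> borel_measurable borel" for x :: "real^'n"
    unfolding neuron borel_prod[symmetric] by measurable
  have cost: "barron_cost \<alpha> = (\<lambda>\<theta>. \<bar>fst \<theta>\<bar> * (norm (fst (snd \<theta>)) + \<bar>snd (snd \<theta>)\<bar>) powr \<alpha>)"
    by (auto simp: barron_cost_def fun_eq_iff)
  have [measurable]: "(barron_cost \<alpha> :: real \<times> (real^'n) \<times> real \<Rightarrow> real) \<in> borel_measurable borel"
    unfolding cost borel_prod[symmetric] by measurable
  have "emeasure U (space U) = (\<integral>\<^sup>+t. ennreal (1/m) * indicator S t \<partial>lborel)"
    unfolding U_def by (subst emeasure_density) (auto intro!: nn_integral_cong simp: indicator_def)
  also have "\<dots> = ennreal (1/m) * ennreal m" by (simp add: nn_integral_cmult_indicator m)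
  also have "\<dots> = 1" using m by (simp flip: ennreal_mult)
  finally have "prob_space U" by (rule prob_spaceI)
  then have p: "prob_space \<pi>" unfolding \<pi>_def using hU by (rule prob_space.prob_space_distr)
  have 1: "integrable \<pi> (neuron \<alpha> x) \<and> f x = integral\<^sup>L \<pi> (neuron \<alpha> x)" if "x \<in> D" for x
  proof -
    have eq: "(indicator S t / m) *\<^sub>R neuron \<alpha> x (h t) = indicator S t *\<^sub>R (a t * relu_pow \<alpha> (w t \<bullet> x + b t))" for t
      using m by (simp add: h_def neuron_def)
    have "integrable \<pi> (neuron \<alpha> x) \<longleftrightarrow> integrable U (\<lambda>t. neuron \<alpha> x (h t))"
      unfolding \<pi>_def by (rule integrable_distr_eq) measurable
    also have "\<dots> \<longleftrightarrow> integrable lborel (\<lambda>t. (indicator S t / m) *\<^sub>R neuron \<alpha> x (h t))"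
      unfolding U_def using m by (intro integrable_density) auto
    also have "\<dots>" using int[OF that] unfolding eq set_integrable_def .
    finally have "integrable \<pi> (neuron \<alpha> x)" .
    moreover have "integral\<^sup>L \<pi> (neuron \<alpha> x) = integral\<^sup>L U (\<lambda>t. neuron \<alpha> x (h t))"
      unfolding \<pi>_def by (rule integral_distr) measurable
    moreover have "\<dots> = integral\<^sup>L lborel (\<lambda>t. (indicator S t / m) *\<^sub>R neuron \<alpha> x (h t))"
      unfolding U_def using m by (intro integral_density) auto
    moreover have "\<dots> = f x" using f[OF that] unfolding eq set_lebesgue_integral_def by simp
    ultimately show ?thesis by simp
  qed
  have "barron_represents \<pi> \<alpha> D f"
    using p 1 by (simp add: barron_represents_def \<pi>_def)
  then have "barron_norm \<alpha> D f \<le> (\<integral>\<^sup>+ \<theta>. ennreal (barron_cost \<alpha> \<theta>) \<partial>\<pi>)"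
    unfolding barron_norm_def by (intro INF_lower) simp
  also have "\<dots> = (\<integral>\<^sup>+t. ennreal (barron_cost \<alpha> (h t)) \<partial>U)"
    unfolding \<pi>_def by (rule nn_integral_distr) measurable
  also have "\<dots> = (\<integral>\<^sup>+t. ennreal (indicator S t / m) * ennreal (barron_cost \<alpha> (h t)) \<partial>lborel)"
    unfolding U_def by (rule nn_integral_density) measurable
  also have "\<dots> = (\<integral>\<^sup>+t. ennreal (\<bar>a t\<bar> * (norm (w t) + \<bar>b t\<bar>) powr \<alpha>) * indicator S t \<partial>lborel)"
    using m by (intro nn_integral_cong)
      (auto simp: indicator_def barron_cost_def h_def abs_mult simp flip: ennreal_mult)
  finally show ?thesis .
qed

text \<open>Taking pi/2 - arctan (x / y) as the angle gives values in (0, pi) on the upper half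
  plane and turns the coefficient 1/2 + arctan (x / y) / pi into 1 - \<theta> / pi.\<close>

lemma half_disc_polar:
  assumes "v \<in> half_disc R" "R > 0"
  obtains r \<theta> where "0 < r" "r < R" "0 < \<theta>" "\<theta> < pi" "v$1 = r * cos \<theta>" "v$2 = r * sin \<theta>"
    "arctan (v$1 / v$2) = pi / 2 - \<theta>"
proof -
  define t where "t = v$1 / v$2"
  define \<theta> where "\<theta> = pi / 2 - arctan t"
  define r where "r = norm v"
  have v2: "v$2 > 0" using assms half_discD by blast
  have s: "sqrt (1 + t\<^sup>2) > 0" by (simp add: add_pos_nonneg)
  have r: "r = v$2 * sqrt (1 + t\<^sup>2)"
  proof -
    have "(v$1)\<^sup>2 + (v$2)\<^sup>2 = (v$2)\<^sup>2 * (1 + t\<^sup>2)" using v2 by (simp add: t_def field_simps)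
    then have "r = sqrt ((v$2)\<^sup>2 * (1 + t\<^sup>2))" by (simp add: r_def norm_vec_def L2_set_def sum_2)
    then show ?thesis using v2 by (simp add: real_sqrt_mult)
  qed
  have "cos \<theta> = sin (arctan t)" "sin \<theta> = cos (arctan t)" by (simp_all add: \<theta>_def cos_diff sin_diff)
  then have cs: "cos \<theta> = t / sqrt (1 + t\<^sup>2)" "sin \<theta> = 1 / sqrt (1 + t\<^sup>2)" by (simp_all add: sin_arctan cos_arctan)
  show thesis
  proof (rule that[of r \<theta>])
    show "0 < r" using v2 s by (simp add: r)
    show "r < R" using half_discD(2)[OF assms] by (simp add: r_def)
    show "0 < \<theta>" "\<theta> < pi" using arctan_bounded[of t] by (auto simp: \<theta>_def)
    have "v$1 = v$2 * t" using v2 by (simp add: t_def)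
    then show "v$1 = r * cos \<theta>" using s by (simp add: r cs)
    show "v$2 = r * sin \<theta>" using s by (simp add: r cs)
    show "arctan (v$1 / v$2) = pi / 2 - \<theta>" by (simp add: \<theta>_def t_def)
  qed
qed

text \<open>Isolates the homogeneous part, which contains the resonant term, from the logarithmic
  part; \<epsilon> enters only the latter.\<close>

lemma u_fun_polar:
  assumes "v$1 = r * cos \<theta>" "v$2 = r * sin \<theta>" "arctan (v$1 / v$2) = pi / 2 - \<theta>"
  shows "u_fun \<epsilon> k v = r ^ k * (cos (k * \<theta>) + (- 1 / pi) * (\<theta> * cos (k * \<theta>)))
    - 1 / (2 * pi) * (r ^ k * sin (k * \<theta>) * ln (r\<^sup>2 + \<epsilon>\<^sup>2))"
proof -
  have "Complex (v$1) (v$2) = complex_of_real r * cis \<theta>" by (simp add: assms complex_eq_iff)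
  then have "Complex (v$1) (v$2) ^ k = complex_of_real (r ^ k) * cis (k * \<theta>)"
    by (simp only: power_mult_distrib Complex.DeMoivre of_real_power)
  then have z: "Re (Complex (v$1) (v$2) ^ k) = r ^ k * cos (k * \<theta>)" "Im (Complex (v$1) (v$2) ^ k) = r ^ k * sin (k * \<theta>)"
    by simp_all
  have n: "(v$1)\<^sup>2 + (v$2)\<^sup>2 = r\<^sup>2"
    unfolding assms power_mult_distrib distrib_left[symmetric] by simp
  have p: "1 / 2 + (pi / 2 - \<theta>) / pi = 1 - \<theta> / pi" by (simp add: field_simps)
  have "u_fun \<epsilon> k v = (1 - \<theta> / pi) * (r ^ k * cos (k * \<theta>)) - ln (r\<^sup>2 + \<epsilon>\<^sup>2) / (2 * pi) * (r ^ k * sin (k * \<theta>))"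
    unfolding u_fun_def Let_def z n assms(3) p ..
  also have "(1 - \<theta> / pi) * (r ^ k * cos (k * \<theta>)) = r ^ k * (cos (k * \<theta>) + (- 1 / pi) * (\<theta> * cos (k * \<theta>)))"
    by (simp add: algebra_simps)
  also have "ln (r\<^sup>2 + \<epsilon>\<^sup>2) / (2 * pi) * (r ^ k * sin (k * \<theta>)) = 1 / (2 * pi) * (r ^ k * sin (k * \<theta>) * ln (r\<^sup>2 + \<epsilon>\<^sup>2))"
    by simp
  finally show ?thesis .
qed

lemma log_kernel_primitive:
  assumes "E > 0"
  shows "((\<lambda>t. c * ln (t\<^sup>2 + E)) has_real_derivative (2 * c) * t / (t\<^sup>2 + E)) (at t)"
proof -
  have "t\<^sup>2 + E > 0" using assms by (simp add: add_nonneg_pos)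
  then have "((\<lambda>t. ln (t\<^sup>2 + E)) has_real_derivative (2 * t) / (t\<^sup>2 + E)) (at t)"
    by (auto intro!: derivative_eq_intros)
  from DERIV_cmult[OF this, of c] show ?thesis by (simp add: mult_ac)
qed

text \<open>Here the factor \<bar>ln \<epsilon>\<bar> of the Barron norm originates. On either side
  of 0 the majorant has the primitive c ln (t^2 + E) up to sign, so both halves contribute
  equally.\<close>

lemma nn_integral_log_kernel_le:
  fixes g :: "real \<Rightarrow> real"
  assumes E: "E > 0" and R: "R \<ge> 0" and c: "c \<ge> 0"
    and g: "\<And>t. \<bar>g t\<bar> \<le> (2 * c) * \<bar>t\<bar> / (t\<^sup>2 + E)"
  shows "(\<integral>\<^sup>+t. ennreal \<bar>g t\<bar> * indicator {-R..R} t \<partial>lborel) \<le> ennreal (2 * c * (ln (R\<^sup>2 + E) - ln E))"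
proof -
  define h where "h t = (2 * c) * t / (t\<^sup>2 + E)" for t
  define H where "H t = c * ln (t\<^sup>2 + E)" for t
  have dH: "(H has_real_derivative h t) (at t)" for t
    unfolding H_def[abs_def] h_def by (rule log_kernel_primitive[OF E])
  have pos: "t\<^sup>2 + E > 0" for t using E by (simp add: add_nonneg_pos)
  have meas [measurable]: "h \<in> borel_measurable borel" unfolding h_def[abs_def] by measurable
  have "(\<integral>\<^sup>+t. ennreal \<bar>g t\<bar> * indicator {-R..R} t \<partial>lborel)
     \<le> (\<integral>\<^sup>+t. ennreal (- h t) * indicator {-R..0} t + ennreal (h t) * indicator {0..R} t \<partial>lborel)"
  proof (rule nn_integral_mono)
    fix t
    show "ennreal \<bar>g t\<bar> * indicator {-R..R} t \<le> ennreal (- h t) * indicator {-R..0} t + ennreal (h t) * indicator {0..R} t"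
    proof (cases "t \<ge> 0")
      case True
      then have "ennreal \<bar>g t\<bar> \<le> ennreal (h t)" using g[of t] by (intro ennreal_leI) (simp add: h_def)
      then show ?thesis using True by (auto simp: indicator_def add_increasing)
    next
      case False
      then have "ennreal \<bar>g t\<bar> \<le> ennreal (- h t)" using g[of t] by (intro ennreal_leI) (simp add: h_def)
      then show ?thesis using False R by (auto simp: indicator_def)
    qed
  qed
  also have "\<dots> = (\<integral>\<^sup>+t. ennreal (- h t) * indicator {-R..0} t \<partial>lborel) + (\<integral>\<^sup>+t. ennreal (h t) * indicator {0..R} t \<partial>lborel)"
    by (rule nn_integral_add) auto
  also have "(\<integral>\<^sup>+t. ennreal (h t) * indicator {0..R} t \<partial>lborel) = ennreal (H R - H 0)"
    by (rule nn_integral_FTC_Icc)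
       (use dH R c pos in \<open>auto simp: has_real_derivative_iff_has_vector_derivative h_def less_imp_le intro!: divide_nonneg_nonneg intro: has_vector_derivative_at_within\<close>)
  also have "(\<integral>\<^sup>+t. ennreal (- h t) * indicator {-R..0} t \<partial>lborel) = ennreal (- H 0 - (- H (-R)))"
  proof (rule nn_integral_FTC_Icc[where F = "\<lambda>t. - H t"])
    show "((\<lambda>t. - H t) has_real_derivative - h x) (at x)" for x
      by (rule DERIV_minus[OF dH])
    show "0 \<le> - h x" if "x \<in> {-R..0}" for x
      using that c pos[of x] by (auto simp: h_def intro!: divide_nonpos_nonneg mult_nonneg_nonpos)
  qed (use R in auto)
  also have "ennreal (- H 0 - (- H (-R))) + ennreal (H R - H 0) = ennreal (2 * c * (ln (R\<^sup>2 + E) - ln E))"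
  proof -
    have "ln E \<le> ln (R\<^sup>2 + E)" using E pos[of R] by (subst ln_le_cancel_iff) auto
    then have "H 0 \<le> H R" unfolding H_def using c by (simp add: mult_left_mono)
    moreover have "H (-R) = H R" by (simp add: H_def)
    ultimately show ?thesis by (simp flip: ennreal_plus) (simp add: H_def algebra_simps)
  qed
  finally show ?thesis .
qed

text \<open>Controls the value F k 0 that appears in \<open>log_representation\<close>. The bound on
  g is integrated from -R, where \<psi> vanishes, to 0, in the form that - H - \<psi> and - H +
  \<psi> are nondecreasing there.\<close>

lemma abs_log_kernel_primitive_le:
  fixes g \<psi> :: "real \<Rightarrow> real"
  assumes E: "E > 0" and R: "R \<ge> 0"
    and g: "\<And>t. \<bar>g t\<bar> \<le> (2 * c) * \<bar>t\<bar> / (t\<^sup>2 + E)"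
    and \<psi>: "\<And>t. (\<psi> has_real_derivative g t) (at t)" "\<psi> (-R) = 0"
  shows "\<bar>\<psi> 0\<bar> \<le> c * (ln (R\<^sup>2 + E) - ln E)"
proof -
  define H where "H t = c * ln (t\<^sup>2 + E)" for t
  have dH: "(H has_real_derivative (2 * c) * t / (t\<^sup>2 + E)) (at t)" for t
    unfolding H_def[abs_def] by (rule log_kernel_primitive[OF E])
  have b: "- ((2 * c) * t / (t\<^sup>2 + E)) - g t \<ge> 0" "- ((2 * c) * t / (t\<^sup>2 + E)) + g t \<ge> 0" if "t \<le> 0" for t
  proof -
    have "\<bar>g t\<bar> \<le> - ((2 * c) * t / (t\<^sup>2 + E))" using g[of t] that by simp
    then show "- ((2 * c) * t / (t\<^sup>2 + E)) - g t \<ge> 0" "- ((2 * c) * t / (t\<^sup>2 + E)) + g t \<ge> 0" by linarith+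
  qed
  have "- H (-R) - \<psi> (-R) \<le> - H 0 - \<psi> 0"
  proof (rule DERIV_nonneg_imp_nondecreasing[where f="\<lambda>t. - H t - \<psi> t"])
    show "\<exists>y. ((\<lambda>t. - H t - \<psi> t) has_real_derivative y) (at x) \<and> 0 \<le> y" if "-R \<le> x" "x \<le> 0" for x
      using DERIV_diff[OF DERIV_minus[OF dH] \<psi>(1), of x] b(1)[OF that(2)] by blast
  qed (use R in auto)
  moreover have "- H (-R) + \<psi> (-R) \<le> - H 0 + \<psi> 0"
  proof (rule DERIV_nonneg_imp_nondecreasing[where f="\<lambda>t. - H t + \<psi> t"])
    show "\<exists>y. ((\<lambda>t. - H t + \<psi> t) has_real_derivative y) (at x) \<and> 0 \<le> y" if "-R \<le> x" "x \<le> 0" for x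
      using DERIV_add[OF DERIV_minus[OF dH] \<psi>(1), of x] b(2)[OF that(2)] by blast
  qed (use R in auto)
  moreover have "H (-R) - H 0 = c * (ln (R\<^sup>2 + E) - ln E)" by (simp add: H_def algebra_simps)
  ultimately show ?thesis using \<psi>(2) by linarith
qed

text \<open>
  Both kinds of neurons live on one parameter box: \<open>b \<le> R\<close> carries the biased neurons with density
  \<open>A sin (k \<phi>) g b\<close>, and the strip \<open>R < b \<le> R + 1\<close> of width one carries the unbiased ones with density \<open>D\<close>.
\<close>

lemma barron_norm_angular_le:
  fixes g D :: "real \<Rightarrow> real" and f :: "real^2 \<Rightarrow> real"
  assumes R: "R > 0" and k: "k > 0" and g: "continuous_on UNIV g"
    and D [measurable]: "D \<in> borel_measurable borel" and B: "\<And>\<phi>. \<bar>D \<phi>\<bar> \<le> B"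
    and gI: "(\<integral>\<^sup>+t. ennreal \<bar>g t\<bar> * indicator {-R..R} t \<partial>lborel) \<le> ennreal G" and G: "G \<ge> 0"
    and f: "\<And>r \<theta> v. v \<in> half_disc R \<Longrightarrow> 0 < r \<Longrightarrow> r < R \<Longrightarrow> 0 < \<theta> \<Longrightarrow> \<theta> < pi \<Longrightarrow>
       v$1 = r * cos \<theta> \<Longrightarrow> v$2 = r * sin \<theta> \<Longrightarrow> arctan (v$1 / v$2) = pi / 2 - \<theta> \<Longrightarrow>
       f v = (LINT \<phi>:{0..2*pi}|lborel. A * sin (k * \<phi>) * (LINT b:{-R..R}|lborel. g b * max (r * cos (\<phi> - \<theta>) - b) 0 ^ k)
               + D \<phi> * max (r * cos (\<phi> - \<theta>)) 0 ^ k)"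
  shows "barron_norm (real k) (half_disc R) f \<le> ennreal ((1 + R) ^ k * (2 * pi) * (\<bar>A\<bar> * G + B))"
proof -
  have [measurable]: "g \<in> borel_measurable borel" using g by (rule borel_measurable_continuous_onI)
  define S where "S = {0..2*pi} \<times> {-R..R+1}"
  define a where "a t = (if snd t \<le> R then A * sin (k * fst t) * g (snd t) else D (fst t))" for t :: "real \<times> real"
  define w where "w t = (vector [cos (fst t), sin (fst t)] :: real^2)" for t :: "real \<times> real"
  define b where "b t = (if snd t \<le> R then - snd t else 0)" for t :: "real \<times> real"
  have S_cbox: "S = cbox (0, -R) (2*pi, R+1)" by (simp add: S_def cbox_Pair_eq)
  have [measurable]: "S \<in> sets borel" unfolding S_cbox by simp
  have eS: "emeasure lborel S = ennreal (2 * pi * (2 * R + 1))"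
    unfolding S_def lborel_prod[symmetric] using R
    by (simp add: lborel.emeasure_pair_measure_Times ennreal_mult)
  have am [measurable]: "a \<in> borel_measurable borel" unfolding a_def[abs_def] borel_prod[symmetric] by measurable
  have bm [measurable]: "b \<in> borel_measurable borel" unfolding b_def[abs_def] borel_prod[symmetric] by measurable
  have cw: "continuous_on UNIV w"
  proof -
    have "w = (\<lambda>t. \<chi> i. if i = 1 then cos (fst t) else sin (fst t))"
      by (auto simp: w_def vec_eq_iff forall_2 fun_eq_iff)
    moreover have "continuous_on UNIV (\<lambda>t::real \<times> real. if i = 1 then cos (fst t) else sin (fst t))" for i :: 2
      by (cases "i = 1") (auto intro!: continuous_intros)
    ultimately show ?thesis by (simp only: continuous_on_vec_lambda)
  qed
  have wm [measurable]: "w \<in> borel_measurable borel" using cw by (rule borel_measurable_continuous_onI)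
  have nw: "norm (w t) = 1" for t by (simp add: w_def norm_vec_def L2_set_def sum_2)
  \<comment> \<open>This bound serves integrability on the box and does not enter the cost, which
    sees the kernel only through \<open>G\<close>; so it may grow arbitrarily as \<epsilon> tends to
    0.\<close>
  obtain Gm where Gm: "\<And>t. t \<in> {-R..R} \<Longrightarrow> \<bar>g t\<bar> \<le> Gm"
  proof -
    have "compact (g ` {-R..R})" by (intro compact_continuous_image continuous_on_subset[OF g]) auto
    then have "bounded (g ` {-R..R})" by (rule compact_imp_bounded)
    then show thesis using that unfolding bounded_iff by (metis imageI real_norm_def)
  qed
  define am where "am = \<bar>A\<bar> * Gm + B"
  have B0: "B \<ge> 0" using B[of 0] by linarith
  have Gm0: "Gm \<ge> 0" using Gm[of 0] R by force
  have a_le: "\<bar>a t\<bar> \<le> am" if "t \<in> S" for t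
  proof (cases "snd t \<le> R")
    case True
    have "\<bar>a t\<bar> = \<bar>A\<bar> * \<bar>sin (k * fst t)\<bar> * \<bar>g (snd t)\<bar>" using True by (simp add: a_def abs_mult)
    also have "\<dots> \<le> \<bar>A\<bar> * 1 * Gm"
      using True that by (intro mult_mono mult_left_mono Gm) (auto simp: S_def)
    finally show ?thesis using B0 by (simp add: am_def)
  next
    case False
    then show ?thesis using B[of "fst t"] Gm0 by (simp add: a_def am_def add_increasing)
  qed
  have bS: "\<bar>b t\<bar> \<le> R" if "t \<in> S" for t using that R by (auto simp: b_def S_def)
  define N where "N v t = a t * relu_pow k (w t \<bullet> v + b t)" for v t
  have Nm [measurable]: "N v \<in> borel_measurable borel" for v
    unfolding N_def[abs_def] by measurable
  have Nint: "integrable lborel (\<lambda>t. indicator S t *\<^sub>R N v t)" if v: "v \<in> half_disc R" for v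
  proof (rule integrableI_bounded_set_indicator[where B = "am * (2 * R) ^ k"])
    have "norm (N v t) \<le> am * (2 * R) ^ k" if "t \<in> S" for t
    proof -
      have "w t \<bullet> v + b t \<le> norm (w t) * norm v + R"
        using bS[OF that] norm_cauchy_schwarz[of "w t" v] by linarith
      also have "\<dots> \<le> 2 * R" using half_discD(2)[OF v R] by (simp add: nw)
      finally have "max (w t \<bullet> v + b t) 0 ^ k \<le> (2 * R) ^ k" using R by (intro power_mono) auto
      then have "\<bar>a t\<bar> * max (w t \<bullet> v + b t) 0 ^ k \<le> am * (2 * R) ^ k"
        using a_le[OF that] by (intro mult_mono) auto
      then show ?thesis using k by (simp add: N_def relu_pow_of_nat abs_mult)
    qed
    then show "AE t in lborel. t \<in> S \<longrightarrow> norm (N v t) \<le> am * (2 * R) ^ k" by simp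
  qed (use eS in auto)
  have "barron_norm (real k) (half_disc R) f \<le> (\<integral>\<^sup>+t. ennreal (\<bar>a t\<bar> * (norm (w t) + \<bar>b t\<bar>) powr real k) * indicator S t \<partial>lborel)"
  proof (rule barron_norm_le_set_integral[where m = "2 * pi * (2 * R + 1)"])
    fix v :: "real^2" assume v: "v \<in> half_disc R"
    show "set_integrable lborel S (\<lambda>t. a t * relu_pow (real k) (w t \<bullet> v + b t))"
      using Nint[OF v] unfolding set_integrable_def N_def .
    obtain r \<theta> where p: "0 < r" "r < R" "0 < \<theta>" "\<theta> < pi" "v$1 = r * cos \<theta>" "v$2 = r * sin \<theta>"
      "arctan (v$1 / v$2) = pi / 2 - \<theta>"
      using half_disc_polar[OF v R] by blast
    define \<tau> where "\<tau> \<phi> = r * cos (\<phi> - \<theta>)" for \<phi> :: real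
    have w\<tau>: "w (\<phi>, b') \<bullet> v = \<tau> \<phi>" for \<phi> b'
      using p by (simp add: w_def inner_vec_def sum_2 \<tau>_def cos_diff algebra_simps)
    have inner: "(LINT b':{-R..R+1}|lborel. N v (\<phi>, b')) =
        A * sin (k * \<phi>) * (LINT b':{-R..R}|lborel. g b' * max (\<tau> \<phi> - b') 0 ^ k) + D \<phi> * max (\<tau> \<phi>) 0 ^ k" for \<phi> :: real
    proof -
      have 1: "N v (\<phi>, b') = A * sin (k * \<phi>) * (g b' * max (\<tau> \<phi> - b') 0 ^ k)" if "b' \<in> {-R..R}" for b'
        using that k by (simp add: N_def w\<tau> relu_pow_of_nat a_def b_def)
      have 2: "N v (\<phi>, b') = D \<phi> * max (\<tau> \<phi>) 0 ^ k" if "b' \<in> {R<..R+1}" for b'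
        using that k by (simp add: N_def w\<tau> relu_pow_of_nat a_def b_def)
      have c: "continuous_on UNIV (\<lambda>b'. g b' * max (\<tau> \<phi> - b') 0 ^ k)" by (intro continuous_intros g)
      have i1: "set_integrable lborel {-R..R} (\<lambda>b'. N v (\<phi>, b'))"
        using set_integral_continuous(1)[OF c, of "-R" R, THEN set_integrable_mult_right, of "A * sin (k * \<phi>)"]
        by (subst set_integrable_cong[OF refl refl 1]) auto
      have i2: "set_integrable lborel {R<..R+1} (\<lambda>b'. N v (\<phi>, b'))"
        by (subst set_integrable_cong[OF refl refl 2]) (auto simp: set_integrable_def)
      have "{-R..R+1} = {-R..R} \<union> {R<..R+1}" using R by auto
      then have "(LINT b':{-R..R+1}|lborel. N v (\<phi>, b')) = (LINT b':{-R..R}|lborel. N v (\<phi>, b')) + (LINT b':{R<..R+1}|lborel. N v (\<phi>, b'))"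
        using i1 i2 by (simp only:) (subst set_integral_Un, auto)
      also have "(LINT b':{-R..R}|lborel. N v (\<phi>, b')) = (LINT b':{-R..R}|lborel. A * sin (k * \<phi>) * (g b' * max (\<tau> \<phi> - b') 0 ^ k))"
        by (rule set_lebesgue_integral_cong) (use 1 in auto)
      also have "\<dots> = A * sin (k * \<phi>) * (LINT b':{-R..R}|lborel. g b' * max (\<tau> \<phi> - b') 0 ^ k)"
        by simp
      also have "(LINT b':{R<..R+1}|lborel. N v (\<phi>, b')) = (LINT b':{R<..R+1}|lborel. D \<phi> * max (\<tau> \<phi>) 0 ^ k)"
        by (rule set_lebesgue_integral_cong) (use 2 in auto)
      also have "\<dots> = D \<phi> * max (\<tau> \<phi>) 0 ^ k"
        by (simp add: set_lebesgue_integral_def)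
      finally show ?thesis .
    qed
    have "(LINT t:S|lborel. a t * relu_pow (real k) (w t \<bullet> v + b t)) = integral\<^sup>L (lborel \<Otimes>\<^sub>M lborel) (\<lambda>t. indicator S t *\<^sub>R N v t)"
      by (simp add: set_lebesgue_integral_def N_def lborel_prod)
    also have "\<dots> = (LINT \<phi>|lborel. LINT b'|lborel. indicator S (\<phi>, b') *\<^sub>R N v (\<phi>, b'))"
      by (rule lborel_pair.integral_fst'[symmetric]) (use Nint[OF v] in \<open>simp add: lborel_prod\<close>)
    also have "\<dots> = (LINT \<phi>:{0..2*pi}|lborel. LINT b':{-R..R+1}|lborel. N v (\<phi>, b'))"
      unfolding set_lebesgue_integral_def
      by (intro Bochner_Integration.integral_cong refl) (auto simp: S_def indicator_def)
    also have "\<dots> = f v"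
      unfolding inner using f[OF v p] by (simp add: \<tau>_def)
    finally show "f v = (LINT t:S|lborel. a t * relu_pow (real k) (w t \<bullet> v + b t))" by simp
  qed (use eS R in auto)
  also have "\<dots> \<le> (\<integral>\<^sup>+t. ennreal ((1 + R) ^ k) * (indicator {0..2*pi} (fst t) * (ennreal (\<bar>A\<bar> * \<bar>g (snd t)\<bar>) * indicator {-R..R} (snd t) + ennreal B * indicator {R<..R+1} (snd t))) \<partial>lborel)"
  proof (rule nn_integral_mono)
    fix t :: "real \<times> real"
    show "ennreal (\<bar>a t\<bar> * (norm (w t) + \<bar>b t\<bar>) powr real k) * indicator S t
      \<le> ennreal ((1 + R) ^ k) * (indicator {0..2*pi} (fst t) * (ennreal (\<bar>A\<bar> * \<bar>g (snd t)\<bar>) * indicator {-R..R} (snd t) + ennreal B * indicator {R<..R+1} (snd t)))"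
    proof (cases "t \<in> S")
      case True
      \<comment> \<open>The weight vector has norm 1 and the bias at most R, whence the factor (1 +
        R)^k.\<close>
      have pw: "(norm (w t) + \<bar>b t\<bar>) powr real k \<le> (1 + R) ^ k"
        using bS[OF True] unfolding nw by (subst powr_realpow) (auto intro!: power_mono)
      define X where "X = (if snd t \<le> R then \<bar>A\<bar> * \<bar>g (snd t)\<bar> else B)"
      have "\<bar>a t\<bar> \<le> X"
      proof (cases "snd t \<le> R")
        case le: True
        have "\<bar>A\<bar> * \<bar>sin (k * fst t)\<bar> * \<bar>g (snd t)\<bar> \<le> \<bar>A\<bar> * 1 * \<bar>g (snd t)\<bar>"
          by (intro mult_right_mono mult_left_mono) auto
        then show ?thesis using le by (simp add: a_def X_def abs_mult)
      qed (use B in \<open>simp add: a_def X_def\<close>)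
      then have "\<bar>a t\<bar> * (norm (w t) + \<bar>b t\<bar>) powr real k \<le> X * (1 + R) ^ k"
        using pw by (intro mult_mono) auto
      then have "ennreal (\<bar>a t\<bar> * (norm (w t) + \<bar>b t\<bar>) powr real k) \<le> ennreal (X * (1 + R) ^ k)" by (rule ennreal_leI)
      also have "\<dots> = ennreal ((1 + R) ^ k) * ennreal X"
        using R by (subst ennreal_mult''[symmetric]) (auto simp: X_def B0 mult.commute)
      finally show ?thesis using True by (auto simp: S_def X_def indicator_def)
    qed auto
  qed
  also have "\<dots> = ennreal ((1 + R) ^ k) * (\<integral>\<^sup>+t. indicator {0..2*pi} (fst t) * (ennreal (\<bar>A\<bar> * \<bar>g (snd t)\<bar>) * indicator {-R..R} (snd t) + ennreal B * indicator {R<..R+1} (snd t)) \<partial>(lborel \<Otimes>\<^sub>M lborel))"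
    unfolding lborel_prod[symmetric] by (rule nn_integral_cmult) measurable
  also have "(\<integral>\<^sup>+t. indicator {0..2*pi} (fst t) * (ennreal (\<bar>A\<bar> * \<bar>g (snd t)\<bar>) * indicator {-R..R} (snd t) + ennreal B * indicator {R<..R+1} (snd t)) \<partial>(lborel \<Otimes>\<^sub>M lborel))
     = (\<integral>\<^sup>+\<phi>. \<integral>\<^sup>+s. indicator {0..2*pi} \<phi> * (ennreal (\<bar>A\<bar> * \<bar>g s\<bar>) * indicator {-R..R} s + ennreal B * indicator {R<..R+1} s) \<partial>lborel \<partial>lborel)"
    by (subst lborel.nn_integral_fst[symmetric]) auto
  also have "\<dots> = (\<integral>\<^sup>+\<phi>. indicator {0..2*pi} \<phi> * (ennreal \<bar>A\<bar> * (\<integral>\<^sup>+s. ennreal \<bar>g s\<bar> * indicator {-R..R} s \<partial>lborel) + ennreal B) \<partial>lborel)"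
  proof (intro nn_integral_cong)
    fix \<phi> :: real
    have "(\<integral>\<^sup>+s. indicator {0..2*pi} \<phi> * (ennreal (\<bar>A\<bar> * \<bar>g s\<bar>) * indicator {-R..R} s + ennreal B * indicator {R<..R+1} s) \<partial>lborel)
      = indicator {0..2*pi} \<phi> * (\<integral>\<^sup>+s. ennreal \<bar>A\<bar> * (ennreal \<bar>g s\<bar> * indicator {-R..R} s) + ennreal B * indicator {R<..R+1} s \<partial>lborel)"
      by (subst nn_integral_cmult[symmetric]) (auto simp: ennreal_mult mult.assoc)
    also have "(\<integral>\<^sup>+s. ennreal \<bar>A\<bar> * (ennreal \<bar>g s\<bar> * indicator {-R..R} s) + ennreal B * indicator {R<..R+1} s \<partial>lborel)
      = ennreal \<bar>A\<bar> * (\<integral>\<^sup>+s. ennreal \<bar>g s\<bar> * indicator {-R..R} s \<partial>lborel) + ennreal B"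
      by (subst nn_integral_add) (auto simp: nn_integral_cmult nn_integral_cmult_indicator)
    finally show "(\<integral>\<^sup>+s. indicator {0..2*pi} \<phi> * (ennreal (\<bar>A\<bar> * \<bar>g s\<bar>) * indicator {-R..R} s + ennreal B * indicator {R<..R+1} s) \<partial>lborel)
      = indicator {0..2*pi} \<phi> * (ennreal \<bar>A\<bar> * (\<integral>\<^sup>+s. ennreal \<bar>g s\<bar> * indicator {-R..R} s \<partial>lborel) + ennreal B)" .
  qed
  also have "\<dots> = ennreal (2 * pi) * (ennreal \<bar>A\<bar> * (\<integral>\<^sup>+s. ennreal \<bar>g s\<bar> * indicator {-R..R} s \<partial>lborel) + ennreal B)"
    by (subst nn_integral_multc) auto
  also have "ennreal ((1 + R) ^ k) * (ennreal (2 * pi) * (ennreal \<bar>A\<bar> * (\<integral>\<^sup>+s. ennreal \<bar>g s\<bar> * indicator {-R..R} s \<partial>lborel) + ennreal B))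
     \<le> ennreal ((1 + R) ^ k) * (ennreal (2 * pi) * (ennreal \<bar>A\<bar> * ennreal G + ennreal B))"
    by (intro mult_left_mono add_right_mono gI) auto
  also have "\<dots> = ennreal ((1 + R) ^ k * (2 * pi) * (\<bar>A\<bar> * G + B))"
  proof -
    have "ennreal (\<bar>A\<bar> * G + B) = ennreal \<bar>A\<bar> * ennreal G + ennreal B"
      using G B0 by (simp add: ennreal_mult)
    moreover have "ennreal (x * y * z) = ennreal x * (ennreal y * ennreal z)" if "x \<ge> 0" "y \<ge> 0" "z \<ge> 0" for x y z
      using that by (simp add: ennreal_mult mult.assoc)
    ultimately show ?thesis using R G B0 by simp
  qed
  finally show ?thesis .
qed

text \<open>The representation of the logarithm brings along a multiple of r^k sin (k \<theta>).
  That term is representable without bias, so \<kappa> times its density is added to the angular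
  density; its cost is acceptable because \<kappa> is of order \<bar>ln \<epsilon>\<bar>.\<close>

lemma barron_norm_u_fun_le:
  assumes R: "R > 0" and k: "k \<ge> 2"
  shows "\<exists>C>0. \<forall>\<epsilon>\<in>{0<..<1/2}. barron_norm (real k) (half_disc R) (u_fun \<epsilon> k) \<le> ennreal (C * \<bar>ln \<epsilon>\<bar>)"
proof -
  have k0: "k > 0" using k by simp
  have "angular_rep k (\<lambda>\<theta>. cos (k * \<theta>) + (- 1 / pi) * (\<theta> * cos (k * \<theta>)))"
    using k0 by (intro angular_rep_add angular_rep_cmult angular_rep_theta_cos angular_rep_sin_cos_nat) auto
  then obtain D0 B0 where D0 [measurable]: "D0 \<in> borel_measurable borel" and B0: "\<And>\<phi>. \<bar>D0 \<phi>\<bar> \<le> B0"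
    and I0: "\<And>\<theta>::real. \<theta> \<in> {0<..<pi} \<Longrightarrow> (LINT \<phi>:{0..2*pi}|lborel. D0 \<phi> * max (cos (\<phi> - \<theta>)) 0 ^ k) = cos (k * \<theta>) + (- 1 / pi) * (\<theta> * cos (k * \<theta>))"
    by (rule angular_repE) (rule that)
  have "angular_rep k (\<lambda>\<theta>. sin (k * \<theta>))"
    using k0 by (intro angular_rep_sin_cos_nat) auto
  then obtain Ds Bs where Ds [measurable]: "Ds \<in> borel_measurable borel" and Bs: "\<And>\<phi>. \<bar>Ds \<phi>\<bar> \<le> Bs"
    and Is: "\<And>\<theta>::real. \<theta> \<in> {0<..<pi} \<Longrightarrow> (LINT \<phi>:{0..2*pi}|lborel. Ds \<phi> * max (cos (\<phi> - \<theta>)) 0 ^ k) = sin (k * \<theta>)"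
    by (rule angular_repE) (rule that)
  have B0': "B0 \<ge> 0" and Bs': "Bs \<ge> 0" using B0[of 0] Bs[of 0] by linarith+
  define W where "W = sin_moment k"
  define W' where "W' = sin_cos_moment k"
  define c where "c = chebyshev_const k"
  have W: "W > 0" and W': "W' > 0" and c: "c > 0"
    unfolding W_def W'_def c_def by (rule sin_moment_pos sin_cos_moment_pos chebyshev_const_pos)+
  \<comment> \<open>Chosen so that A k! c W' / 2 = - 1 / (2 pi), the coefficient of the logarithm in
    u.\<close>
  define A where "A = - 1 / (pi * W' * c * fact k)"
  \<comment> \<open>The 2 comes from ln E = 2 ln \<epsilon>; the quotient absorbs ln (R^2 + 1) by
    means of \<bar>ln \<epsilon>\<bar> \<ge> ln 2.\<close>
  define \<Lambda> where "\<Lambda> = 2 + ln (R\<^sup>2 + 1) / ln 2"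
  have \<Lambda>: "\<Lambda> \<ge> 2" unfolding \<Lambda>_def by simp
  define C where "C = (1 + R) ^ k * (2 * pi) * (\<bar>A\<bar> * (2 * (k + 1) * \<Lambda>) + (B0 / ln 2 + (1 + W * (k + 1) * \<Lambda> / W') * Bs))"
  have bound: "barron_norm (real k) (half_disc R) (u_fun \<epsilon> k) \<le> ennreal (C * \<bar>ln \<epsilon>\<bar>)" if \<epsilon>: "\<epsilon> \<in> {0<..<1/2}" for \<epsilon> :: real
  proof -
    define E where "E = \<epsilon>\<^sup>2"
    have E: "E > 0" using \<epsilon> by (simp add: E_def)
    have E1: "E \<le> 1" using \<epsilon> by (simp add: E_def power_le_one)
    have lnE: "ln E = 2 * ln \<epsilon>" using \<epsilon> by (simp add: E_def ln_realpow)
    have lne: "ln \<epsilon> \<le> - ln 2" using \<epsilon> ln_le_cancel_iff[of \<epsilon> "1/2"] by (auto simp: ln_div)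
    have l2: "ln (2::real) > 0" by simp
    then have lna: "\<bar>ln \<epsilon>\<bar> = - ln \<epsilon>" "\<bar>ln \<epsilon>\<bar> \<ge> ln 2" using lne by linarith+
    define lam where "lam = ln (R\<^sup>2 + E) - ln E"
    have lam: "lam \<le> \<Lambda> * \<bar>ln \<epsilon>\<bar>" "lam \<ge> 0"
    proof -
      have "ln (R\<^sup>2 + E) \<le> ln (R\<^sup>2 + 1)" using R E E1 by (subst ln_le_cancel_iff) (auto simp: add_pos_pos)
      moreover have "ln (R\<^sup>2 + 1) \<le> ln (R\<^sup>2 + 1) / ln 2 * \<bar>ln \<epsilon>\<bar>"
      proof -
        have "ln (R\<^sup>2 + 1) * ln 2 \<le> ln (R\<^sup>2 + 1) * \<bar>ln \<epsilon>\<bar>" using lna by (intro mult_left_mono) auto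
        then show ?thesis using l2 by (simp add: field_simps)
      qed
      ultimately show "lam \<le> \<Lambda> * \<bar>ln \<epsilon>\<bar>"
        unfolding lam_def \<Lambda>_def distrib_right lnE using lna by linarith
      have "ln E \<le> ln (R\<^sup>2 + E)" using R E by (subst ln_le_cancel_iff) (auto simp: add_pos_pos)
      then show "lam \<ge> 0" by (simp add: lam_def)
    qed
    obtain F where F: "\<And>j (t::real). j \<le> k \<Longrightarrow> (F j has_real_derivative F (Suc j) t) (at t)"
      "\<And>j. j \<le> k \<Longrightarrow> F j (-R) = 0" "continuous_on UNIV (F (Suc k))"
      and Fb: "\<And>t::real. \<bar>F (Suc k) t\<bar> \<le> (2 * k + 2) * \<bar>t\<bar> / (t\<^sup>2 + E)"
      and FI: "\<And>r \<theta>::real. integral {0..2*pi} (\<lambda>\<phi>. sin (k * \<phi>) * F 0 (r * cos (\<phi> - \<theta>)))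
       = c * (r ^ k * sin (k * \<theta>)) * (W * F k 0 + W' / 2 * (ln (r\<^sup>2 + E) - ln E))"
      by (rule log_representation[OF E, of k "-R", folded W_def W'_def c_def]) (rule that)
    have Fb': "\<bar>F (Suc k) t\<bar> \<le> (2 * real (k + 1)) * \<bar>t\<bar> / (t\<^sup>2 + E)" for t :: real
      using Fb[of t] by (simp add: algebra_simps)
    \<comment> \<open>Minus the coefficient of r^k sin (k \<theta>) that is left over once ln (r^2 +
      E) has its correct factor: ln E / (2 pi) from the normalisation of the logarithm at r = 0, and
      - W F k 0 / (pi W') from the base point -R.\<close>
    define \<kappa> where "\<kappa> = - 1 / (2 * pi) * (ln E - 2 * W * F k 0 / W')"
    have Fk: "\<bar>F k 0\<bar> \<le> real (k + 1) * lam"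
      unfolding lam_def using R by (intro abs_log_kernel_primitive_le[OF E _ Fb']) (auto intro: F)
    have \<kappa>: "\<bar>\<kappa>\<bar> \<le> (1 + W * real (k + 1) * \<Lambda> / W') * \<bar>ln \<epsilon>\<bar>"
    proof -
      have "\<bar>\<kappa>\<bar> = 1 / (2 * pi) * \<bar>ln E - 2 * W * F k 0 / W'\<bar>" by (simp add: \<kappa>_def abs_mult)
      also have "\<dots> \<le> 1 / 2 * \<bar>ln E - 2 * W * F k 0 / W'\<bar>"
        using pi_gt3 by (intro mult_right_mono) (auto simp: field_simps)
      also have "\<bar>ln E - 2 * W * F k 0 / W'\<bar> \<le> \<bar>ln E\<bar> + \<bar>2 * W * F k 0 / W'\<bar>" by (rule abs_triangle_ineq4)
      also have "\<bar>ln E\<bar> = 2 * \<bar>ln \<epsilon>\<bar>" by (simp add: lnE abs_mult)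
      also have "\<bar>2 * W * F k 0 / W'\<bar> = 2 * W / W' * \<bar>F k 0\<bar>" using W W' by (simp add: abs_mult)
      also have "1 / 2 * (2 * \<bar>ln \<epsilon>\<bar> + 2 * W / W' * \<bar>F k 0\<bar>) \<le> 1 / 2 * (2 * \<bar>ln \<epsilon>\<bar> + 2 * W / W' * (real (k + 1) * (\<Lambda> * \<bar>ln \<epsilon>\<bar>)))"
      proof (intro mult_left_mono add_left_mono)
        have "real (k + 1) * lam \<le> real (k + 1) * (\<Lambda> * \<bar>ln \<epsilon>\<bar>)" using lam(1) by (rule mult_left_mono) simp
        with Fk show "\<bar>F k 0\<bar> \<le> real (k + 1) * (\<Lambda> * \<bar>ln \<epsilon>\<bar>)" by (rule order_trans)
      qed (use W W' in auto)
      also have "\<dots> = (1 + W * real (k + 1) * \<Lambda> / W') * \<bar>ln \<epsilon>\<bar>"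
      proof -
        have "1 / 2 * (2 * l + 2 * a / b * (n * (m * l))) = (1 + a * n * m / b) * l" for l a b n m :: real
          by (simp add: distrib_right)
        then show ?thesis .
      qed
      finally show ?thesis by simp
    qed
    define D where "D \<phi> = D0 \<phi> + \<kappa> * Ds \<phi>" for \<phi> :: real
    define B where "B = B0 + \<bar>\<kappa>\<bar> * Bs"
    have Dm: "D \<in> borel_measurable borel" unfolding D_def[abs_def] by measurable
    have DB: "\<bar>D \<phi>\<bar> \<le> B" for \<phi> :: real
    proof -
      have "\<bar>D \<phi>\<bar> \<le> \<bar>D0 \<phi>\<bar> + \<bar>\<kappa>\<bar> * \<bar>Ds \<phi>\<bar>" unfolding D_def by (rule order_trans[OF abs_triangle_ineq]) (simp add: abs_mult)
      also have "\<dots> \<le> B0 + \<bar>\<kappa>\<bar> * Bs" by (intro add_mono mult_left_mono B0 Bs) auto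
      finally show ?thesis by (simp add: B_def)
    qed
    have "barron_norm (real k) (half_disc R) (u_fun \<epsilon> k) \<le> ennreal ((1 + R) ^ k * (2 * pi) * (\<bar>A\<bar> * (2 * real (k + 1) * lam) + B))"
    proof (rule barron_norm_angular_le[OF R k0 F(3) Dm DB])
      show "(\<integral>\<^sup>+t. ennreal \<bar>F (Suc k) t\<bar> * indicator {-R..R} t \<partial>lborel) \<le> ennreal (2 * real (k + 1) * lam)"
        unfolding lam_def using R by (intro nn_integral_log_kernel_le[OF E _ _ Fb']) auto
      show "0 \<le> 2 * real (k + 1) * lam" using lam by simp
      fix r \<theta> :: real and v :: "real^2"
      assume p: "v \<in> half_disc R" "0 < r" "r < R" "0 < \<theta>" "\<theta> < pi" "v$1 = r * cos \<theta>" "v$2 = r * sin \<theta>" "arctan (v$1 / v$2) = pi / 2 - \<theta>"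
      have th: "\<theta> \<in> {0<..<pi}" using p by simp
      have \<tau>: "-R \<le> r * cos x" "r * cos x \<le> R" for x :: real
      proof -
        have "\<bar>r * cos x\<bar> \<le> r * 1" unfolding abs_mult using p by (intro mult_mono) auto
        then show "-R \<le> r * cos x" "r * cos x \<le> R" using p by linarith+
      qed
      have inner: "(LINT b:{-R..R}|lborel. F (Suc k) b * max (r * cos (\<phi> - \<theta>) - b) 0 ^ k) = fact k * F 0 (r * cos (\<phi> - \<theta>))" for \<phi> :: real
        by (rule ridge_representation(2)[OF F k0 \<tau>])
      have mx: "max (r * x) 0 ^ k = r ^ k * max x 0 ^ k" for x :: real
        using p by (simp add: max_mult_distrib_left flip: power_mult_distrib)
      have cF0: "continuous_on UNIV (F 0)"
        using F(1)[of 0] by (intro DERIV_continuous_on) (auto intro: DERIV_subset)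
      have cS: "continuous_on UNIV (\<lambda>\<phi>::real. sin (k * \<phi>) * F 0 (r * cos (\<phi> - \<theta>)))"
        by (intro continuous_intros continuous_on_compose2[OF cF0]) auto
      note sS = set_integral_continuous[OF cS, of 0 "2*pi"]
      have s0: "set_integrable lborel {0..2*pi} (\<lambda>\<phi>. r ^ k * (D0 \<phi> * max (cos (\<phi> - \<theta>)) 0 ^ k))"
        by (intro set_integrable_mult_right set_integrable_angular[OF D0 B0])
      have s1: "set_integrable lborel {0..2*pi} (\<lambda>\<phi>. r ^ k * \<kappa> * (Ds \<phi> * max (cos (\<phi> - \<theta>)) 0 ^ k))"
        by (intro set_integrable_mult_right set_integrable_angular[OF Ds Bs])
      have "(LINT \<phi>:{0..2*pi}|lborel. A * sin (k * \<phi>) * (LINT b:{-R..R}|lborel. F (Suc k) b * max (r * cos (\<phi> - \<theta>) - b) 0 ^ k)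
               + D \<phi> * max (r * cos (\<phi> - \<theta>)) 0 ^ k)
        = (LINT \<phi>:{0..2*pi}|lborel. A * fact k * (sin (k * \<phi>) * F 0 (r * cos (\<phi> - \<theta>))) +
            (r ^ k * (D0 \<phi> * max (cos (\<phi> - \<theta>)) 0 ^ k) + r ^ k * \<kappa> * (Ds \<phi> * max (cos (\<phi> - \<theta>)) 0 ^ k)))"
        unfolding inner mx D_def by (intro arg_cong[where f="set_lebesgue_integral lborel _"] ext) (simp add: algebra_simps)
      also have "\<dots> = A * fact k * (LINT \<phi>:{0..2*pi}|lborel. sin (k * \<phi>) * F 0 (r * cos (\<phi> - \<theta>))) +
          (r ^ k * (LINT \<phi>:{0..2*pi}|lborel. D0 \<phi> * max (cos (\<phi> - \<theta>)) 0 ^ k) + r ^ k * \<kappa> * (LINT \<phi>:{0..2*pi}|lborel. Ds \<phi> * max (cos (\<phi> - \<theta>)) 0 ^ k))"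
        using s0 s1 sS(1)[THEN set_integrable_mult_right, of "A * fact k"]
        by (simp only: set_integral_add set_integral_mult_right)
      also have "\<dots> = A * fact k * (c * (r ^ k * sin (k * \<theta>)) * (W * F k 0 + W' / 2 * (ln (r\<^sup>2 + E) - ln E)))
          + (r ^ k * (cos (k * \<theta>) + (- 1 / pi) * (\<theta> * cos (k * \<theta>))) + r ^ k * \<kappa> * sin (k * \<theta>))"
        unfolding I0[OF th] Is[OF th] sS(2) FI ..
      also have "A * fact k * (c * (r ^ k * sin (k * \<theta>)) * (W * F k 0 + W' / 2 * (ln (r\<^sup>2 + E) - ln E)))
         = - (r ^ k * \<kappa> * sin (k * \<theta>)) - 1 / (2 * pi) * (r ^ k * sin (k * \<theta>) * ln (r\<^sup>2 + E))"
      proof -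
        have Afk: "A * fact k = - 1 / (pi * W' * c)" by (simp add: A_def)
        have "- 1 / (pi * w * d) * (d * s * (a + w / 2 * (l - e))) = - (s * (- 1 / (2 * pi) * (e - 2 * a / w))) - 1 / (2 * pi) * (s * l)"
          if "w > 0" "d > 0" for w d s a l e :: real
          using that by (simp add: field_simps)
        from this[OF W' c, of "r ^ k * sin (k * \<theta>)" "W * F k 0" "ln (r\<^sup>2 + E)" "ln E"]
        show ?thesis unfolding Afk \<kappa>_def by (simp only: mult_ac)
      qed
      also have "\<dots> + (r ^ k * (cos (k * \<theta>) + (- 1 / pi) * (\<theta> * cos (k * \<theta>))) + r ^ k * \<kappa> * sin (k * \<theta>)) = u_fun \<epsilon> k v"
        unfolding u_fun_polar[OF p(6-8)] E_def by linarith
      finally show "u_fun \<epsilon> k v = (LINT \<phi>:{0..2*pi}|lborel. A * sin (k * \<phi>) * (LINT b:{-R..R}|lborel. F (Suc k) b * max (r * cos (\<phi> - \<theta>) - b) 0 ^ k)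
               + D \<phi> * max (r * cos (\<phi> - \<theta>)) 0 ^ k)" ..
    qed
    also have "\<dots> \<le> ennreal (C * \<bar>ln \<epsilon>\<bar>)"
    proof (rule ennreal_leI)
      have "2 * real (k + 1) * lam \<le> 2 * real (k + 1) * \<Lambda> * \<bar>ln \<epsilon>\<bar>"
        using lam(1) by (simp add: mult.assoc)
      then have 1: "\<bar>A\<bar> * (2 * real (k + 1) * lam) \<le> \<bar>A\<bar> * (2 * real (k + 1) * \<Lambda> * \<bar>ln \<epsilon>\<bar>)" by (rule mult_left_mono) simp
      have "B0 * ln 2 \<le> B0 * \<bar>ln \<epsilon>\<bar>" using lna B0' by (intro mult_left_mono) auto
      then have 2: "B0 \<le> B0 / ln 2 * \<bar>ln \<epsilon>\<bar>" using l2 by (simp add: field_simps)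
      have 3: "\<bar>\<kappa>\<bar> * Bs \<le> (1 + W * real (k + 1) * \<Lambda> / W') * \<bar>ln \<epsilon>\<bar> * Bs" using \<kappa> Bs' by (rule mult_right_mono)
      have "\<bar>A\<bar> * (2 * real (k + 1) * lam) + B \<le> \<bar>A\<bar> * (2 * real (k + 1) * \<Lambda> * \<bar>ln \<epsilon>\<bar>) + (B0 / ln 2 * \<bar>ln \<epsilon>\<bar> + (1 + W * real (k + 1) * \<Lambda> / W') * \<bar>ln \<epsilon>\<bar> * Bs)"
        unfolding B_def using 1 2 3 by linarith
      also have "\<dots> = (\<bar>A\<bar> * (2 * real (k + 1) * \<Lambda>) + (B0 / ln 2 + (1 + W * real (k + 1) * \<Lambda> / W') * Bs)) * \<bar>ln \<epsilon>\<bar>"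
      proof -
        have "a * (b * l) + (d * l + e * l * f) = (a * b + (d + e * f)) * l" for a b d e f l :: real by (simp add: algebra_simps)
        then show ?thesis .
      qed
      finally have "(1 + R) ^ k * (2 * pi) * (\<bar>A\<bar> * (2 * real (k + 1) * lam) + B) \<le> (1 + R) ^ k * (2 * pi) * ((\<bar>A\<bar> * (2 * real (k + 1) * \<Lambda>) + (B0 / ln 2 + (1 + W * real (k + 1) * \<Lambda> / W') * Bs)) * \<bar>ln \<epsilon>\<bar>)"
        using R by (intro mult_left_mono) auto
      also have "\<dots> = C * \<bar>ln \<epsilon>\<bar>" by (simp only: C_def mult.assoc of_nat_mult of_nat_numeral)
      finally show "(1 + R) ^ k * (2 * pi) * (\<bar>A\<bar> * (2 * real (k + 1) * lam) + B) \<le> C * \<bar>ln \<epsilon>\<bar>" .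
    qed
    finally show ?thesis .
  qed
  have "A \<noteq> 0" using W' c by (simp add: A_def)
  moreover have "W * real (k + 1) * \<Lambda> / W' \<ge> 0" using W W' \<Lambda> by simp
  then have "1 + W * real (k + 1) * \<Lambda> / W' \<ge> 0" by linarith
  ultimately have "C > 0"
    unfolding C_def using R \<Lambda> B0' Bs' by (intro mult_pos_pos add_pos_nonneg add_nonneg_nonneg[of "B0 / ln 2"] mult_nonneg_nonneg) auto
  with bound show ?thesis by blast
qed

theorem theorem3p11:
  fixes R :: real and k :: nat
  assumes "R > 0" and "k \<ge> 2"
  shows "\<exists>\<epsilon>0>0.
    (\<exists>C>0. \<forall>\<epsilon>\<in>{0<..<\<epsilon>0}.
        barron_norm (real k) (half_disc R) (u_fun \<epsilon> k) \<le> ennreal (C * \<bar>ln \<epsilon>\<bar>)) \<and>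
    (\<exists>c>0. \<exists>C>0. \<exists>\<epsilon>1\<in>{0<..\<epsilon>0}. \<forall>p::ennreal. 1 \<le> p \<longrightarrow> (\<forall>\<epsilon>\<in>{0<..<\<epsilon>1}.
        ennreal (c * R ^ (k - 2) * \<epsilon>\<^sup>2) \<le> Lp_norm p (half_disc R) (u_diff \<epsilon> k) \<and>
        Lp_norm p (half_disc R) (u_diff \<epsilon> k) \<le> ennreal (C * R ^ (k - 2) * \<epsilon>\<^sup>2))) \<and>
    (\<exists>C>0. \<forall>p::ennreal. 1 \<le> p \<longrightarrow> (\<forall>\<epsilon>\<in>{0<..<\<epsilon>0}.
        Lp_norm p (half_disc R) (grad (u_diff \<epsilon> k)) \<le> ennreal (C * \<epsilon> powr enn2real (2 / p)))) \<and>
    (\<forall>p::ennreal. 1 \<le> p \<longrightarrow> (\<exists>C>0. \<forall>\<epsilon>\<in>{0<..<\<epsilon>0}.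
        (k > 2 \<or> (1 < p \<and> p < \<infinity>) \<longrightarrow>
           Lp_norm p (half_disc R) (hessian (u_diff \<epsilon> k)) \<le> ennreal (C * \<epsilon> powr enn2real (2 / p))) \<and>
        (k = 2 \<and> p = 1 \<longrightarrow>
           Lp_norm p (half_disc R) (hessian (u_diff \<epsilon> k)) \<le> ennreal (C * \<epsilon>\<^sup>2 * \<bar>ln \<epsilon>\<bar>))))"
proof -
  obtain c C2 where 2: "c > 0" "C2 > 0" "\<forall>p::ennreal. 1 \<le> p \<longrightarrow> (\<forall>\<epsilon>\<in>{0<..<1/2}.
        ennreal (c * R ^ (k - 2) * \<epsilon>\<^sup>2) \<le> Lp_norm p (half_disc R) (u_diff \<epsilon> k) \<and>
        Lp_norm p (half_disc R) (u_diff \<epsilon> k) \<le> ennreal (C2 * R ^ (k - 2) * \<epsilon>\<^sup>2))"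
    using Lp_norm_u_diff_bounds[OF assms] by blast
  show ?thesis
  \<comment> \<open>Below 1/2 the modulus of ln \<epsilon> exceeds ln 2, so bounded costs are
    absorbed into multiples of it. The two-sided estimate holds on the same range, which is why
    \<epsilon>1 is 1/2 as well.\<close>
  proof (rule exI[of _ "1/2"], intro conjI)
    show "\<exists>c>0. \<exists>C>0. \<exists>\<epsilon>1\<in>{0<..1/2}. \<forall>p::ennreal. 1 \<le> p \<longrightarrow> (\<forall>\<epsilon>\<in>{0<..<\<epsilon>1}.
        ennreal (c * R ^ (k - 2) * \<epsilon>\<^sup>2) \<le> Lp_norm p (half_disc R) (u_diff \<epsilon> k) \<and>
        Lp_norm p (half_disc R) (u_diff \<epsilon> k) \<le> ennreal (C * R ^ (k - 2) * \<epsilon>\<^sup>2))"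
      by (rule exI[of _ c], rule conjI[OF 2(1)], rule exI[of _ C2], rule conjI[OF 2(2)], rule bexI[of _ "1/2"], rule 2(3)) simp
    show "\<forall>p::ennreal. 1 \<le> p \<longrightarrow> (\<exists>C>0. \<forall>\<epsilon>\<in>{0<..<1/2}.
        (k > 2 \<or> (1 < p \<and> p < \<infinity>) \<longrightarrow>
           Lp_norm p (half_disc R) (hessian (u_diff \<epsilon> k)) \<le> ennreal (C * \<epsilon> powr enn2real (2 / p))) \<and>
        (k = 2 \<and> p = 1 \<longrightarrow>
           Lp_norm p (half_disc R) (hessian (u_diff \<epsilon> k)) \<le> ennreal (C * \<epsilon>\<^sup>2 * \<bar>ln \<epsilon>\<bar>)))"
      by (intro allI impI Lp_norm_hessian_u_diff_le assms)
  qed (use barron_norm_u_fun_le[OF assms] Lp_norm_grad_u_diff_le[OF assms] in simp_all)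
qed

end
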